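(* Consider federated on-policy $n$-step TD-learning with linear function approximation, as described in the context, and let $v_{\hat T}=\frac1N\sum_{i=1}^Nv^i_{\hat T}$ denote the average of the parameters over the agents at the random time $\hat T$. For small enough step size $\alpha$ and $T\ge\mathcal O(\log\frac1\alpha)$, there exists a constant $c_{TDL}\in(0,1)$ (the parameter of the sampling distribution of $\hat T$) such that $$\mathbb E[\|v_{\hat T}-v^\pi\|_2^2]\le\mathcal C_1^{TD_L}\frac1\alpha(1-\alpha\mathcal C_0^{TD_L})^T+\mathcal C_2^{TD_L}\frac{\alpha\tau_\alpha^2}{N}+\mathcal C_3^{TD_L}(K-1)\alpha^2\tau_\alpha+\mathcal C_4^{TD_L}\alpha^3\tau_\alpha^2,$$ where $\mathcal C_i^{TD_L}$, $i=0,1,2,3,4$, are problem dependent constants and $\tau_\alpha=\mathcal O(\log(1/\alpha))$. Choosing $\alpha=\mathcal O\big(\frac{\log(NT)}T\big)$ and $K=T/N$, one achieves $\mathbb E[\|v_{\hat T}-v^\pi\|_2^2]\le\epsilon$ within $T=\tilde{\mathcal O}\big(\frac1{N\epsilon}\big)$ iterations.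
   Context: MDP: finite state space $\mathcal S$, finite action space $\mathcal A$, transition probabilities $\mathcal P(\cdot|s,a)$, reward $\mathcal R(s,a)$, discount factor $\gamma\in(0,1)$; $\pi$ is a policy whose induced Markov chain $(S_t,A_t)$ is irreducible and aperiodic, with stationary distribution $\mu^\pi$ on states. $\Phi\in\mathbb R^{|\mathcal S|\times d}$ is a full rank feature matrix with $s$-th row $\phi(s)$. $(\mathcal T^\pi)^n$ is the $n$-step Bellman operator, the $n$-th power of $(\mathcal T^\pi V)(s)=\sum_a\pi(a|s)[\mathcal R(s,a)+\gamma\sum_{s'}\mathcal P(s'|s,a)V(s')]$. $\Pi_\Phi$ is the projection onto the column span of $\Phi$ with respect to $\|V\|_\pi=(\sum_s\mu^\pi(s)V(s)^2)^{1/2}$. $v^\pi\in\mathbb R^d$ is the unique solution of $\Phi v^\pi=\Pi_\Phi((\mathcal T^\pi)^n\Phi v^\pi)$. Algorithm ($N$ agents, synchronization period $K$, step size $\alpha$, $T$ iterations). Each agent $i$ has $v^i_0=0$, draws $S^i_0\sim\xi$ for a given distribution $\xi$, and follows a trajectory $A^i_t\sim\pi(\cdot|S^i_t)$, $S^i_{t+1}\sim\mathcal P(\cdot|S^i_t,A^i_t)$, independently of the other agents. For $t=0,\dots,T-1$: $e^i_{t,l}=\mathcal R(S^i_l,A^i_l)+\gamma\phi(S^i_{l+1})^\top v^i_t-\phi(S^i_l)^\top v^i_t$ for $l=t,\dots,t+n-1$, and $v^i_{t+1}=v^i_t+\alpha\,\phi(S^i_t)\sum_{l=t}^{t+n-1}\gamma^{l-t}e^i_{t,l}$;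 if $K$ divides $t+1$, every $v^i_{t+1}$ is then replaced by $\frac1N\sum_jv^j_{t+1}$. Finally $\hat T$ is sampled, independently of all other randomness, with $P(\hat T=t)=c_{TDL}^{-t}/\sum_{t'=0}^{T-1}c_{TDL}^{-t'}$, $t=0,\dots,T-1$, and the output is $\frac1N\sum_iv^i_{\hat T}$. $\tilde{\mathcal O}$ ignores logarithmic terms. *)

theory Defs
  imports "HOL-Analysis.Analysis" "HOL-Probability.Probability"
begin

primrec kernel_pow :: "('x \<Rightarrow> 'x pmf) \<Rightarrow> nat \<Rightarrow> 'x \<Rightarrow> 'x pmf" where
  "kernel_pow M 0 x = return_pmf x"
| "kernel_pow M (Suc k) x = bind_pmf (kernel_pow M k x) M"

definition irreducible_chain :: "('x \<Rightarrow> 'x pmf) \<Rightarrow> bool" where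
  "irreducible_chain M \<longleftrightarrow> (\<forall>x y. \<exists>k. 0 < pmf (kernel_pow M k x) y)"

definition aperiodic_chain :: "('x \<Rightarrow> 'x pmf) \<Rightarrow> bool" where
  "aperiodic_chain M \<longleftrightarrow> (\<forall>x. Gcd {k. 0 < k \<and> 0 < pmf (kernel_pow M k x) x} = 1)"

definition stationary :: "('x \<Rightarrow> 'x pmf) \<Rightarrow> 'x pmf \<Rightarrow> bool" where
  "stationary M \<mu> \<longleftrightarrow> bind_pmf \<mu> M = \<mu>"

definition state_kernel :: "('s \<Rightarrow> 'a \<Rightarrow> 's pmf) \<Rightarrow> ('s \<Rightarrow> 'a pmf) \<Rightarrow> 's \<Rightarrow> 's pmf" where
  "state_kernel P \<pi> s = bind_pmf (\<pi> s) (P s)"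

definition state_action_kernel ::
  "('s \<Rightarrow> 'a \<Rightarrow> 's pmf) \<Rightarrow> ('s \<Rightarrow> 'a pmf) \<Rightarrow> 's \<times> 'a \<Rightarrow> ('s \<times> 'a) pmf" where
  "state_action_kernel P \<pi> x = bind_pmf (P (fst x) (snd x)) (\<lambda>s'. map_pmf (Pair s') (\<pi> s'))"

definition bellman ::
  "('s::finite \<Rightarrow> 'a::finite \<Rightarrow> 's pmf) \<Rightarrow> ('s \<Rightarrow> 'a \<Rightarrow> real) \<Rightarrow> real \<Rightarrow> ('s \<Rightarrow> 'a pmf)
    \<Rightarrow> real ^ 's \<Rightarrow> real ^ 's" where
  "bellman P R \<gamma> \<pi> V =
    (\<chi> s. \<Sum>a\<in>UNIV. pmf (\<pi> s) a * (R s a + \<gamma> * (\<Sum>s'\<in>UNIV. pmf (P s a) s' * V $ s')))"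

definition weighted_norm :: "'s::finite pmf \<Rightarrow> real ^ 's \<Rightarrow> real" where
  "weighted_norm \<mu> V = sqrt (\<Sum>s\<in>UNIV. pmf \<mu> s * (V $ s)\<^sup>2)"

text \<open>The minimizer below is unique whenever \<open>\<mu>\<close> charges every state, as the stationary
  distribution of an irreducible chain does.\<close>

definition weighted_proj :: "'s::finite pmf \<Rightarrow> real ^ 'd ^ 's \<Rightarrow> real ^ 's \<Rightarrow> real ^ 's" where
  "weighted_proj \<mu> \<Phi> V =
    arg_min (\<lambda>U. weighted_norm \<mu> (V - U)) (\<lambda>U. U \<in> span (columns \<Phi>))"

definition td_solution ::
  "('s::finite \<Rightarrow> 'a::finite \<Rightarrow> 's pmf) \<Rightarrow> ('s \<Rightarrow> 'a \<Rightarrow> real) \<Rightarrow> real \<Rightarrow> ('s \<Rightarrow> 'a pmf)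
    \<Rightarrow> 's pmf \<Rightarrow> real ^ 'd ^ 's \<Rightarrow> nat \<Rightarrow> real ^ 'd" where
  "td_solution P R \<gamma> \<pi> \<mu> \<Phi> n =
    (THE v. \<Phi> *v v = weighted_proj \<mu> \<Phi> ((bellman P R \<gamma> \<pi> ^^ n) (\<Phi> *v v)))"

text \<open>Law of the list \<open>[(S\<^sub>0, A\<^sub>0), \<dots>, (S\<^sub>L, A\<^sub>L)]\<close> (of length \<open>L + 1\<close>) for a single agent.\<close>

primrec traj_pmf ::
  "('s \<Rightarrow> 'a \<Rightarrow> 's pmf) \<Rightarrow> ('s \<Rightarrow> 'a pmf) \<Rightarrow> 's pmf \<Rightarrow> nat \<Rightarrow> ('s \<times> 'a) list pmf" where
  "traj_pmf P \<pi> \<xi> 0 = bind_pmf \<xi> (\<lambda>s. map_pmf (\<lambda>a. [(s, a)]) (\<pi> s))"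
| "traj_pmf P \<pi> \<xi> (Suc L) = bind_pmf (traj_pmf P \<pi> \<xi> L)
     (\<lambda>xs. map_pmf (\<lambda>x. xs @ [x]) (state_action_kernel P \<pi> (last xs)))"

definition td_error ::
  "('s \<Rightarrow> 'a \<Rightarrow> real) \<Rightarrow> real \<Rightarrow> real ^ 'd ^ 's \<Rightarrow> ('s \<times> 'a) list \<Rightarrow> real ^ 'd \<Rightarrow> nat \<Rightarrow> real" where
  "td_error R \<gamma> \<Phi> xs v l =
    R (fst (xs ! l)) (snd (xs ! l)) + \<gamma> * (\<Phi> $ fst (xs ! Suc l) \<bullet> v) - \<Phi> $ fst (xs ! l) \<bullet> v"

definition local_update ::
  "('s \<Rightarrow> 'a \<Rightarrow> real) \<Rightarrow> real \<Rightarrow> real ^ 'd ^ 's \<Rightarrow> nat \<Rightarrow> real \<Rightarrow> ('s \<times> 'a) list \<Rightarrow> nat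
    \<Rightarrow> real ^ 'd \<Rightarrow> real ^ 'd" where
  "local_update R \<gamma> \<Phi> n \<alpha> xs t v =
    v + (\<alpha> * (\<Sum>l=t..<t + n. \<gamma> ^ (l - t) * td_error R \<gamma> \<Phi> xs v l)) *\<^sub>R (\<Phi> $ fst (xs ! t))"

definition agent_mean :: "nat \<Rightarrow> (nat \<Rightarrow> real ^ 'd) \<Rightarrow> real ^ 'd" where
  "agent_mean N u = (1 / real N) *\<^sub>R (\<Sum>j<N. u j)"

text \<open>\<open>fed_td \<dots> \<omega> t i\<close> is the parameter of agent \<open>i\<close> at time \<open>t\<close> (after a possible
  synchronization), where \<open>\<omega> i\<close> is the trajectory of agent \<open>i\<close> and agents are numbered from 0.\<close>

primrec fed_td ::
  "('s \<Rightarrow> 'a \<Rightarrow> real) \<Rightarrow> real \<Rightarrow> real ^ 'd ^ 's \<Rightarrow> nat \<Rightarrow> real \<Rightarrow> nat \<Rightarrow> nat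
    \<Rightarrow> (nat \<Rightarrow> ('s \<times> 'a) list) \<Rightarrow> nat \<Rightarrow> nat \<Rightarrow> real ^ 'd" where
  "fed_td R \<gamma> \<Phi> n \<alpha> N K \<omega> 0 = (\<lambda>i. 0)"
| "fed_td R \<gamma> \<Phi> n \<alpha> N K \<omega> (Suc t) =
    (let u = (\<lambda>i. local_update R \<gamma> \<Phi> n \<alpha> (\<omega> i) t (fed_td R \<gamma> \<Phi> n \<alpha> N K \<omega> t i))
     in if K dvd Suc t then (\<lambda>i. agent_mean N u) else u)"

text \<open>The law of the random output time, with weight proportional to \<open>c\<^sup>-\<^sup>t\<close> on \<open>{0, \<dots>, T - 1}\<close>.\<close>

definition output_time_pmf :: "real \<Rightarrow> nat \<Rightarrow> nat pmf" where
  "output_time_pmf c T =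
    embed_pmf (\<lambda>t. if t < T then inverse c ^ t / (\<Sum>t'<T. inverse c ^ t') else 0)"

lemma pmf_output_time:
  assumes "0 < c" "1 \<le> T"
  shows "pmf (output_time_pmf c T) t =
    (if t < T then inverse c ^ t / (\<Sum>t'<T. inverse c ^ t') else 0)"
proof -
  let ?Z = "\<Sum>t'<T. inverse c ^ t'"
  let ?f = "\<lambda>t. if t < T then inverse c ^ t / ?Z else 0"
  have Z: "0 < ?Z"
    using assms by (intro sum_pos) (auto simp: lessThan_empty_iff)
  have nonneg: "0 \<le> ?f t" for t
    using assms(1) Z by simp
  have "(\<integral>\<^sup>+ t. ennreal (?f t) \<partial>count_space UNIV) = (\<Sum>t<T. ennreal (?f t))"
    by (subst nn_integral_count_space'[of "{..<T}"]) auto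
  also have "\<dots> = ennreal (\<Sum>t<T. ?f t)"
    by (rule sum_ennreal) (rule nonneg)
  also have "(\<Sum>t<T. ?f t) = 1"
    using Z by (simp add: sum_divide_distrib[symmetric])
  finally have "(\<integral>\<^sup>+ t. ennreal (?f t) \<partial>count_space UNIV) = 1"
    by simp
  from pmf_embed_pmf[of ?f, OF nonneg this] show ?thesis
    unfolding output_time_pmf_def .
qed

text \<open>The mean squared distance of the output to \<open>v\<close>. The trajectories of the \<open>N\<close> agents and the
  output time are independent; \<open>T\<close> iterations read the states with indices \<open>0, \<dots>, T + n - 1\<close>.\<close>

definition output_mse ::
  "('s \<Rightarrow> 'a \<Rightarrow> 's pmf) \<Rightarrow> ('s \<Rightarrow> 'a \<Rightarrow> real) \<Rightarrow> real \<Rightarrow> ('s \<Rightarrow> 'a pmf) \<Rightarrow> 's pmf \<Rightarrow> real ^ 'd ^ 's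
    \<Rightarrow> nat \<Rightarrow> real \<Rightarrow> nat \<Rightarrow> nat \<Rightarrow> nat \<Rightarrow> real \<Rightarrow> real ^ 'd \<Rightarrow> real" where
  "output_mse P R \<gamma> \<pi> \<xi> \<Phi> n \<alpha> N K T c v =
    measure_pmf.expectation
      (pair_pmf (Pi_pmf {..<N} [] (\<lambda>_. traj_pmf P \<pi> \<xi> (T + n - 1))) (output_time_pmf c T))
      (\<lambda>(\<omega>, t). (norm (agent_mean N (fed_td R \<gamma> \<Phi> n \<alpha> N K \<omega> t) - v))\<^sup>2)"

end

theory Submission
  imports Defs "HOL-Real_Asymp.Real_Asymp"
begin

text \<open>
  Write \<open>\<delta>\<^sub>i\<close> for the error of agent \<open>i\<close>. The update direction is a function \<open>f\<close> of the last \<open>n + 1\<close>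
  state-action pairs of the agent and of \<open>\<delta>\<^sub>i\<close>; its stationary mean \<open>B \<delta>\<^sub>i\<close> is linear and
  dissipative because the Bellman operator contracts the stationary norm. A solution \<open>g\<close> of the
  Poisson equation for \<open>f\<close> turns the Markovian noise into martingale noise: the corrected
  parameters \<open>z\<^sub>i = \<delta>\<^sub>i + \<alpha> g\<^sub>i\<close> and their mean \<open>y\<close> follow the mean field up to higher-order
  remainders and independent martingale increments, whose variance is divided by \<open>N\<close> in \<open>y\<close>.

  The Lyapunov function \<open>|y|\<^sup>2 + \<lambda> \<alpha> (\<Sum>\<^sub>i |z\<^sub>i|\<^sup>2) / N\<close> contracts by a factor \<open>1 - \<kappa> \<alpha>\<close> per step
  up to \<open>O(\<alpha>\<^sup>2 / N + \<alpha>\<^sup>3)\<close>: a synchronization displaces \<open>y\<close>, and this is paid for by the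
  dispersion of the parameters that it removes from the second term. Every iterate thus has mean
  squared error \<open>O((1 - \<kappa> \<alpha>)\<^sup>t + \<alpha> / N + \<alpha>\<^sup>2)\<close>, uniformly in \<open>K\<close>. If \<open>K = 1\<close>, the second term
  is not needed, the remainders involve only averages over the agents, and mixing of the chain
  improves \<open>\<alpha>\<^sup>2\<close> to \<open>\<alpha>\<^sup>3\<close>.
\<close>

subsection \<open>Expectations over finitely supported distributions\<close>

text \<open>Let a be the step size and D the dispersion of the parameters. The weight of order a in
  the Lyapunov function is forced from two sides. A synchronization moves y by a q, where |q|^2 is
  at most L^2 D; splitting off this displacement by Young's inequality without losing the
  contraction of |y|^2 costs order a D, and the D/2 released by the energy repays it at a weight of
  order a. A heavier weight would let in the noise a^2 of the individual agents, which no averaging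
  reduces; at weight a it adds only a^3 per step, that is a^2 after division by the rate. The
  claimed bound can absorb this a^2 in its third term only if K - 1 is at least 1. At K = 1 that
  term vanishes, so full synchronization is treated on its own. The Poisson equation holds at every
  step and replaces conditioning on a delayed time; \<open>\<tau>\<close> is ln(1/\<alpha>) rounded
  up, and being at least 1 it may multiply the error terms. The factor 1/\<alpha> of the transient
  is due to the random output time.\<close>

abbreviation "E \<equiv> measure_pmf.expectation"

lemma expectation_bind_finite:
  fixes h :: "'b \<Rightarrow> 'c::{banach, second_countable_topology}"
  assumes "finite (set_pmf p)" "\<And>x. x \<in> set_pmf p \<Longrightarrow> finite (set_pmf (q x))"
  shows "E (bind_pmf p q) h
    = E p (\<lambda>x. E (q x) h)"
  using assms
  by (subst pmf_expectation_bind[of "set_pmf p"])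
     (auto simp: integral_measure_pmf[where A = "set_pmf p"])

lemma expectation_mono_finite:
  fixes f g :: "'b \<Rightarrow> real"
  assumes "finite (set_pmf p)" "\<And>x. x \<in> set_pmf p \<Longrightarrow> f x \<le> g x"
  shows "E p f \<le> E p g"
  using assms by (intro integral_mono_AE integrable_measure_pmf_finite) (auto simp: AE_measure_pmf_iff)

lemma expectation_cong:
  fixes f g :: "'b \<Rightarrow> 'c::{banach, second_countable_topology}"
  assumes "\<And>x. x \<in> set_pmf p \<Longrightarrow> f x = g x"
  shows "E p f = E p g"
  using assms by (intro integral_cong_AE) (auto simp: AE_measure_pmf_iff)

lemma norm_expectation_le:
  fixes f :: "'b \<Rightarrow> 'c::{banach, second_countable_topology}"
  assumes "finite (set_pmf p)" "\<And>x. x \<in> set_pmf p \<Longrightarrow> norm (f x) \<le> B"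
  shows "norm (E p f) \<le> B"
proof -
  have "norm (E p f) \<le> E p (\<lambda>x. norm (f x))"
    by (rule integral_norm_bound)
  also have "\<dots> \<le> E p (\<lambda>x. B)"
    using assms by (intro expectation_mono_finite)
  finally show ?thesis by simp
qed

lemma expectation_finite_type:
  fixes h :: "'x::finite \<Rightarrow> 'c::{banach, second_countable_topology}"
  shows "E p h = (\<Sum>x\<in>UNIV. pmf p x *\<^sub>R h x)"
  by (subst integral_measure_pmf[of UNIV]) auto

lemma finite_set_Pi_pmf:
  assumes "finite A" "\<And>x. x \<in> A \<Longrightarrow> finite (set_pmf (p x))"
  shows "finite (set_pmf (Pi_pmf A d p))"
  using assms by (subst set_Pi_pmf) (auto intro!: finite_PiE_dflt)

text \<open>The variance is at most the second moment, so \<open>\<zeta>\<close> need not be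
  centred: only the cross term with its mean matters, and completing the square costs
  nothing.\<close>

lemma expectation_norm_add_square_le:
  fixes \<zeta> :: "'w \<Rightarrow> 'v::euclidean_space"
  assumes "finite (set_pmf p)" "\<And>x. x \<in> set_pmf p \<Longrightarrow> (norm (\<zeta> x))\<^sup>2 \<le> b"
  shows "E p (\<lambda>x. (norm (a + \<zeta> x))\<^sup>2)
    \<le> (norm (a + E p \<zeta>))\<^sup>2 + b"
proof -
  note int = integrable_measure_pmf_finite[OF assms(1)]
  have "E p (\<lambda>x. (norm (a + \<zeta> x))\<^sup>2)
    = E p (\<lambda>x. (norm a)\<^sup>2 + 2 * (a \<bullet> \<zeta> x) + (norm (\<zeta> x))\<^sup>2)"
    by (intro expectation_cong) (simp add: power2_norm_eq_inner inner_simps inner_commute)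
  also have "\<dots> = (norm a)\<^sup>2 + 2 * (a \<bullet> E p \<zeta>)
      + E p (\<lambda>x. (norm (\<zeta> x))\<^sup>2)"
    by (simp add: int)
  also have "\<dots> \<le> (norm a)\<^sup>2 + 2 * (a \<bullet> E p \<zeta>) + b"
    using expectation_mono_finite[OF assms(1), of "\<lambda>x. (norm (\<zeta> x))\<^sup>2" "\<lambda>x. b"] assms(2) by simp
  also have "\<dots> \<le> (norm (a + E p \<zeta>))\<^sup>2 + b"
    by (simp add: power2_norm_eq_inner inner_simps inner_commute)
  finally show ?thesis .
qed

lemma expectation_Pi_pmf_component:
  fixes h :: "'b \<Rightarrow> 'c::{banach, second_countable_topology}"
  assumes "finite I" "i \<in> I"
  shows "E (Pi_pmf I d p) (\<lambda>x. h (x i)) = E (p i) h"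
proof -
  have "E (Pi_pmf I d p) (\<lambda>x. h (x i))
      = E (map_pmf (\<lambda>f. f i) (Pi_pmf I d p)) h" by simp
  then show ?thesis using assms by (simp only: Pi_pmf_component) simp
qed

text \<open>Independence makes the second moments add. With a factor 1/N in each
  \<open>\<zeta> i\<close>, N terms of size 1/N^2 give 1/N; every variance reduction by the number
  of agents originates here. The induction integrates out one coordinate at a time.\<close>

lemma expectation_norm_sum_square_Pi_pmf_le:
  fixes \<zeta> :: "'i \<Rightarrow> 'w \<Rightarrow> 'v::euclidean_space"
  assumes "finite I" "\<And>i. i \<in> I \<Longrightarrow> finite (set_pmf (p i))"
    "\<And>i x. i \<in> I \<Longrightarrow> x \<in> set_pmf (p i) \<Longrightarrow> (norm (\<zeta> i x))\<^sup>2 \<le> b i"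
  shows "E (Pi_pmf I d p) (\<lambda>x. (norm (a + (\<Sum>i\<in>I. \<zeta> i (x i))))\<^sup>2)
    \<le> (norm (a + (\<Sum>i\<in>I. E (p i) (\<zeta> i))))\<^sup>2 + (\<Sum>i\<in>I. b i)"
  using assms
proof (induction I arbitrary: a rule: finite_induct)
  case empty
  then show ?case by simp
next
  case (insert j I)
  let ?m = "\<lambda>i. E (p i) (\<zeta> i)"
  have fj: "finite (set_pmf (p j))" using insert by auto
  have fI: "finite (set_pmf (Pi_pmf I d p))" using insert by (intro finite_set_Pi_pmf) auto
  have "E (Pi_pmf (insert j I) d p)
      (\<lambda>x. (norm (a + (\<Sum>i\<in>insert j I. \<zeta> i (x i))))\<^sup>2)
    = E (p j) (\<lambda>y. E (Pi_pmf I d p)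
      (\<lambda>x. (norm (a + (\<zeta> j y + (\<Sum>i\<in>I. \<zeta> i (if i = j then y else x i)))))\<^sup>2))"
    using insert.hyps fj fI
    by (simp add: Pi_pmf_insert' expectation_bind_finite fun_upd_def)
  also have "\<dots> = E (p j) (\<lambda>y. E (Pi_pmf I d p)
      (\<lambda>x. (norm ((a + \<zeta> j y) + (\<Sum>i\<in>I. \<zeta> i (x i))))\<^sup>2))"
  proof -
    have "(\<Sum>i\<in>I. \<zeta> i (if i = j then y else x i)) = (\<Sum>i\<in>I. \<zeta> i (x i))" for y x
      using insert.hyps by (intro sum.cong) auto
    then show ?thesis by (simp add: add.assoc)
  qed
  also have "\<dots> \<le> E (p j)
      (\<lambda>y. (norm ((a + \<zeta> j y) + (\<Sum>i\<in>I. ?m i)))\<^sup>2 + (\<Sum>i\<in>I. b i))"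
    using insert by (intro expectation_mono_finite fj insert.IH) auto
  also have "\<dots> = E (p j)
      (\<lambda>y. (norm ((a + (\<Sum>i\<in>I. ?m i)) + \<zeta> j y))\<^sup>2) + (\<Sum>i\<in>I. b i)"
    by (simp add: integrable_measure_pmf_finite[OF fj] algebra_simps)
  also have "\<dots> \<le> (norm ((a + (\<Sum>i\<in>I. ?m i)) + ?m j))\<^sup>2 + b j + (\<Sum>i\<in>I. b i)"
    using insert by (intro add_right_mono expectation_norm_add_square_le fj) auto
  finally show ?case using insert.hyps by (simp add: algebra_simps)
qed

subsection \<open>Mixing of finite Markov chains\<close>

lemma kernel_pow_add: "kernel_pow M (j + k) x = bind_pmf (kernel_pow M j x) (kernel_pow M k)"
proof (induction k)
  case (Suc k)
  have "kernel_pow M (j + Suc k) x = bind_pmf (bind_pmf (kernel_pow M j x) (kernel_pow M k)) M"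
    by (simp add: Suc)
  then show ?case by (simp add: bind_assoc_pmf)
qed (simp add: bind_return_pmf')

lemma kernel_pow_1: "kernel_pow M (Suc 0) = M"
  by (simp add: bind_return_pmf fun_eq_iff)

lemma set_kernel_pow_add:
  "y \<in> set_pmf (kernel_pow M j x) \<Longrightarrow> z \<in> set_pmf (kernel_pow M k y) \<Longrightarrow>
    z \<in> set_pmf (kernel_pow M (j + k) x)"
  by (auto simp: kernel_pow_add)

text \<open>A numerical semigroup of gcd 1 is cofinite. The smallest positive gap d between two
  elements b and b + d divides every element, by division with remainder, so d = 1; from b and b + 1
  every k >= b^2 is then reached.\<close>

lemma eventually_mem_additive_set:
  fixes S :: "nat set"
  assumes add: "\<And>a b. a \<in> S \<Longrightarrow> b \<in> S \<Longrightarrow> a + b \<in> S"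
    and pos: "\<And>a. a \<in> S \<Longrightarrow> 0 < a" and Gcd: "Gcd S = 1"
  shows "\<exists>m. \<forall>k\<ge>m. k \<in> S"
proof -
  have mult: "q * a \<in> S" if "a \<in> S" "0 < q" for q a
    using that(2)
  proof (induction q)
    case (Suc q)
    then show ?case using that(1) add by (cases "q = 0") auto
  qed simp
  define D where "D = (\<lambda>d. 0 < d \<and> (\<exists>b\<in>S. b + d \<in> S))"
  have "S \<noteq> {}" using Gcd by auto
  then obtain s where "s \<in> S" by auto
  then have "D s" using add pos by (auto simp: D_def)
  then have D: "D (LEAST d. D d)" by (rule LeastI)
  define d where "d = (LEAST d. D d)"
  have least: "d \<le> e" if "D e" for e
    unfolding d_def using that by (rule Least_le)
  obtain b where b: "b \<in> S" "b + d \<in> S" and d: "0 < d"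
    using D by (auto simp: D_def d_def)
  have "d dvd s" if s: "s \<in> S" for s
  proof (rule ccontr)
    assume "\<not> d dvd s"
    then have r: "0 < s mod d" by (simp add: dvd_eq_mod_eq_0)
    have "D s" using s add pos by (auto simp: D_def)
    then have "d \<le> s" by (rule least)
    then have q: "0 < s div d" using d by (simp add: div_greater_zero_iff)
    \<comment> \<open>This exhibits s mod d as the difference of two elements of S, so a nonzero
      remainder would be a gap smaller than d.\<close>
    have "(s div d) * (b + d) + s mod d = s + (s div d) * b"
      using div_mult_mod_eq[of s d] by (simp add: distrib_left)
    moreover have "(s div d) * (b + d) \<in> S" "s + (s div d) * b \<in> S"
      using mult b q s add by auto
    ultimately have "D (s mod d)" using r by (metis D_def)
    then have "d \<le> s mod d" by (rule least)
    then show False using mod_less_divisor[OF d, of s] by linarith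
  qed
  then have "d dvd Gcd S" by (intro Gcd_greatest)
  then have "d = 1" using Gcd by simp
  then have b1: "Suc b \<in> S" using b by simp
  have b0: "0 < b" using pos b by auto
  have "k \<in> S" if k: "b * b \<le> k" for k
  proof -
    have r: "k mod b < b" using b0 by simp
    have "b \<le> k div b" using k b0 by (simp add: less_eq_div_iff_mult_less_eq)
    then have q: "k mod b < k div b" using r by linarith
    \<comment> \<open>k mod b copies of b + 1 produce the remainder; k >= b^2 leaves a positive
      number of copies of b for the rest.\<close>
    have "(k div b - k mod b) * b + k mod b * Suc b = k"
      using q div_mult_mod_eq[of k b] by (simp add: diff_mult_distrib)
    moreover have "(k div b - k mod b) * b \<in> S" using mult b(1) q by simp
    moreover have "k mod b * Suc b \<in> S" if "0 < k mod b" using mult b1 that by blast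
    ultimately show ?thesis using add by (cases "k mod b = 0") (metis add.right_neutral mult_0, metis gr0I)
  qed
  then show ?thesis by blast
qed

text \<open>The return times to x form an additive set of gcd 1, so x can be held in a loop for any
  long enough time before travelling to y; finiteness gives one length for all pairs.\<close>

lemma kernel_pow_eventually_positive:
  fixes M :: "'x::finite \<Rightarrow> 'x pmf"
  assumes "irreducible_chain M" "aperiodic_chain M"
  shows "\<exists>m>0. \<forall>x y. 0 < pmf (kernel_pow M m x) y"
proof -
  have "\<exists>m. \<forall>k\<ge>m. x \<in> set_pmf (kernel_pow M k x)" for x
  proof -
    let ?S = "{k. 0 < k \<and> 0 < pmf (kernel_pow M k x) x}"
    have "\<exists>m. \<forall>k\<ge>m. k \<in> ?S"
    proof (rule eventually_mem_additive_set)
      show "Gcd ?S = 1" using assms(2) by (simp add: aperiodic_chain_def)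
    qed (auto simp: pmf_positive_iff intro: set_kernel_pow_add)
    then show ?thesis by (auto simp: pmf_positive_iff)
  qed
  then obtain r where r: "\<And>x k. r x \<le> k \<Longrightarrow> x \<in> set_pmf (kernel_pow M k x)" by metis
  have "\<forall>x y. \<exists>k. y \<in> set_pmf (kernel_pow M k x)"
    using assms(1) by (simp add: irreducible_chain_def pmf_positive_iff)
  then obtain h where h: "\<And>x y. y \<in> set_pmf (kernel_pow M (h x y) x)" by metis
  \<comment> \<open>Sums over the finite type stand in for the maxima of the thresholds
    \<open>r\<close> and the travel times \<open>h\<close>.\<close>
  define m where "m = Suc ((\<Sum>x\<in>UNIV. r x) + (\<Sum>x\<in>UNIV. \<Sum>y\<in>UNIV. h x y))"
  have "y \<in> set_pmf (kernel_pow M m x)" for x y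
  proof -
    have "r x \<le> (\<Sum>x\<in>UNIV. r x)" by (intro member_le_sum) auto
    moreover have "h x y \<le> (\<Sum>y\<in>UNIV. h x y)" by (intro member_le_sum) auto
    moreover have "(\<Sum>y\<in>UNIV. h x y) \<le> (\<Sum>x\<in>UNIV. \<Sum>y\<in>UNIV. h x y)"
      by (rule member_le_sum[of x UNIV "\<lambda>x. \<Sum>y\<in>UNIV. h x y"]) auto
    ultimately have "r x \<le> m - h x y" "m = m - h x y + h x y"
      unfolding m_def by linarith+
    then show ?thesis using set_kernel_pow_add[OF r h] by metis
  qed
  moreover have "0 < m" by (simp add: m_def)
  ultimately show ?thesis unfolding pmf_positive_iff by blast
qed

lemma expectation_bounds:
  fixes f :: "'x::finite \<Rightarrow> real"
  assumes "\<And>x. lo \<le> f x" "\<And>x. f x \<le> hi"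
  shows "lo \<le> E p f" "E p f \<le> hi"
  using expectation_mono_finite[of p "\<lambda>_. lo" f] expectation_mono_finite[of p f "\<lambda>_. hi"] assms
  by auto

text \<open>Doeblin's argument: a kernel with all entries at least \<open>\<eta>\<close> shrinks oscillations.\<close>

lemma expectation_contracts_oscillation:
  fixes f :: "'x::finite \<Rightarrow> real"
  assumes f: "\<And>x. lo \<le> f x" "\<And>x. f x \<le> hi" and \<eta>: "\<And>x y. \<eta> \<le> pmf (q x) y"
  shows "\<exists>lo' hi'. hi' - lo' = (1 - \<eta>) * (hi - lo) \<and>
    (\<forall>x. lo' \<le> E (q x) f \<and> E (q x) f \<le> hi')"
proof -
  \<comment> \<open>A single column z suffices: every law q x puts mass at least \<eta> on it, which
    pulls all the averages towards the same value f z.\<close>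
  fix z :: 'x
  have bound: "\<eta> * h z \<le> E (q x) h" if "\<And>y. 0 \<le> h y" for h :: "'x \<Rightarrow> real" and x
  proof -
    have "\<eta> * h z \<le> pmf (q x) z *\<^sub>R h z" using \<eta> that by (simp add: mult_right_mono)
    also have "\<dots> \<le> (\<Sum>y\<in>UNIV. pmf (q x) y *\<^sub>R h y)"
      using that by (intro member_le_sum[of z UNIV "\<lambda>y. pmf (q x) y *\<^sub>R h y"]) auto
    also have "\<dots> = E (q x) h" by (subst integral_measure_pmf[of UNIV]) auto
    finally show ?thesis .
  qed
  have "\<eta> * (hi - f z) \<le> hi - E (q x) f" for x
    using bound[of "\<lambda>y. hi - f y" x] f by (simp add: integrable_measure_pmf_finite)
  moreover have "\<eta> * (f z - lo) \<le> E (q x) f - lo" for x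
    using bound[of "\<lambda>y. f y - lo" x] f by (simp add: integrable_measure_pmf_finite)
  ultimately show ?thesis
    by (intro exI[of _ "lo + \<eta> * (f z - lo)"] exI[of _ "hi - \<eta> * (hi - f z)"])
       (auto simp: algebra_simps)
qed

lemma stationary_kernel_pow: "stationary M \<nu> \<Longrightarrow> bind_pmf \<nu> (kernel_pow M k) = \<nu>"
proof (induction k)
  case 0
  have "kernel_pow M 0 = return_pmf" by (simp add: fun_eq_iff)
  then show ?case by (simp add: bind_return_pmf')
next
  case (Suc k)
  have "kernel_pow M (Suc k) = (\<lambda>x. bind_pmf (kernel_pow M k x) M)" by (simp add: fun_eq_iff)
  then have "bind_pmf \<nu> (kernel_pow M (Suc k)) = bind_pmf (bind_pmf \<nu> (kernel_pow M k)) M"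
    by (simp only: bind_assoc_pmf)
  then show ?case using Suc by (simp only: stationary_def)
qed

lemma stationary_positive:
  fixes M :: "'x::finite \<Rightarrow> 'x pmf"
  assumes "irreducible_chain M" "stationary M \<nu>"
  shows "0 < pmf \<nu> y"
proof -
  obtain x where x: "x \<in> set_pmf \<nu>" using set_pmf_not_empty[of \<nu>] by blast
  obtain k where "y \<in> set_pmf (kernel_pow M k x)"
    using assms(1) by (auto simp: irreducible_chain_def pmf_positive_iff)
  then have "y \<in> set_pmf (bind_pmf \<nu> (kernel_pow M k))" using x by auto
  then show ?thesis by (simp add: stationary_kernel_pow[OF assms(2)] pmf_positive_iff)
qed

text \<open>Every m steps the range over x of the expectations started at x shrinks by the factor 1
  - \<eta>. The stationary value is an average of these expectations, so it lies in the same range,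
  whose length bounds the distance.\<close>

lemma geometric_mixing:
  fixes M :: "'x::finite \<Rightarrow> 'x pmf"
  assumes "irreducible_chain M" "aperiodic_chain M" and st: "stationary M \<nu>"
  obtains C \<rho> :: real where "0 < C" "0 < \<rho>" "\<rho> < 1"
    "\<And>k x y. \<bar>pmf (kernel_pow M k x) y - pmf \<nu> y\<bar> \<le> C * \<rho> ^ k"
proof -
  obtain m where m: "0 < m" "\<And>x y. 0 < pmf (kernel_pow M m x) y"
    using kernel_pow_eventually_positive[OF assms(1,2)] by blast
  \<comment> \<open>The entry 1/2 keeps 1 - \<eta> away from 0, so that its root and its reciprocal
    can be used.\<close>
  define \<eta> where "\<eta> = Min (insert (1 / 2) (range (\<lambda>(x, y). pmf (kernel_pow M m x) y)))"
  have \<eta>: "0 < \<eta>" "\<eta> \<le> 1 / 2"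
    unfolding \<eta>_def using m(2) by (auto simp: Min_gr_iff)
  have \<eta>_le: "\<eta> \<le> pmf (kernel_pow M m x) y" for x y
    unfolding \<eta>_def by (intro Min_le) (auto intro: range_eqI[of _ _ "(x, y)"])
  have E_add: "E (kernel_pow M (j + k) x) f
    = E (kernel_pow M j x) (\<lambda>z. E (kernel_pow M k z) f)"
    for j k x and f :: "'x \<Rightarrow> real"
    unfolding kernel_pow_add by (intro expectation_bind_finite) auto
  have osc: "\<exists>lo hi. hi - lo = (1 - \<eta>) ^ j \<and>
      (\<forall>x. lo \<le> E (kernel_pow M (m * j) x) f \<and>
        E (kernel_pow M (m * j) x) f \<le> hi)"
    if f: "\<And>x. 0 \<le> f x" "\<And>x. f x \<le> 1" for f :: "'x \<Rightarrow> real" and j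
  proof (induction j)
    case 0
    show ?case using f by (intro exI[of _ 0] exI[of _ 1]) simp
  next
    case (Suc j)
    then obtain lo hi where lh: "hi - lo = (1 - \<eta>) ^ j"
      "\<And>x. lo \<le> E (kernel_pow M (m * j) x) f"
      "\<And>x. E (kernel_pow M (m * j) x) f \<le> hi" by blast
    show ?case
      unfolding mult_Suc_right E_add
      using expectation_contracts_oscillation[OF lh(2,3) \<eta>_le] by (simp add: lh(1))
  qed
  define \<rho> where "\<rho> = root m (1 - \<eta>)"
  have \<rho>: "0 < \<rho>" "\<rho> < 1" "\<rho> ^ m = 1 - \<eta>"
    unfolding \<rho>_def using \<eta> m(1) by auto
  have bound: "\<bar>pmf (kernel_pow M k x) y - pmf \<nu> y\<bar> \<le> 1 / (1 - \<eta>) * \<rho> ^ k" for k x y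
  proof -
    let ?f = "\<lambda>z. indicator {y} z :: real"
    let ?j = "k div m"
    obtain lo hi where lh: "hi - lo = (1 - \<eta>) ^ ?j"
      "\<And>x. lo \<le> E (kernel_pow M (m * ?j) x) ?f"
      "\<And>x. E (kernel_pow M (m * ?j) x) ?f \<le> hi"
      using osc[of ?f ?j] by auto
    \<comment> \<open>The k mod m leftover steps come first and only average values that already lie
      between lo and hi.\<close>
    have "lo \<le> E (kernel_pow M (k mod m + m * ?j) x) ?f"
      "E (kernel_pow M (k mod m + m * ?j) x) ?f \<le> hi" for x
      unfolding E_add by (rule expectation_bounds[OF lh(2,3)])+
    then have bounds: "lo \<le> E (kernel_pow M k x) ?f"
      "E (kernel_pow M k x) ?f \<le> hi" for x
      by simp_all
    have "E \<nu> ?f = E \<nu> (\<lambda>x. E (kernel_pow M k x) ?f)"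
      by (subst stationary_kernel_pow[OF st, of k, symmetric], rule expectation_bind_finite) auto
    then have "lo \<le> E \<nu> ?f" "E \<nu> ?f \<le> hi"
      using expectation_bounds[OF bounds, of \<nu>] by auto
    with bounds[of x] lh(1) have "\<bar>pmf (kernel_pow M k x) y - pmf \<nu> y\<bar> \<le> (1 - \<eta>) ^ ?j"
      by (simp add: measure_pmf_single abs_le_iff)
    also have "\<dots> = \<rho> ^ (m * ?j)" by (simp add: power_mult \<rho>(3))
    also have "\<dots> \<le> 1 / (1 - \<eta>) * \<rho> ^ k"
    proof -
      \<comment> \<open>Rounding k down to a multiple of m loses at most m steps, that is a factor 1
        / (1 - \<eta>).\<close>
      have "\<rho> ^ (m * ?j) * (1 - \<eta>) = \<rho> ^ (m * ?j + m)" by (simp add: power_add \<rho>(3))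
      also have "\<dots> \<le> \<rho> ^ k"
      proof (rule power_decreasing)
        show "k \<le> m * ?j + m"
          using mult_div_mod_eq[of m k] mod_less_divisor[OF m(1), of k] by linarith
      qed (use \<rho> in auto)
      finally show ?thesis using \<eta> by (simp add: field_simps)
    qed
    finally show ?thesis .
  qed
  show ?thesis by (rule that[of "1 / (1 - \<eta>)" \<rho>]) (use \<eta> \<rho> bound in auto)
qed

text \<open>The witness is the deviation matrix, the sum over k of M^k - 1 \<nu>^T, which converges
  by geometric mixing. Applying M shifts the series by one, so only its term at k = 0
  remains.\<close>

lemma deviation_kernel:
  fixes M :: "'x::finite \<Rightarrow> 'x pmf"
  assumes "irreducible_chain M" "aperiodic_chain M" and st: "stationary M \<nu>"
  obtains \<kappa> :: "'x \<Rightarrow> 'x \<Rightarrow> real" where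
    "\<And>x y. \<kappa> x y - E (M x) (\<lambda>z. \<kappa> z y) = (if x = y then 1 else 0) - pmf \<nu> y"
proof -
  obtain C \<rho> :: real where C: "0 < C" "0 < \<rho>" "\<rho> < 1"
    "\<And>k x y. \<bar>pmf (kernel_pow M k x) y - pmf \<nu> y\<bar> \<le> C * \<rho> ^ k"
    using geometric_mixing[OF assms] by blast
  let ?d = "\<lambda>x y k. pmf (kernel_pow M k x) y - pmf \<nu> y"
  have summ: "summable (?d x y)" for x y
    by (rule summable_comparison_test[of _ "\<lambda>k. C * \<rho> ^ k"]) (use C in \<open>auto intro!: summable_mult summable_geometric\<close>)
  have "(\<Sum>k. ?d x y k) - E (M x) (\<lambda>z. \<Sum>k. ?d z y k)
    = (if x = y then 1 else 0) - pmf \<nu> y" for x y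
  proof -
    have Suc: "?d x y (Suc k) = (\<Sum>z\<in>UNIV. pmf (M x) z * ?d z y k)" for k
    proof -
      have "pmf (kernel_pow M (Suc k) x) y = pmf (bind_pmf (M x) (kernel_pow M k)) y"
        using kernel_pow_add[of M "Suc 0" k x] by (simp add: kernel_pow_1)
      also have "\<dots> = (\<Sum>z\<in>UNIV. pmf (M x) z * pmf (kernel_pow M k z) y)"
        unfolding pmf_bind by (subst integral_measure_pmf[of UNIV]) auto
      finally show ?thesis
        by (simp add: right_diff_distrib sum_subtractf sum_distrib_right[symmetric] sum_pmf_eq_1)
    qed
    have "E (M x) (\<lambda>z. \<Sum>k. ?d z y k) = (\<Sum>z\<in>UNIV. pmf (M x) z * (\<Sum>k. ?d z y k))"
      by (subst integral_measure_pmf[of UNIV]) auto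
    also have "\<dots> = (\<Sum>z\<in>UNIV. \<Sum>k. pmf (M x) z * ?d z y k)"
      by (intro sum.cong suminf_mult[symmetric] summ refl)
    also have "\<dots> = (\<Sum>k. \<Sum>z\<in>UNIV. pmf (M x) z * ?d z y k)"
      by (intro suminf_sum[symmetric] summable_mult summ)
    also have "\<dots> = (\<Sum>k. ?d x y (Suc k))" unfolding Suc ..
    also have "\<dots> = (\<Sum>k. ?d x y k) - ?d x y 0" by (rule suminf_split_head[OF summ])
    finally show ?thesis by (simp add: pmf_return indicator_def)
  qed
  then show ?thesis by (rule that)
qed

subsection \<open>The Poisson equation for functions of a window of the chain\<close>

text \<open>The transition operator of the chain of histories: a history grows by one entry, drawn
  from the kernel at its last entry.\<close>

definition hop :: "('x \<Rightarrow> 'x pmf) \<Rightarrow> ('x list \<Rightarrow> 'v::euclidean_space) \<Rightarrow> 'x list \<Rightarrow> 'v" where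
  "hop Q F xs = E (Q (last xs)) (\<lambda>x. F (xs @ [x]))"

text \<open>\<open>F\<close> reads only the last n + 1 entries; on shorter lists it is left
  unconstrained.\<close>

definition window :: "nat \<Rightarrow> ('x list \<Rightarrow> 'v) \<Rightarrow> bool" where
  "window n F \<longleftrightarrow> (\<forall>ys xs. length xs = Suc n \<longrightarrow> F (ys @ xs) = F xs)"

lemma windowD: "window n F \<Longrightarrow> length xs = Suc n \<Longrightarrow> F (ys @ xs) = F xs"
  by (simp add: window_def)

lemma window_mono:
  assumes "window j F" "j \<le> n"
  shows "window n F"
  unfolding window_def
proof (intro allI impI)
  fix ys xs :: "'a list" assume xs: "length xs = Suc n"
  let ?u = "take (n - j) xs" and ?v = "drop (n - j) xs"
  have v: "length ?v = Suc j" using xs assms(2) by simp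
  have "F (ys @ xs) = F ((ys @ ?u) @ ?v)" by simp
  also have "\<dots> = F (?u @ ?v)" by (simp only: windowD[OF assms(1) v])
  finally show "F (ys @ xs) = F xs" by simp
qed

lemma window_0: "window 0 F \<Longrightarrow> xs \<noteq> [] \<Longrightarrow> F xs = F [last xs]"
  using windowD[of 0 F "[last xs]" "butlast xs"] by simp

text \<open>Averaging over the newest entry leaves one entry less to depend on. After n hops a
  function of n + 1 entries depends on the current state alone, where mixing of the kernel
  applies.\<close>

lemma window_hop: "window (Suc n) F \<Longrightarrow> window n (hop Q F)"
  unfolding window_def hop_def
proof (intro allI impI)
  fix ys xs :: "'a list"
  assume F: "\<forall>ys xs. length xs = Suc (Suc n) \<longrightarrow> F (ys @ xs) = F xs" and xs: "length xs = Suc n"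
  have "last (ys @ xs) = last xs" using xs by (cases xs) auto
  moreover have "F ((ys @ xs) @ [x]) = F (xs @ [x])" for x
    using F[rule_format, of "xs @ [x]" ys] xs by simp
  ultimately show "E (Q (last (ys @ xs))) (\<lambda>x. F ((ys @ xs) @ [x]))
    = E (Q (last xs)) (\<lambda>x. F (xs @ [x]))" by simp
qed

lemma window_hop_pow: "window n F \<Longrightarrow> k \<le> n \<Longrightarrow> window (n - k) ((hop Q ^^ k) F)"
proof (induction k)
  case (Suc k)
  then have "window (Suc (n - Suc k)) ((hop Q ^^ k) F)" by (simp add: Suc_diff_Suc)
  then show ?case by (simp add: window_hop)
qed simp

lemma expectation_kernel_pow_Suc:
  fixes h :: "'x::finite \<Rightarrow> 'v::euclidean_space"
  shows "E (kernel_pow M (Suc k) x) h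
    = E (M x) (\<lambda>z. E (kernel_pow M k z) h)"
proof -
  have "kernel_pow M (Suc k) x = bind_pmf (M x) (kernel_pow M k)"
    using kernel_pow_add[of M "Suc 0" k x] by (simp add: kernel_pow_1)
  then show ?thesis by (simp only:) (rule expectation_bind_finite, auto)
qed

lemma hop_pow_window_0:
  fixes Q :: "'x::finite \<Rightarrow> 'x pmf"
  assumes "window 0 H" "xs \<noteq> []"
  shows "(hop Q ^^ k) H xs = E (kernel_pow Q k (last xs)) (\<lambda>y. H [y])"
  using assms(2)
proof (induction k arbitrary: xs)
  case 0
  then show ?case using window_0[OF assms(1), of xs] by simp
next
  case (Suc k)
  then show ?case by (simp add: expectation_kernel_pow_Suc hop_def del: kernel_pow.simps)
qed

lemma norm_hop_pow_le:
  fixes Q :: "'x::finite \<Rightarrow> 'x pmf"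
  assumes "\<And>xs. norm (F xs) \<le> b"
  shows "norm ((hop Q ^^ k) F xs) \<le> b"
proof (induction k arbitrary: xs)
  case (Suc k)
  then show ?case by (simp add: hop_def norm_expectation_le)
qed (simp add: assms)

lemma hop_pow_diff:
  fixes Q :: "'x::finite \<Rightarrow> 'x pmf"
  shows "(hop Q ^^ k) (\<lambda>xs. F xs - F' xs) xs = (hop Q ^^ k) F xs - (hop Q ^^ k) F' xs"
proof (induction k arbitrary: xs)
  case (Suc k)
  then show ?case by (simp add: hop_def integrable_measure_pmf_finite)
qed simp

lemma hop_pow_Suc_apply: "(hop Q ^^ Suc k) F = (hop Q ^^ k) (hop Q F)"
  by (simp add: funpow_swap1)

text \<open>The stationary expectation of \<open>F\<close>: n hops from a single entry drawn from
  \<nu> fill a window of exactly n + 1 entries.\<close>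

definition window_mean :: "('x \<Rightarrow> 'x pmf) \<Rightarrow> 'x pmf \<Rightarrow> nat \<Rightarrow> ('x list \<Rightarrow> 'v::euclidean_space) \<Rightarrow> 'v" where
  "window_mean Q \<nu> n F = E \<nu> (\<lambda>y. (hop Q ^^ n) F [y])"

text \<open>The Neumann series for the Poisson equation, cut at n. The first n terms are kept as
  they are; all later ones involve only H = hop^n F, a function of the state, so the tail is the
  deviation kernel \<open>\<kappa>\<close> applied to H.\<close>

definition window_poisson :: "('x::finite \<Rightarrow> 'x pmf) \<Rightarrow> 'x pmf \<Rightarrow> ('x \<Rightarrow> 'x \<Rightarrow> real) \<Rightarrow> nat \<Rightarrow>
    ('x list \<Rightarrow> 'v::euclidean_space) \<Rightarrow> 'x list \<Rightarrow> 'v" where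
  "window_poisson Q \<nu> \<kappa> n F xs = (\<Sum>k<n. (hop Q ^^ k) F xs - window_mean Q \<nu> n F)
    + (\<Sum>y\<in>UNIV. \<kappa> (last xs) y *\<^sub>R (hop Q ^^ n) F [y])"

lemma norm_window_mean_le:
  fixes Q :: "'x::finite \<Rightarrow> 'x pmf"
  assumes "\<And>xs. norm (F xs) \<le> b"
  shows "norm (window_mean Q \<nu> n F) \<le> b"
  unfolding window_mean_def by (intro norm_expectation_le norm_hop_pow_le assms) auto

lemma window_mean_diff:
  fixes Q :: "'x::finite \<Rightarrow> 'x pmf"
  shows "window_mean Q \<nu> n (\<lambda>xs. F xs - F' xs) = window_mean Q \<nu> n F - window_mean Q \<nu> n F'"
  by (simp add: window_mean_def hop_pow_diff integrable_measure_pmf_finite)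

text \<open>By linearity, a Lipschitz bound in a parameter follows from the norm bound for the
  Poisson solution.\<close>

lemma window_poisson_diff:
  "window_poisson Q \<nu> \<kappa> n (\<lambda>xs. F xs - F' xs) xs
    = window_poisson Q \<nu> \<kappa> n F xs - window_poisson Q \<nu> \<kappa> n F' xs"
  by (simp add: window_poisson_def hop_pow_diff window_mean_diff scaleR_diff_right sum_subtractf sum.distrib algebra_simps)

lemma window_window_poisson:
  assumes "window n F"
  shows "window n (window_poisson Q \<nu> \<kappa> n F)"
  unfolding window_def
proof (intro allI impI)
  fix ys xs :: "'a list" assume xs: "length xs = Suc n"
  have "last (ys @ xs) = last xs" using xs by (cases xs) auto
  moreover have "(hop Q ^^ k) F (ys @ xs) = (hop Q ^^ k) F xs" if "k < n" for k
    using window_mono[OF window_hop_pow[OF assms, of k Q], of n] that xs by (intro windowD) auto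
  ultimately show "window_poisson Q \<nu> \<kappa> n F (ys @ xs) = window_poisson Q \<nu> \<kappa> n F xs"
    by (simp add: window_poisson_def)
qed

lemma norm_window_poisson_le:
  assumes "\<And>xs. norm (F xs) \<le> b"
  shows "norm (window_poisson Q \<nu> \<kappa> n F xs) \<le> (2 * real n + (\<Sum>x\<in>UNIV. \<Sum>y\<in>UNIV. \<bar>\<kappa> x y\<bar>)) * b"
proof -
  have b: "0 \<le> b" using assms[of "[]"] norm_ge_zero order_trans by blast
  have "norm (\<Sum>k<n. (hop Q ^^ k) F xs - window_mean Q \<nu> n F) \<le> (\<Sum>k<n. b + b)"
    by (intro sum_norm_le order_trans[OF norm_triangle_ineq4] add_mono norm_hop_pow_le norm_window_mean_le assms)
  moreover have "norm (\<Sum>y\<in>UNIV. \<kappa> (last xs) y *\<^sub>R (hop Q ^^ n) F [y]) \<le> (\<Sum>y\<in>UNIV. \<bar>\<kappa> (last xs) y\<bar> * b)"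
    by (intro sum_norm_le) (auto intro!: mult_left_mono norm_hop_pow_le assms)
  moreover have "(\<Sum>y\<in>UNIV. \<bar>\<kappa> (last xs) y\<bar> * b) \<le> (\<Sum>x\<in>UNIV. \<Sum>y\<in>UNIV. \<bar>\<kappa> x y\<bar>) * b"
  proof -
    have "(\<Sum>y\<in>UNIV. \<bar>\<kappa> (last xs) y\<bar>) \<le> (\<Sum>x\<in>UNIV. \<Sum>y\<in>UNIV. \<bar>\<kappa> x y\<bar>)"
      by (rule member_le_sum[of "last xs" UNIV "\<lambda>x. \<Sum>y\<in>UNIV. \<bar>\<kappa> x y\<bar>"]) (auto intro: sum_nonneg)
    then show ?thesis using b by (simp add: sum_distrib_right[symmetric] mult_right_mono)
  qed
  ultimately show ?thesis
    unfolding window_poisson_def by (intro norm_triangle_le) (simp add: algebra_simps)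
qed

text \<open>The finite part telescopes from F to H = hop^n F; the tail contributes H at the last
  state minus the stationary mean, by the equation for \<open>\<kappa>\<close>. The two copies of H
  cancel.\<close>

lemma window_poisson_equation:
  assumes \<kappa>: "\<And>x y. \<kappa> x y - E (Q x) (\<lambda>z. \<kappa> z y) = (if x = y then 1 else 0) - pmf \<nu> y"
    and F: "window n F" and xs: "xs \<noteq> []"
  shows "F xs - window_mean Q \<nu> n F
    = window_poisson Q \<nu> \<kappa> n F xs - hop Q (window_poisson Q \<nu> \<kappa> n F) xs"
proof -
  let ?m = "window_mean Q \<nu> n F" and ?H = "(hop Q ^^ n) F"
  have "hop Q (window_poisson Q \<nu> \<kappa> n F) xs = (\<Sum>k<n. (hop Q ^^ Suc k) F xs - ?m)
      + (\<Sum>y\<in>UNIV. E (Q (last xs)) (\<lambda>z. \<kappa> z y) *\<^sub>R ?H [y])"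
    by (simp add: hop_def window_poisson_def integrable_measure_pmf_finite)
  then have "window_poisson Q \<nu> \<kappa> n F xs - hop Q (window_poisson Q \<nu> \<kappa> n F) xs
    = (\<Sum>k<n. (hop Q ^^ k) F xs - (hop Q ^^ Suc k) F xs)
      + (\<Sum>y\<in>UNIV. (\<kappa> (last xs) y - E (Q (last xs)) (\<lambda>z. \<kappa> z y)) *\<^sub>R ?H [y])"
    by (simp add: window_poisson_def sum_subtractf scaleR_diff_left)
  also have "(\<Sum>k<n. (hop Q ^^ k) F xs - (hop Q ^^ Suc k) F xs) = F xs - ?H xs"
    by (subst sum_lessThan_telescope') simp
  also have "?H xs = ?H [last xs]"
    using window_0[OF _ xs] window_hop_pow[OF F, of n Q] by simp
  also have "(\<Sum>y\<in>UNIV. (\<kappa> (last xs) y - E (Q (last xs)) (\<lambda>z. \<kappa> z y)) *\<^sub>R ?H [y])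
    = ?H [last xs] - ?m"
  proof -
    have "?m = (\<Sum>y\<in>UNIV. pmf \<nu> y *\<^sub>R ?H [y])"
      unfolding window_mean_def by (subst integral_measure_pmf[of UNIV]) auto
    then show ?thesis
      unfolding \<kappa> scaleR_diff_left sum_subtractf by (simp add: if_distrib[of "\<lambda>c. c *\<^sub>R _"] sum.delta' cong: if_cong)
  qed
  finally show ?thesis by simp
qed

text \<open>Mixing acts only once n hops have reduced F to a function of the state. For t < n the
  trivial bound 2 b is used; the division by \<open>\<rho> ^ n\<close> pays for this and for the
  lost exponent in \<open>\<rho> ^ (t - n)\<close>.\<close>

lemma hop_pow_mixing:
  fixes Q :: "'x::finite \<Rightarrow> 'x pmf" and \<rho> C :: real
  assumes mix: "\<And>k x y. \<bar>pmf (kernel_pow Q k x) y - pmf \<nu> y\<bar> \<le> C * \<rho> ^ k"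
    and \<rho>: "0 < \<rho>" "\<rho> < 1" and C: "0 < C"
    and F: "window n F" "\<And>xs. norm (F xs) \<le> b" and xs: "xs \<noteq> []"
  shows "norm ((hop Q ^^ t) F xs - window_mean Q \<nu> n F) \<le> (2 + C * CARD('x)) / \<rho> ^ n * b * \<rho> ^ t"
proof -
  let ?m = "window_mean Q \<nu> n F" and ?H = "(hop Q ^^ n) F"
  have b: "0 \<le> b" using F(2)[of "[]"] norm_ge_zero order_trans by blast
  show ?thesis
  proof (cases "n \<le> t")
    case False
    have "norm ((hop Q ^^ t) F xs - ?m) \<le> b + b"
      by (intro order_trans[OF norm_triangle_ineq4] add_mono norm_hop_pow_le norm_window_mean_le F)
    also have "\<dots> \<le> (2 + C * CARD('x)) * b"
      using C b by (simp add: algebra_simps)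
    also have "\<dots> \<le> (2 + C * CARD('x)) * b * (\<rho> ^ t / \<rho> ^ n)"
    proof -
      have "\<rho> ^ n \<le> \<rho> ^ t" using False \<rho> by (intro power_decreasing) auto
      then have "1 \<le> \<rho> ^ t / \<rho> ^ n" using \<rho> by simp
      then show ?thesis
        using mult_left_mono[of 1 "\<rho> ^ t / \<rho> ^ n" "(2 + C * CARD('x)) * b"] C b by simp
    qed
    finally show ?thesis by (simp add: field_simps)
  next
    case True
    then have "(hop Q ^^ t) F xs = (hop Q ^^ (t - n)) ?H xs"
      by (metis comp_apply funpow_add le_add_diff_inverse2)
    also have "\<dots> = E (kernel_pow Q (t - n) (last xs)) (\<lambda>y. ?H [y])"
      using window_hop_pow[OF F(1), of n Q] xs by (intro hop_pow_window_0) auto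
    also have "\<dots> = (\<Sum>y\<in>UNIV. pmf (kernel_pow Q (t - n) (last xs)) y *\<^sub>R ?H [y])"
      by (subst integral_measure_pmf[of UNIV]) auto
    also have "\<dots> - ?m = (\<Sum>y\<in>UNIV. (pmf (kernel_pow Q (t - n) (last xs)) y - pmf \<nu> y) *\<^sub>R ?H [y])"
      unfolding window_mean_def
      by (subst integral_measure_pmf[of UNIV]) (auto simp: scaleR_diff_left sum_subtractf)
    also have "norm \<dots> \<le> (\<Sum>y\<in>(UNIV :: 'x set). C * \<rho> ^ (t - n) * b)"
    proof (intro sum_norm_le)
      fix y :: 'x
      show "norm ((pmf (kernel_pow Q (t - n) (last xs)) y - pmf \<nu> y) *\<^sub>R ?H [y]) \<le> C * \<rho> ^ (t - n) * b"
        using mix[of "t - n" "last xs" y] norm_hop_pow_le[where Q = Q and k = n and xs = "[y]", OF F(2)] C \<rho>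
        by (auto intro!: mult_mono)
    qed
    also have "\<dots> = C * CARD('x) * b * \<rho> ^ (t - n)" by simp
    also have "\<rho> ^ (t - n) = \<rho> ^ t / \<rho> ^ n"
      using True \<rho> by (simp add: power_diff)
    also have "C * CARD('x) * b * (\<rho> ^ t / \<rho> ^ n) \<le> (2 + C * CARD('x)) * b * (\<rho> ^ t / \<rho> ^ n)"
      using b \<rho> by (intro mult_right_mono) auto
    finally show ?thesis by (simp add: field_simps)
  qed
qed

subsection \<open>Averages\<close>

definition avg :: "'i set \<Rightarrow> ('i \<Rightarrow> 'v::real_vector) \<Rightarrow> 'v" where
  "avg I u = (1 / real (card I)) *\<^sub>R (\<Sum>i\<in>I. u i)"

lemma avg_add: "avg I (\<lambda>i. u i + v i) = avg I u + avg I v"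
  by (simp add: avg_def sum.distrib scaleR_add_right)

lemma avg_diff: "avg I (\<lambda>i. u i - v i) = avg I u - avg I v"
  by (simp add: avg_def sum_subtractf scaleR_diff_right)

lemma avg_scaleR: "avg I (\<lambda>i. a *\<^sub>R u i) = a *\<^sub>R avg I u"
  by (simp add: avg_def scaleR_sum_right[symmetric] mult.commute)

lemma avg_mult: "avg I (\<lambda>i. a * u i) = a * avg I (u :: _ \<Rightarrow> real)"
  using avg_scaleR[of I a u] by simp

lemma avg_const: "finite I \<Longrightarrow> I \<noteq> {} \<Longrightarrow> avg I (\<lambda>i. a) = a"
  by (simp add: avg_def sum_constant_scaleR)

lemma avg_cong: "(\<And>i. i \<in> I \<Longrightarrow> u i = v i) \<Longrightarrow> avg I u = avg I v"
  by (simp add: avg_def)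

lemma avg_mono:
  fixes u v :: "'i \<Rightarrow> real"
  assumes "\<And>i. i \<in> I \<Longrightarrow> u i \<le> v i"
  shows "avg I u \<le> avg I v"
  using assms by (auto simp: avg_def intro!: divide_right_mono sum_mono)

lemma avg_nonneg:
  fixes u :: "'i \<Rightarrow> real"
  assumes "\<And>i. i \<in> I \<Longrightarrow> 0 \<le> u i"
  shows "0 \<le> avg I u"
  using assms by (auto simp: avg_def intro!: divide_nonneg_nonneg sum_nonneg)

lemma norm_avg_le: "norm (avg I u) \<le> avg I (\<lambda>i. norm (u i))"
  for u :: "'i \<Rightarrow> 'v::real_normed_vector"
  by (auto simp: avg_def intro!: divide_right_mono norm_sum)

lemma avg_linear: "linear h \<Longrightarrow> avg I (\<lambda>i. h (u i)) = h (avg I u)"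
  by (simp add: avg_def linear_cmul linear_sum)

lemma avg_inner: "avg I (\<lambda>i. a \<bullet> u i) = a \<bullet> avg I u"
  by (simp add: avg_def inner_sum_right)

lemma norm_avg_square_le:
  fixes u :: "'i \<Rightarrow> 'v::real_inner"
  assumes "finite I" "I \<noteq> {}"
  shows "(norm (avg I u))\<^sup>2 \<le> avg I (\<lambda>i. (norm (u i))\<^sup>2)"
proof -
  let ?m = "avg I u"
  have "0 \<le> avg I (\<lambda>i. (norm (u i - ?m))\<^sup>2)"
    by (intro avg_nonneg) simp
  also have "avg I (\<lambda>i. (norm (u i - ?m))\<^sup>2)
    = avg I (\<lambda>i. (norm (u i))\<^sup>2 - 2 * (?m \<bullet> u i) + (norm ?m)\<^sup>2)"
    by (intro avg_cong) (simp add: power2_norm_eq_inner inner_simps inner_commute)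
  also have "\<dots> = avg I (\<lambda>i. (norm (u i))\<^sup>2) - (norm ?m)\<^sup>2"
    using assms by (simp add: avg_add avg_diff avg_mult avg_inner avg_const power2_norm_eq_inner)
  finally show ?thesis by simp
qed

lemma norm_add_square_le_young:
  fixes p q :: "'v::real_inner"
  assumes "0 < s"
  shows "(norm (p + q))\<^sup>2 \<le> (1 + s) * (norm p)\<^sup>2 + (1 + 1 / s) * (norm q)\<^sup>2"
proof -
  have "0 \<le> (norm (s *\<^sub>R p - q))\<^sup>2 / s" using assms by simp
  also have "\<dots> = s * (norm p)\<^sup>2 - 2 * (p \<bullet> q) + (norm q)\<^sup>2 / s"
    using assms
    by (simp add: power2_norm_eq_inner inner_simps inner_commute divide_simps)
       (simp add: algebra_simps)
  finally have "2 * (p \<bullet> q) \<le> s * (norm p)\<^sup>2 + (norm q)\<^sup>2 / s" by simp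
  moreover have "(norm (p + q))\<^sup>2 = (norm p)\<^sup>2 + 2 * (p \<bullet> q) + (norm q)\<^sup>2"
    by (simp add: power2_norm_eq_inner inner_simps inner_commute)
  ultimately show ?thesis by (simp add: algebra_simps)
qed

lemma norm_add_square_le: "(norm (p + q))\<^sup>2 \<le> 2 * (norm p)\<^sup>2 + 2 * (norm q)\<^sup>2"
  for p q :: "'v::real_inner"
  using norm_add_square_le_young[of 1 p q] by simp

lemma add_square_le: "(a + b)\<^sup>2 \<le> 2 * a\<^sup>2 + 2 * b\<^sup>2" for a b :: real
  using norm_add_square_le[of a b] by simp

text \<open>The Euler step alone contracts by 1 - 3/2 c a, its quadratic term costing at most c a /
  2. Young's inequality with parameter c a / 2 then separates e: it spends the excess over c a and
  turns a^2 |e|^2 into order a |e|^2.\<close>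

lemma dissipative_step:
  fixes B :: "'v::real_inner \<Rightarrow> 'v"
  assumes "norm (B y) \<le> L * norm y" "y \<bullet> B y \<le> - c * (norm y)\<^sup>2"
    and "0 < c" "0 < a" "a \<le> 1" "2 * a * L\<^sup>2 \<le> c" "a * c \<le> 1"
  shows "(norm (y + a *\<^sub>R B y + a *\<^sub>R e))\<^sup>2
    \<le> (1 - c * a) * (norm y)\<^sup>2 + (1 + 2 / c) * a * (norm e)\<^sup>2"
proof -
  let ?p = "y + a *\<^sub>R B y"
  have "(norm ?p)\<^sup>2 = (norm y)\<^sup>2 + 2 * a * (y \<bullet> B y) + a\<^sup>2 * (norm (B y))\<^sup>2"
    unfolding power2_norm_eq_inner by (simp add: inner_simps inner_commute power2_eq_square)
  also have "\<dots> \<le> (norm y)\<^sup>2 + 2 * a * (- c * (norm y)\<^sup>2) + a\<^sup>2 * (L * norm y)\<^sup>2"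
    using assms by (intro add_mono mult_left_mono power_mono) auto
  also have "\<dots> = (1 - 2 * c * a + a * (a * L\<^sup>2)) * (norm y)\<^sup>2"
    by (simp add: algebra_simps power2_eq_square)
  also have "\<dots> \<le> (1 - 2 * c * a + a * (c / 2)) * (norm y)\<^sup>2"
    using assms by (intro mult_right_mono add_left_mono mult_left_mono) auto
  finally have p: "(norm ?p)\<^sup>2 \<le> (1 - 3 / 2 * c * a) * (norm y)\<^sup>2"
    by (simp add: algebra_simps)
  have ca: "0 < c * a / 2" using assms by simp
  have "(norm (?p + a *\<^sub>R e))\<^sup>2
    \<le> (1 + c * a / 2) * (norm ?p)\<^sup>2 + (1 + 1 / (c * a / 2)) * (norm (a *\<^sub>R e))\<^sup>2"
    by (rule norm_add_square_le_young[OF ca])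
  also have "(1 + c * a / 2) * (norm ?p)\<^sup>2
      \<le> (1 + c * a / 2) * ((1 - 3 / 2 * c * a) * (norm y)\<^sup>2)"
    using p ca by (intro mult_left_mono) auto
  also have "\<dots> = (1 - c * a - 3 / 4 * (c * a)\<^sup>2) * (norm y)\<^sup>2"
    by (simp add: algebra_simps power2_eq_square)
  also have "\<dots> \<le> (1 - c * a) * (norm y)\<^sup>2" by (intro mult_right_mono) auto
  also have "(1 + 1 / (c * a / 2)) * (norm (a *\<^sub>R e))\<^sup>2 = (a * a + 2 / c * a) * (norm e)\<^sup>2"
    using assms by (simp add: power_mult_distrib power2_eq_square field_simps)
  also have "\<dots> \<le> (1 * a + 2 / c * a) * (norm e)\<^sup>2"
    using assms by (intro mult_right_mono add_right_mono) auto
  finally show ?thesis by (simp add: algebra_simps)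
qed

subsection \<open>Lyapunov functions for one step\<close>

text \<open>The parameter is the error relative to the solution, so the mean field \<open>B\<close>
  is linear with root 0; \<open>w\<close> is the noise state of one agent and \<open>G\<close>
  collects the states where the estimates are required. One L >= 1 serves as every Lipschitz and
  growth constant.\<close>

locale stochastic_approximation =
  fixes f g :: "'w \<Rightarrow> 'v::euclidean_space \<Rightarrow> 'v" and B :: "'v \<Rightarrow> 'v"
    and nx :: "'w \<Rightarrow> 'w pmf" and G :: "'w set" and L c :: real
  assumes finite_nx: "finite (set_pmf (nx w))"
    and closed: "w \<in> G \<Longrightarrow> w' \<in> set_pmf (nx w) \<Longrightarrow> w' \<in> G"
    and L: "1 \<le> L" and c: "0 < c"
    and linear_B: "linear B"
    and poisson: "w \<in> G \<Longrightarrow>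
      f w v - B v = g w v - E (nx w) (\<lambda>w'. g w' v)"
    and lipschitz_f: "w \<in> G \<Longrightarrow> norm (f w u - f w v) \<le> L * norm (u - v)"
    and lipschitz_g: "w \<in> G \<Longrightarrow> norm (g w u - g w v) \<le> L * norm (u - v)"
    and f_0: "w \<in> G \<Longrightarrow> norm (f w 0) \<le> L"
    and g_0: "w \<in> G \<Longrightarrow> norm (g w 0) \<le> L"
    and norm_B: "norm (B v) \<le> L * norm v"
    and dissipative: "v \<bullet> B v \<le> - c * (norm v)\<^sup>2"
begin

definition gm :: "'w \<Rightarrow> 'v \<Rightarrow> 'v" where
  "gm w v = E (nx w) (\<lambda>w'. g w' v)"

abbreviation nexts :: "'i set \<Rightarrow> 'w \<Rightarrow> ('i \<Rightarrow> 'w) \<Rightarrow> ('i \<Rightarrow> 'w) pmf" where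
  "nexts I d w \<equiv> Pi_pmf I d (\<lambda>i. nx (w i))"

lemma lipschitz_gm:
  assumes "w \<in> G"
  shows "norm (gm w u - gm w v) \<le> L * norm (u - v)"
proof -
  have "gm w u - gm w v = E (nx w) (\<lambda>w'. g w' u - g w' v)"
    unfolding gm_def by (simp add: integrable_measure_pmf_finite[OF finite_nx])
  then show ?thesis
    by (simp only:) (rule norm_expectation_le[OF finite_nx lipschitz_g[OF closed[OF assms]]])
qed

lemma norm_f: "w \<in> G \<Longrightarrow> norm (f w v) \<le> L * (1 + norm v)"
  using lipschitz_f[of w v 0] f_0[of w] norm_triangle_ineq2[of "f w v" "f w 0"]
  by (simp add: algebra_simps)

lemma norm_g: "w \<in> G \<Longrightarrow> norm (g w v) \<le> L * (1 + norm v)"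
  using lipschitz_g[of w v 0] g_0[of w] norm_triangle_ineq2[of "g w v" "g w 0"]
  by (simp add: algebra_simps)

lemma f_eq: "w \<in> G \<Longrightarrow> f w v = B v + g w v - gm w v"
  using poisson[of w v] unfolding gm_def by (simp add: algebra_simps)

text \<open>The corrected mean absorbs the Markovian noise: it moves by the mean field, a remainder
  \<open>r\<close> of higher order in the step size, and a martingale increment whose variance is divided
  by the number of agents.\<close>

lemma corrected_mean_step:
  fixes I :: "'i set" and w :: "'i \<Rightarrow> 'w" and \<delta> p :: "'i \<Rightarrow> 'v" and a :: real
  defines "h \<equiv> avg I (\<lambda>i. g (w i) (\<delta> i))"
    and "r \<equiv> avg I (\<lambda>i. gm (w i) (p i) - gm (w i) (\<delta> i))"
  assumes I: "finite I" "I \<noteq> {}" and w: "\<And>i. i \<in> I \<Longrightarrow> w i \<in> G"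
    and a: "0 < a" "a \<le> 1" "2 * a * L\<^sup>2 \<le> c" "a * c \<le> 1"
    and p: "avg I p = avg I \<delta> + a *\<^sub>R avg I (\<lambda>i. f (w i) (\<delta> i))"
  shows "E (nexts I d w)
      (\<lambda>w'. (norm (avg I p + a *\<^sub>R avg I (\<lambda>i. g (w' i) (p i))))\<^sup>2)
    \<le> (1 - c * a) * (norm (avg I \<delta> + a *\<^sub>R h))\<^sup>2
      + (1 + 2 / c) * a * (norm (r - a *\<^sub>R B h))\<^sup>2
      + a\<^sup>2 * L\<^sup>2 / real (card I) * avg I (\<lambda>i. (1 + norm (p i))\<^sup>2)"
proof -
  let ?k = "real (card I)"
  have k: "0 < ?k" using I by (simp add: card_gt_0_iff)
  let ?y = "avg I \<delta> + a *\<^sub>R h"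
  let ?b = "\<lambda>i. (a / ?k)\<^sup>2 * (L\<^sup>2 * (1 + norm (p i))\<^sup>2)"
  have "E (nexts I d w)
      (\<lambda>w'. (norm (avg I p + a *\<^sub>R avg I (\<lambda>i. g (w' i) (p i))))\<^sup>2)
    = E (nexts I d w)
      (\<lambda>w'. (norm (avg I p + (\<Sum>i\<in>I. (a / ?k) *\<^sub>R g (w' i) (p i))))\<^sup>2)"
    by (simp add: avg_def[of I "\<lambda>i. g (_ i) (p i)"] scaleR_sum_right[symmetric])
  also have "\<dots> \<le> (norm (avg I p
      + (\<Sum>i\<in>I. E (nx (w i)) (\<lambda>x. (a / ?k) *\<^sub>R g x (p i)))))\<^sup>2 + (\<Sum>i\<in>I. ?b i)"
  proof (rule expectation_norm_sum_square_Pi_pmf_le[OF I(1) finite_nx])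
    fix i x assume i: "i \<in> I" "x \<in> set_pmf (nx (w i))"
    have "norm (g x (p i)) \<le> L * (1 + norm (p i))"
      using i w closed norm_g by blast
    then have "(norm (g x (p i)))\<^sup>2 \<le> (L * (1 + norm (p i)))\<^sup>2"
      by (intro power_mono) auto
    then show "(norm ((a / ?k) *\<^sub>R g x (p i)))\<^sup>2 \<le> ?b i"
      using a k by (auto simp: power_mult_distrib power_divide intro!: divide_right_mono mult_left_mono)
  qed
  also have "(\<Sum>i\<in>I. ?b i) = a\<^sup>2 * L\<^sup>2 / ?k * avg I (\<lambda>i. (1 + norm (p i))\<^sup>2)"
    unfolding sum_distrib_left[symmetric] avg_def by (simp add: power_divide power2_eq_square)
  also have "(\<Sum>i\<in>I. E (nx (w i)) (\<lambda>x. (a / ?k) *\<^sub>R g x (p i)))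
    = a *\<^sub>R avg I (\<lambda>i. gm (w i) (p i))"
    by (simp add: avg_def gm_def scaleR_sum_right)
  \<comment> \<open>With f = B + g - gm, the term gm at the old parameters cancels up to the
    Lipschitz difference r. The mean field acts on the average error, not on the corrected mean; by
    linearity the gap is a B h, which joins the remainder.\<close>
  also have "avg I p + a *\<^sub>R avg I (\<lambda>i. gm (w i) (p i)) = ?y + a *\<^sub>R B ?y + a *\<^sub>R (r - a *\<^sub>R B h)"
  proof -
    have "avg I (\<lambda>i. f (w i) (\<delta> i)) = avg I (\<lambda>i. B (\<delta> i) + g (w i) (\<delta> i) - gm (w i) (\<delta> i))"
      using w by (intro avg_cong f_eq) auto
    also have "\<dots> = B (avg I \<delta>) + h - avg I (\<lambda>i. gm (w i) (\<delta> i))"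
      by (simp add: avg_add avg_diff avg_linear[OF linear_B] h_def)
    finally have f: "avg I (\<lambda>i. f (w i) (\<delta> i)) = B (avg I \<delta>) + h - avg I (\<lambda>i. gm (w i) (\<delta> i))" .
    have "avg I p + a *\<^sub>R avg I (\<lambda>i. gm (w i) (p i)) = ?y + a *\<^sub>R B (avg I \<delta>) + a *\<^sub>R r"
      unfolding p f r_def avg_diff by (simp add: algebra_simps)
    moreover have "B ?y = B (avg I \<delta>) + a *\<^sub>R B h"
      by (simp add: linear_add[OF linear_B] linear_cmul[OF linear_B])
    ultimately show ?thesis by (simp add: algebra_simps)
  qed
  also have "(norm (?y + a *\<^sub>R B ?y + a *\<^sub>R (r - a *\<^sub>R B h)))\<^sup>2
    \<le> (1 - c * a) * (norm ?y)\<^sup>2 + (1 + 2 / c) * a * (norm (r - a *\<^sub>R B h))\<^sup>2"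
    by (rule dissipative_step[OF norm_B dissipative c a(1,2,3,4)])
  finally show ?thesis by simp
qed

section \<open>Corrected parameters and bounds for small steps\<close>

definition corrected :: "real \<Rightarrow> 'w \<Rightarrow> 'v \<Rightarrow> 'v" where
  "corrected a w v = v + a *\<^sub>R g w v"

abbreviation center :: "real \<Rightarrow> 'i set \<Rightarrow> ('i \<Rightarrow> 'w) \<Rightarrow> ('i \<Rightarrow> 'v) \<Rightarrow> 'v" where
  "center a I w v \<equiv> avg I (\<lambda>i. corrected a (w i) (v i))"

abbreviation energy :: "real \<Rightarrow> 'i set \<Rightarrow> ('i \<Rightarrow> 'w) \<Rightarrow> ('i \<Rightarrow> 'v) \<Rightarrow> real" where
  "energy a I w v \<equiv> avg I (\<lambda>i. (norm (corrected a (w i) (v i)))\<^sup>2)"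

lemma avg_corrected:
  "center a I w p = avg I p + a *\<^sub>R avg I (\<lambda>i. g (w i) (p i))"
  by (simp add: corrected_def avg_add avg_scaleR)

text \<open>The correction moves v by at most (1 + |v|) / 2, so 1 + |v| is at most twice 1 + |z| for
  the corrected value z; squaring gives the 8.\<close>

lemma one_add_norm_le_corrected:
  assumes "w \<in> G" "0 < a" "2 * a * L \<le> 1"
  shows "(1 + norm v)\<^sup>2 \<le> 8 * (1 + (norm (corrected a w v))\<^sup>2)"
proof -
  have 1: "norm v \<le> norm (corrected a w v) + norm (a *\<^sub>R g w v)"
    unfolding corrected_def by (metis add_diff_cancel_right' norm_triangle_ineq4)
  have "norm (a *\<^sub>R g w v) \<le> a * (L * (1 + norm v))"
    using assms norm_g by simp
  also have "\<dots> \<le> 1 / 2 * (1 + norm v)"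
    using assms mult_right_mono[of "a * L" "1 / 2" "1 + norm v"] by simp
  finally have "1 + norm v \<le> 2 * (1 + norm (corrected a w v))" using 1 norm_ge_zero[of "corrected a w v"] by argo
  then have "(1 + norm v)\<^sup>2 \<le> (2 * (1 + norm (corrected a w v)))\<^sup>2"
    by (intro power_mono) auto
  also have "\<dots> = 4 * (1 + norm (corrected a w v))\<^sup>2"
    by (simp only: power_mult_distrib) simp
  finally show ?thesis using add_square_le[of 1 "norm (corrected a w v)"] by simp
qed

lemma one_add_norm_update_le:
  assumes "w \<in> G" "0 < a" "a * L \<le> 1"
  shows "1 + norm (v + a *\<^sub>R f w v) \<le> 2 * (1 + norm v)"
proof -
  have "norm (v + a *\<^sub>R f w v) \<le> norm v + a * (L * (1 + norm v))"
    using assms norm_f[of w v] by (intro order_trans[OF norm_triangle_ineq] add_left_mono) auto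
  also have "a * (L * (1 + norm v)) \<le> 1 * (1 + norm v)"
    using assms mult_right_mono[of "a * L" 1 "1 + norm v"] by simp
  finally show ?thesis by simp
qed

text \<open>48 is dictated by \<open>synchronized_step\<close>, while the local step produces 32;
  the part 1 + 2/c comes from \<open>dissipative_step\<close>.\<close>

definition K1 :: real where "K1 = 48 * (1 + 2 / c) * L ^ 4"

lemma L_pow: "1 \<le> L ^ n" "L\<^sup>2 \<le> L ^ 4"
  using L by (auto intro: power_increasing one_le_power)

lemma K1_ge: "48 * L\<^sup>2 \<le> K1" "48 \<le> K1"
proof -
  have "48 * L\<^sup>2 \<le> 48 * (1 * L ^ 4)" using L_pow(2) by simp
  also have "\<dots> \<le> 48 * ((1 + 2 / c) * L ^ 4)"
    using c L_pow(1)[of 4] by (intro mult_left_mono mult_right_mono) auto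
  finally show *: "48 * L\<^sup>2 \<le> K1" by (simp only: K1_def mult.assoc)
  show "48 \<le> K1" using * L_pow(1)[of 2] by linarith
qed

text \<open>Step sizes at most \<open>1 / M\<close> are small enough for every estimate below.\<close>

definition M :: real where "M = 4 * L + 2 * L\<^sup>2 / c + c + 5184 * L\<^sup>2 / c + 8 * K1 / c"

lemma small_step:
  assumes "0 < a" "a * M \<le> 1"
  shows "a * L \<le> 1 / 4" "a \<le> 1 / 4" "2 * a * L\<^sup>2 \<le> c" "a * c \<le> 1" "5184 * L\<^sup>2 * a \<le> c" "8 * K1 * a \<le> c"
proof -
  have nn: "0 \<le> 4 * L" "0 \<le> 2 * L\<^sup>2 / c" "0 \<le> c" "0 \<le> 5184 * L\<^sup>2 / c" "0 \<le> 8 * K1 / c"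
    using L c K1_ge(2) by auto
  have le: "a * x \<le> 1" if "x \<le> M" for x
    using mult_left_mono[OF that, of a] assms by linarith
  have 1: "a * (4 * L) \<le> 1" by (rule le) (use nn in \<open>unfold M_def, linarith\<close>)
  then show "a * L \<le> 1 / 4" by simp
  show "a \<le> 1 / 4" using 1 mult_left_mono[OF L, of a] assms by linarith
  have "a * (2 * L\<^sup>2 / c) \<le> 1" by (rule le) (use nn in \<open>unfold M_def, linarith\<close>)
  then show "2 * a * L\<^sup>2 \<le> c" using c by (simp add: field_simps)
  show "a * c \<le> 1" by (rule le) (use nn in \<open>unfold M_def, linarith\<close>)
  \<comment> \<open>5184 = 8 * 648: the extra energy of a synchronization, with constant 648, has to
    stay below an eighth of the contraction.\<close>
  have "a * (5184 * L\<^sup>2 / c) \<le> 1" by (rule le) (use nn in \<open>unfold M_def, linarith\<close>)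
  then show "5184 * L\<^sup>2 * a \<le> c" using c by (simp add: field_simps)
  have "a * (8 * K1 / c) \<le> 1" by (rule le) (use nn in \<open>unfold M_def, linarith\<close>)
  then show "8 * K1 * a \<le> c" using c by (simp add: field_simps)
qed

text \<open>Parameters move by O(a) in a step, so the remainder has size a; its square, with the
  prefactor a of \<open>dissipative_step\<close>, gives a^3, and the martingale increment gives a^2
  / N. Between synchronizations the agents are not controlled by their mean, hence the factor 1 + Z
  with the mean energy Z.\<close>

lemma corrected_mean_local_step:
  fixes I :: "'i set" and w :: "'i \<Rightarrow> 'w" and \<delta> :: "'i \<Rightarrow> 'v" and a :: real
  defines "u \<equiv> \<lambda>i. \<delta> i + a *\<^sub>R f (w i) (\<delta> i)"
    and "Z \<equiv> energy a I w \<delta>"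
  assumes I: "finite I" "I \<noteq> {}" and w: "\<And>i. i \<in> I \<Longrightarrow> w i \<in> G"
    and a: "0 < a" "a * M \<le> 1"
  shows "E (nexts I d w)
      (\<lambda>w'. (norm (center a I w' u))\<^sup>2)
    \<le> (1 - c * a) * (norm (center a I w \<delta>))\<^sup>2
      + K1 * (a ^ 3 + a\<^sup>2 / real (card I)) * (1 + Z)"
proof -
  note sm = small_step[OF a]
  let ?k = "real (card I)"
  have k: "0 < ?k" using I by (simp add: card_gt_0_iff)
  let ?h = "avg I (\<lambda>i. g (w i) (\<delta> i))"
  let ?r = "avg I (\<lambda>i. gm (w i) (u i) - gm (w i) (\<delta> i))"
  let ?S = "avg I (\<lambda>i. (1 + norm (\<delta> i))\<^sup>2)"
  have S: "?S \<le> 8 * (1 + Z)"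
  proof -
    have "?S \<le> avg I (\<lambda>i. 8 * (1 + (norm (corrected a (w i) (\<delta> i)))\<^sup>2))"
      using sm(1) a w by (intro avg_mono one_add_norm_le_corrected) auto
    also have "\<dots> = 8 * (1 + Z)"
      using I by (simp add: avg_mult avg_add avg_const[OF I] Z_def)
    finally show ?thesis .
  qed
  have e: "(norm (?r - a *\<^sub>R B ?h))\<^sup>2 \<le> 4 * a\<^sup>2 * L ^ 4 * ?S"
  proof -
    have "?r - a *\<^sub>R B ?h = avg I (\<lambda>i. gm (w i) (u i) - gm (w i) (\<delta> i) - a *\<^sub>R B (g (w i) (\<delta> i)))"
      by (simp add: avg_diff avg_scaleR avg_linear[OF linear_B])
    also have "(norm \<dots>)\<^sup>2 \<le> avg I (\<lambda>i. (norm (gm (w i) (u i) - gm (w i) (\<delta> i) - a *\<^sub>R B (g (w i) (\<delta> i))))\<^sup>2)"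
      by (rule norm_avg_square_le[OF I])
    also have "\<dots> \<le> avg I (\<lambda>i. 4 * a\<^sup>2 * L ^ 4 * (1 + norm (\<delta> i))\<^sup>2)"
    proof (rule avg_mono)
      fix i assume i: "i \<in> I"
      have "norm (gm (w i) (u i) - gm (w i) (\<delta> i)) \<le> L * (a * (L * (1 + norm (\<delta> i))))"
        using lipschitz_gm[OF w[OF i], of "u i" "\<delta> i"] norm_f[OF w[OF i], of "\<delta> i"] a L
        by (auto simp: u_def elim!: order_trans)
      moreover have "norm (a *\<^sub>R B (g (w i) (\<delta> i))) \<le> a * (L * (L * (1 + norm (\<delta> i))))"
        using norm_B[of "g (w i) (\<delta> i)"] norm_g[OF w[OF i], of "\<delta> i"] a L
        by (auto elim!: order_trans)
      ultimately have "norm (gm (w i) (u i) - gm (w i) (\<delta> i) - a *\<^sub>R B (g (w i) (\<delta> i)))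
          \<le> 2 * a * L\<^sup>2 * (1 + norm (\<delta> i))"
        using norm_triangle_ineq4[of "gm (w i) (u i) - gm (w i) (\<delta> i)" "a *\<^sub>R B (g (w i) (\<delta> i))"]
        by (simp add: power2_eq_square algebra_simps)
      then have "(norm (gm (w i) (u i) - gm (w i) (\<delta> i) - a *\<^sub>R B (g (w i) (\<delta> i))))\<^sup>2
          \<le> (2 * a * L\<^sup>2 * (1 + norm (\<delta> i)))\<^sup>2"
        by (intro power_mono) auto
      also have "\<dots> = 4 * a\<^sup>2 * L ^ 4 * (1 + norm (\<delta> i))\<^sup>2"
        by (simp add: power_mult_distrib power_mult[symmetric])
      finally show "(norm (gm (w i) (u i) - gm (w i) (\<delta> i) - a *\<^sub>R B (g (w i) (\<delta> i))))\<^sup>2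
        \<le> 4 * a\<^sup>2 * L ^ 4 * (1 + norm (\<delta> i))\<^sup>2" .
    qed
    also have "\<dots> = 4 * a\<^sup>2 * L ^ 4 * ?S" by (rule avg_mult)
    finally show ?thesis .
  qed
  have noise: "avg I (\<lambda>i. (1 + norm (u i))\<^sup>2) \<le> 4 * ?S"
  proof -
    have "avg I (\<lambda>i. (1 + norm (u i))\<^sup>2) \<le> avg I (\<lambda>i. (2 * (1 + norm (\<delta> i)))\<^sup>2)"
      unfolding u_def using sm(1) a w by (intro avg_mono power_mono one_add_norm_update_le) auto
    also have "\<dots> = 4 * ?S" by (simp only: power_mult_distrib avg_mult) simp
    finally show ?thesis .
  qed
  have Z0: "0 \<le> Z" unfolding Z_def by (intro avg_nonneg) simp
  have "E (nexts I d w)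
      (\<lambda>w'. (norm (center a I w' u))\<^sup>2)
    \<le> (1 - c * a) * (norm (center a I w \<delta>))\<^sup>2
      + (1 + 2 / c) * a * (norm (?r - a *\<^sub>R B ?h))\<^sup>2
      + a\<^sup>2 * L\<^sup>2 / ?k * avg I (\<lambda>i. (1 + norm (u i))\<^sup>2)"
    unfolding avg_corrected
    using sm a by (intro corrected_mean_step I w) (auto simp: u_def avg_add avg_scaleR)
  also have "(1 + 2 / c) * a * (norm (?r - a *\<^sub>R B ?h))\<^sup>2
      \<le> (1 + 2 / c) * a * (4 * a\<^sup>2 * L ^ 4 * (8 * (1 + Z)))"
    using a c by (intro mult_left_mono order_trans[OF e] S) auto
  also have "\<dots> = 32 * (1 + 2 / c) * L ^ 4 * (a ^ 3 * (1 + Z))"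
    by (simp only: power2_eq_square power3_eq_cube ac_simps) simp
  also have "\<dots> \<le> K1 * (a ^ 3 * (1 + Z))"
    unfolding K1_def using a c Z0 L_pow by (intro mult_right_mono) auto
  also have "a\<^sup>2 * L\<^sup>2 / ?k * avg I (\<lambda>i. (1 + norm (u i))\<^sup>2) \<le> a\<^sup>2 * L\<^sup>2 / ?k * (4 * (8 * (1 + Z)))"
    using noise S by (intro mult_left_mono) auto
  also have "\<dots> = 32 * L\<^sup>2 * (a\<^sup>2 / ?k * (1 + Z))" by simp
  also have "\<dots> \<le> K1 * (a\<^sup>2 / ?k * (1 + Z))"
    using K1_ge(1) zero_le_power2[of L] Z0 by (intro mult_right_mono) (linarith, auto)
  finally show ?thesis by (simp add: algebra_simps)
qed

text \<open>One agent is the case of \<open>corrected_mean_local_step\<close> with a singleton index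
  set: its center is its own corrected parameter, and its noise a^2 is divided by 1 only. Averaging
  over the agents gives the energy.\<close>

lemma energy_local_step:
  fixes I :: "'i set" and w :: "'i \<Rightarrow> 'w" and \<delta> :: "'i \<Rightarrow> 'v" and a :: real
  defines "u \<equiv> \<lambda>i. \<delta> i + a *\<^sub>R f (w i) (\<delta> i)"
    and "Z \<equiv> energy a I w \<delta>"
  assumes I: "finite I" "I \<noteq> {}" and w: "\<And>i. i \<in> I \<Longrightarrow> w i \<in> G"
    and a: "0 < a" "a * M \<le> 1"
  shows "E (nexts I d w)
      (\<lambda>w'. energy a I w' u)
    \<le> (1 - c * a) * Z + 2 * K1 * a\<^sup>2 * (1 + Z)"
proof -
  have single: "E (nx (w i)) (\<lambda>x. (norm (corrected a x (u i)))\<^sup>2)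
    \<le> (1 - c * a) * (norm (corrected a (w i) (\<delta> i)))\<^sup>2
      + 2 * K1 * a\<^sup>2 * (1 + (norm (corrected a (w i) (\<delta> i)))\<^sup>2)" if i: "i \<in> I" for i
  proof -
    let ?z = "(norm (corrected a (w i) (\<delta> i)))\<^sup>2"
    have "E (nx (w i)) (\<lambda>x. (norm (corrected a x (u i)))\<^sup>2)
      = E (Pi_pmf {i} d (\<lambda>i. nx (w i)))
         (\<lambda>w'. (norm (avg {i} (\<lambda>i. corrected a (w' i) (u i))))\<^sup>2)"
      by (simp add: Pi_pmf_singleton avg_def)
    also have "\<dots> \<le> (1 - c * a) * ?z + K1 * (a ^ 3 + a\<^sup>2) * (1 + ?z)"
      using corrected_mean_local_step[of "{i}" w a d \<delta>] a w[OF i] by (simp add: avg_def u_def)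
    also have "K1 * (a ^ 3 + a\<^sup>2) * (1 + ?z) \<le> K1 * (a\<^sup>2 + a\<^sup>2) * (1 + ?z)"
      using K1_ge(2) small_step(2)[OF a] a
      by (intro mult_right_mono mult_left_mono add_right_mono power_decreasing) auto
    finally show ?thesis by (simp add: algebra_simps)
  qed
  have "E (nexts I d w)
      (\<lambda>w'. energy a I w' u)
    = avg I (\<lambda>i. E (nexts I d w)
      (\<lambda>w'. (norm (corrected a (w' i) (u i)))\<^sup>2))"
    unfolding avg_def
    by (simp add: integrable_measure_pmf_finite finite_set_Pi_pmf I finite_nx)
  also have "\<dots> = avg I (\<lambda>i. E (nx (w i)) (\<lambda>x. (norm (corrected a x (u i)))\<^sup>2))"
    using I by (intro avg_cong expectation_Pi_pmf_component)
  also have "\<dots> \<le> avg I (\<lambda>i. (1 - c * a) * (norm (corrected a (w i) (\<delta> i)))\<^sup>2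
      + 2 * K1 * a\<^sup>2 * (1 + (norm (corrected a (w i) (\<delta> i)))\<^sup>2))"
    by (intro avg_mono single)
  also have "\<dots> = (1 - c * a) * Z + 2 * K1 * a\<^sup>2 * (1 + Z)"
    using I by (simp only: avg_add avg_mult avg_const[OF I] Z_def)
  finally show ?thesis .
qed

text \<open>Averaging the parameters costs the energy of the corrected parameters their dispersion, which
  pays for the displacement of the corrected mean.\<close>

lemma energy_synchronization:
  fixes I :: "'i set" and w :: "'i \<Rightarrow> 'w" and u :: "'i \<Rightarrow> 'v" and a :: real
  defines "Z \<equiv> energy a I w u"
    and "D \<equiv> avg I (\<lambda>i. (norm (u i - avg I u))\<^sup>2)"
  assumes I: "finite I" "I \<noteq> {}" and w: "\<And>i. i \<in> I \<Longrightarrow> w i \<in> G"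
    and a: "0 < a" "a * M \<le> 1"
  shows "avg I (\<lambda>i. (norm (corrected a (w i) (avg I u)))\<^sup>2) + D / 2
    \<le> Z + 648 * L\<^sup>2 * a\<^sup>2 * (1 + Z)"
proof -
  note sm = small_step[OF a]
  let ?m = "avg I u"
  let ?Zs = "energy a I w (\<lambda>_. ?m)"
  \<comment> \<open>The corrected parameter is z + q, with z taken at the mean and q equal to the
    deviation e up to a relative error 1/4. In |z + q|^2 the product of the mean with e is kept, as
    it vanishes on averaging. The other cross terms are at most 9/2 X |e|, where 9/4 = 1 + 5/4; they
    consume |e|^2 / 16 of the 9/16 |e|^2 provided by |q|^2, which leaves one half.\<close>
  have single: "(norm (corrected a (w i) ?m))\<^sup>2 + 2 * (?m \<bullet> (u i - ?m)) + (norm (u i - ?m))\<^sup>2 / 2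
      \<le> (norm (corrected a (w i) (u i)))\<^sup>2 + 81 * a\<^sup>2 * L\<^sup>2 * (1 + norm ?m)\<^sup>2" if i: "i \<in> I" for i
  proof -
    define z where "z = corrected a (w i) ?m"
    define e where "e = u i - ?m"
    define k where "k = g (w i) (u i) - g (w i) ?m"
    define q where "q = e + a *\<^sub>R k"
    have zq: "corrected a (w i) (u i) = z + q"
      by (simp add: z_def q_def e_def k_def corrected_def algebra_simps)
    have k: "norm k \<le> L * norm e"
      unfolding k_def e_def by (rule lipschitz_g[OF w[OF i]])
    have "norm (a *\<^sub>R k) \<le> a * L * norm e"
      using k a by simp
    also have "\<dots> \<le> 1 / 4 * norm e"
      using sm(1) by (intro mult_right_mono) auto
    finally have ak: "norm (a *\<^sub>R k) \<le> 1 / 4 * norm e" .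
    have q1: "norm q \<le> 5 / 4 * norm e"
      using norm_triangle_ineq[of e "a *\<^sub>R k"] ak by (simp add: q_def)
    have "3 / 4 * norm e \<le> norm q"
      using norm_diff_ineq[of e "a *\<^sub>R k"] ak by (simp add: q_def)
    then have "(3 / 4 * norm e)\<^sup>2 \<le> (norm q)\<^sup>2" by (intro power_mono) auto
    then have q2: "9 / 16 * (norm e)\<^sup>2 \<le> (norm q)\<^sup>2"
      by (simp add: power_mult_distrib power_divide)
    have "\<bar>?m \<bullet> k\<bar> \<le> norm ?m * norm k" by (rule Cauchy_Schwarz_ineq2)
    also have "\<dots> \<le> (1 + norm ?m) * (L * norm e)"
      using k L by (intro mult_mono) auto
    finally have mk: "- ((1 + norm ?m) * (L * norm e)) \<le> ?m \<bullet> k" by linarith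
    have "\<bar>g (w i) ?m \<bullet> q\<bar> \<le> norm (g (w i) ?m) * norm q" by (rule Cauchy_Schwarz_ineq2)
    also have "\<dots> \<le> (L * (1 + norm ?m)) * (5 / 4 * norm e)"
      using q1 L norm_g[OF w[OF i]] by (intro mult_mono) auto
    finally have gq: "- ((L * (1 + norm ?m)) * (5 / 4 * norm e)) \<le> g (w i) ?m \<bullet> q" by linarith
    let ?X = "a * L * (1 + norm ?m)"
    have "z \<bullet> q = ?m \<bullet> e + a * (?m \<bullet> k) + a * (g (w i) ?m \<bullet> q)"
      by (simp add: z_def q_def corrected_def inner_simps algebra_simps)
    moreover have "- (?X * norm e) \<le> a * (?m \<bullet> k)"
      using mult_left_mono[OF mk, of a] a by (simp add: mult_ac)
    moreover have "- (5 / 4 * (?X * norm e)) \<le> a * (g (w i) ?m \<bullet> q)"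
      using mult_left_mono[OF gq, of a] a by (simp add: mult_ac)
    ultimately have "?m \<bullet> e - 9 / 4 * (?X * norm e) \<le> z \<bullet> q"
      by linarith
    moreover have "9 / 2 * (?X * norm e) \<le> (norm e)\<^sup>2 / 16 + 81 * ?X\<^sup>2"
    proof -
      have "9 / 2 * (x * y) \<le> y\<^sup>2 / 16 + 81 * x\<^sup>2" for x y :: real
        using zero_le_power2[of "y / 4 - 9 * x"] by (simp add: power2_eq_square algebra_simps)
      then show ?thesis .
    qed
    moreover have "(norm (z + q))\<^sup>2 = (norm z)\<^sup>2 + 2 * (z \<bullet> q) + (norm q)\<^sup>2"
      by (simp add: power2_norm_eq_inner inner_simps inner_commute)
    ultimately have "(norm z)\<^sup>2 + 2 * (?m \<bullet> e) + (norm e)\<^sup>2 / 2 \<le> (norm (z + q))\<^sup>2 + 81 * ?X\<^sup>2"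
      using q2 by linarith
    then show ?thesis by (simp add: zq z_def e_def power_mult_distrib mult_ac)
  qed
  have "?Zs + 2 * (?m \<bullet> avg I (\<lambda>i. u i - ?m)) + D / 2
    = avg I (\<lambda>i. (norm (corrected a (w i) ?m))\<^sup>2 + 2 * (?m \<bullet> (u i - ?m)) + 1 / 2 * (norm (u i - ?m))\<^sup>2)"
    by (simp only: avg_add avg_mult avg_inner D_def)
  also have "\<dots> \<le> avg I (\<lambda>i. (norm (corrected a (w i) (u i)))\<^sup>2 + 81 * a\<^sup>2 * L\<^sup>2 * (1 + norm ?m)\<^sup>2)"
    using single by (intro avg_mono) simp
  also have "\<dots> = Z + 81 * a\<^sup>2 * L\<^sup>2 * (1 + norm ?m)\<^sup>2"
    using I by (simp only: avg_add avg_const[OF I] Z_def)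
  finally have Zs: "?Zs + D / 2 \<le> Z + 81 * a\<^sup>2 * L\<^sup>2 * (1 + norm ?m)\<^sup>2"
    using I by (simp add: avg_diff avg_const)
  \<comment> \<open>This 8 turns the constant 81 into 648.\<close>
  have "(1 + norm ?m)\<^sup>2 \<le> 8 * (1 + Z)"
  proof -
    have "1 + norm ?m \<le> 1 + avg I (\<lambda>i. norm (u i))"
      by (intro add_left_mono norm_avg_le)
    also have "\<dots> = avg I (\<lambda>i. 1 + norm (u i))"
      using I by (simp add: avg_add avg_const)
    finally have "(1 + norm ?m)\<^sup>2 \<le> (norm (avg I (\<lambda>i. 1 + norm (u i))))\<^sup>2"
      by (intro power_mono) auto
    also have "\<dots> \<le> avg I (\<lambda>i. (norm (1 + norm (u i)))\<^sup>2)"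
      by (rule norm_avg_square_le[OF I])
    also have "\<dots> \<le> avg I (\<lambda>i. 8 * (1 + (norm (corrected a (w i) (u i)))\<^sup>2))"
      using one_add_norm_le_corrected a sm(1) w by (intro avg_mono) simp
    also have "\<dots> = 8 * (1 + Z)"
      using I by (simp only: avg_add avg_mult avg_const[OF I] Z_def)
    finally show ?thesis .
  qed
  then have "81 * a\<^sup>2 * L\<^sup>2 * (1 + norm ?m)\<^sup>2 \<le> 81 * a\<^sup>2 * L\<^sup>2 * (8 * (1 + Z))"
    by (intro mult_left_mono) auto
  then show ?thesis using Zs by (simp add: algebra_simps)
qed

text \<open>The first summand lets the contraction of the energy, weighted by
  \<open>lam * a\<close>, absorb the noise of order a^2 Z in the mean; the second lets the
  dispersion removed by a synchronization pay for the displacement of the mean.\<close>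

definition lam :: real where "lam = 8 * K1 / c + 2 * (1 + 8 / c) * L\<^sup>2"

definition K2 :: real where "K2 = 2 * (1 + 2 * lam) * K1 + 648 * lam * L\<^sup>2"

definition lyapunov :: "real \<Rightarrow> 'i set \<Rightarrow> ('i \<Rightarrow> 'w) \<Rightarrow> ('i \<Rightarrow> 'v) \<Rightarrow> real" where
  "lyapunov a I w v = (norm (center a I w v))\<^sup>2
    + lam * a * energy a I w v"

definition fed_step :: "real \<Rightarrow> 'i set \<Rightarrow> bool \<Rightarrow> ('i \<Rightarrow> 'w) \<Rightarrow> ('i \<Rightarrow> 'v) \<Rightarrow> 'i \<Rightarrow> 'v" where
  "fed_step a I sync w v =
    (let u = (\<lambda>i. v i + a *\<^sub>R f (w i) (v i)) in if sync then (\<lambda>i. avg I u) else u)"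

lemma lam_ge: "8 * K1 / c \<le> lam" "2 * (1 + 8 / c) * L\<^sup>2 \<le> lam" "0 < lam"
proof -
  have *: "0 < 8 * K1 / c" "0 \<le> 2 * (1 + 8 / c) * L\<^sup>2" using K1_ge c by auto
  show "8 * K1 / c \<le> lam" "2 * (1 + 8 / c) * L\<^sup>2 \<le> lam" "0 < lam"
    using * unfolding lam_def by linarith+
qed

text \<open>Of the contraction c a of the energy, one quarter absorbs the Z-dependent noise of the
  mean, another its own, and one half remains. The part of its noise independent of Z is of order
  a^2 and enters with weight \<open>lam * a\<close>, hence as a^3.\<close>

lemma lyapunov_local_step:
  fixes I :: "'i set" and w :: "'i \<Rightarrow> 'w" and \<delta> :: "'i \<Rightarrow> 'v" and a :: real
  defines "u \<equiv> \<lambda>i. \<delta> i + a *\<^sub>R f (w i) (\<delta> i)"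
  assumes I: "finite I" "I \<noteq> {}" and w: "\<And>i. i \<in> I \<Longrightarrow> w i \<in> G"
    and a: "0 < a" "a * M \<le> 1"
  shows "E (nexts I d w) (\<lambda>w'. lyapunov a I w' u)
    \<le> (1 - c * a / 2) * lyapunov a I w \<delta> + (1 + 2 * lam) * K1 * (a ^ 3 + a\<^sup>2 / real (card I))"
proof -
  note sm = small_step[OF a]
  let ?k = "real (card I)"
  let ?Y = "(norm (center a I w \<delta>))\<^sup>2"
  let ?Z = "energy a I w \<delta>"
  have k: "1 \<le> ?k" using I by (simp add: Suc_le_eq card_gt_0_iff)
  have Z0: "0 \<le> ?Z" by (intro avg_nonneg) simp
  have K1: "0 < K1" using K1_ge(2) by simp
  have la: "0 < lam * a" using lam_ge(3) a by simp
  have "a ^ 3 \<le> a\<^sup>2" using a sm(2) by (intro power_decreasing) auto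
  moreover have "a\<^sup>2 / ?k \<le> a\<^sup>2" using divide_left_mono[of 1 ?k "a\<^sup>2"] k by simp
  ultimately have aa: "a ^ 3 + a\<^sup>2 / ?k \<le> 2 * a\<^sup>2" by linarith
  have "E (nexts I d w) (\<lambda>w'. lyapunov a I w' u)
    = E (nexts I d w)
        (\<lambda>w'. (norm (center a I w' u))\<^sup>2)
      + lam * a * E (nexts I d w)
        (\<lambda>w'. energy a I w' u)"
    unfolding lyapunov_def by (simp add: integrable_measure_pmf_finite finite_set_Pi_pmf I finite_nx)
  also have "\<dots> \<le> ((1 - c * a) * ?Y + K1 * (a ^ 3 + a\<^sup>2 / ?k) * (1 + ?Z))
      + lam * a * ((1 - c * a) * ?Z + 2 * K1 * a\<^sup>2 * (1 + ?Z))"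
    unfolding u_def using la
    by (intro add_mono mult_left_mono corrected_mean_local_step energy_local_step I w a) auto
  also have "K1 * (a ^ 3 + a\<^sup>2 / ?k) * (1 + ?Z) \<le> K1 * (a ^ 3 + a\<^sup>2 / ?k) + K1 * (2 * a\<^sup>2) * ?Z"
  proof -
    have "K1 * x * (1 + ?Z) \<le> K1 * x + K1 * y * ?Z" if "x \<le> y" for x y
      using mult_right_mono[OF mult_left_mono[OF that, of K1] Z0] K1 by (simp add: distrib_left)
    then show ?thesis using aa .
  qed
  also have "K1 * (2 * a\<^sup>2) * ?Z \<le> lam * a * (c * a / 4 * ?Z)"
  proof -
    have "8 * K1 \<le> lam * c" using lam_ge(1) c by (simp add: field_simps)
    then have "8 * K1 * (a\<^sup>2 / 4 * ?Z) \<le> lam * c * (a\<^sup>2 / 4 * ?Z)"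
      using Z0 by (intro mult_right_mono) auto
    then show ?thesis by (simp add: power2_eq_square mult_ac)
  qed
  also have "lam * a * ((1 - c * a) * ?Z + 2 * K1 * a\<^sup>2 * (1 + ?Z))
      \<le> lam * a * ((1 - c * a) * ?Z + c * a / 4 * ?Z) + 2 * lam * K1 * (a ^ 3 + a\<^sup>2 / ?k)"
  proof -
    have "2 * K1 * a\<^sup>2 * ?Z = (8 * K1 * a) * (a * ?Z / 4)" by (simp add: power2_eq_square)
    also have "\<dots> \<le> c * (a * ?Z / 4)" using sm(6) a Z0 by (intro mult_right_mono) auto
    finally have "lam * a * (2 * K1 * a\<^sup>2 * ?Z) \<le> lam * a * (c * a / 4 * ?Z)"
      using la by (intro mult_left_mono) auto
    moreover have "lam * a * (2 * K1 * a\<^sup>2) \<le> 2 * lam * K1 * (a ^ 3 + a\<^sup>2 / ?k)"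
      using lam_ge(3) K1 by (simp add: power2_eq_square power3_eq_cube distrib_left)
    ultimately show ?thesis by (simp add: distrib_left)
  qed
  also have "(1 - c * a) * ?Y \<le> (1 - c * a / 2) * ?Y"
    using a c by (intro mult_right_mono) auto
  finally show ?thesis unfolding lyapunov_def by (simp add: algebra_simps)
qed

text \<open>Replacing each correction by the one at the common mean moves y by a q with |q|^2 at
  most L^2 D. Young's inequality with parameter c a / 8 prices this at (1 + 8/c) L^2 a D, and the
  lam a D / 2 freed by \<open>energy_synchronization\<close> covers it.\<close>

lemma lyapunov_synchronization:
  fixes I :: "'i set" and w :: "'i \<Rightarrow> 'w" and u :: "'i \<Rightarrow> 'v" and a :: real
  assumes I: "finite I" "I \<noteq> {}" and w: "\<And>i. i \<in> I \<Longrightarrow> w i \<in> G"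
    and a: "0 < a" "a * M \<le> 1"
  shows "lyapunov a I w (\<lambda>i. avg I u) \<le> (1 + c * a / 8) * lyapunov a I w u + 648 * lam * L\<^sup>2 * a ^ 3"
proof -
  note sm = small_step[OF a]
  let ?m = "avg I u"
  let ?D = "avg I (\<lambda>i. (norm (u i - ?m))\<^sup>2)"
  let ?Z = "energy a I w u"
  let ?y = "center a I w u"
  let ?q = "avg I (\<lambda>i. g (w i) ?m - g (w i) (u i))"
  have la: "0 < lam * a" using lam_ge(3) a by simp
  have Z0: "0 \<le> ?Z" by (intro avg_nonneg) simp
  have D0: "0 \<le> ?D" by (intro avg_nonneg) simp
  have ca: "0 < c * a / 8" using c a by simp
  have "center a I w (\<lambda>_. ?m) = ?y + a *\<^sub>R ?q"
    by (simp add: avg_corrected avg_const[OF I] avg_diff algebra_simps)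
  then have "(norm (center a I w (\<lambda>_. ?m)))\<^sup>2
      \<le> (1 + c * a / 8) * (norm ?y)\<^sup>2 + (1 + 1 / (c * a / 8)) * (norm (a *\<^sub>R ?q))\<^sup>2"
    by (simp only: norm_add_square_le_young[OF ca])
  also have "(1 + 1 / (c * a / 8)) * (norm (a *\<^sub>R ?q))\<^sup>2 = (a * a + 8 / c * a) * (norm ?q)\<^sup>2"
    using a c by (simp add: power_mult_distrib power2_eq_square field_simps)
  also have "\<dots> \<le> (1 * a + 8 / c * a) * (L\<^sup>2 * ?D)"
  proof (intro mult_mono add_right_mono)
    have "(norm ?q)\<^sup>2 \<le> avg I (\<lambda>i. (norm (g (w i) ?m - g (w i) (u i)))\<^sup>2)"
      by (rule norm_avg_square_le[OF I])
    also have "\<dots> \<le> avg I (\<lambda>i. (L * norm (u i - ?m))\<^sup>2)"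
      using lipschitz_g w by (intro avg_mono power_mono) (auto simp: norm_minus_commute)
    also have "\<dots> = L\<^sup>2 * ?D" by (simp only: power_mult_distrib avg_mult)
    finally show "(norm ?q)\<^sup>2 \<le> L\<^sup>2 * ?D" .
  qed (use a c sm(2) D0 in auto)
  also have "\<dots> = (2 * (1 + 8 / c) * L\<^sup>2) * (a * ?D / 2)" by (simp add: algebra_simps)
  also have "\<dots> \<le> lam * (a * ?D / 2)"
    using lam_ge(2) a D0 by (intro mult_right_mono) auto
  finally have Y: "(norm (center a I w (\<lambda>_. ?m)))\<^sup>2
      \<le> (1 + c * a / 8) * (norm ?y)\<^sup>2 + lam * a * (?D / 2)" by simp
  have "lam * a * (energy a I w (\<lambda>_. ?m) + ?D / 2)
      \<le> lam * a * (?Z + 648 * L\<^sup>2 * a\<^sup>2 * (1 + ?Z))"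
    using la by (intro mult_left_mono energy_synchronization I w a) auto
  also have "\<dots> = lam * a * ?Z + lam * a * (648 * L\<^sup>2 * a * (a * ?Z)) + 648 * lam * L\<^sup>2 * a ^ 3"
    by (simp add: algebra_simps power2_eq_square power3_eq_cube)
  also have "lam * a * (648 * L\<^sup>2 * a * (a * ?Z)) \<le> lam * a * (c / 8 * (a * ?Z))"
    using la sm(5) a Z0 by (intro mult_left_mono mult_right_mono) auto
  finally show ?thesis using Y unfolding lyapunov_def by (simp add: algebra_simps)
qed

lemma lyapunov_step:
  fixes I :: "'i set" and w :: "'i \<Rightarrow> 'w" and \<delta> :: "'i \<Rightarrow> 'v" and a :: real
  assumes I: "finite I" "I \<noteq> {}" and w: "\<And>i. i \<in> I \<Longrightarrow> w i \<in> G"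
    and a: "0 < a" "a * M \<le> 1"
  shows "E (nexts I d w)
      (\<lambda>w'. lyapunov a I w' (fed_step a I sync w \<delta>))
    \<le> (1 - c / 4 * a) * lyapunov a I w \<delta> + K2 * (a ^ 3 + a\<^sup>2 / real (card I))"
proof -
  note sm = small_step[OF a]
  let ?P = "nexts I d w"
  let ?u = "\<lambda>i. \<delta> i + a *\<^sub>R f (w i) (\<delta> i)"
  let ?V = "lyapunov a I w \<delta>" and ?e = "a ^ 3 + a\<^sup>2 / real (card I)"
  have finP: "finite (set_pmf ?P)" by (intro finite_set_Pi_pmf I finite_nx)
  have V0: "0 \<le> lyapunov a I w' v" for w' v
    unfolding lyapunov_def using lam_ge(3) a by (intro add_nonneg_nonneg mult_nonneg_nonneg avg_nonneg) auto
  have e0: "a ^ 3 \<le> ?e" "0 \<le> ?e" using a by auto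
  have "E ?P (\<lambda>w'. lyapunov a I w' (fed_step a I sync w \<delta>))
    \<le> E ?P (\<lambda>w'. (1 + c * a / 8) * lyapunov a I w' ?u + 648 * lam * L\<^sup>2 * a ^ 3)"
  \<comment> \<open>Synchronizing involves no new randomness, so its cost is estimated for each
    outcome w' and averaged afterwards.\<close>
  proof (rule expectation_mono_finite[OF finP])
    fix w' assume "w' \<in> set_pmf ?P"
    then have w': "w' i \<in> G" if "i \<in> I" for i
      using that w closed set_Pi_pmf_subset'[OF I(1), of d "\<lambda>i. nx (w i)"]
      by (force simp: PiE_dflt_def)
    show "lyapunov a I w' (fed_step a I sync w \<delta>)
      \<le> (1 + c * a / 8) * lyapunov a I w' ?u + 648 * lam * L\<^sup>2 * a ^ 3"
    proof (cases sync)
      case True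
      then show ?thesis
        using lyapunov_synchronization[OF I w' a, where u = ?u] by (simp add: fed_step_def)
    next
      case False
      have "0 \<le> c * a / 8 * lyapunov a I w' ?u" "0 \<le> 648 * lam * L\<^sup>2 * a ^ 3"
        using V0 c a lam_ge(3) by auto
      then show ?thesis using False by (simp add: fed_step_def algebra_simps)
    qed
  qed
  also have "\<dots> = (1 + c * a / 8) * E ?P (\<lambda>w'. lyapunov a I w' ?u)
      + 648 * lam * L\<^sup>2 * a ^ 3"
    by (simp add: integrable_measure_pmf_finite finP)
  also have "\<dots> \<le> (1 + c * a / 8) * ((1 - c * a / 2) * ?V + (1 + 2 * lam) * K1 * ?e)
      + 648 * lam * L\<^sup>2 * ?e"
    using lam_ge(3) c a e0
    by (intro add_mono mult_left_mono lyapunov_local_step I w a) auto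
  also have "\<dots> = ((1 + c * a / 8) * (1 - c * a / 2)) * ?V
      + (1 + c * a / 8) * ((1 + 2 * lam) * K1 * ?e) + 648 * lam * L\<^sup>2 * ?e"
    by (simp only: distrib_left mult.assoc)
  also have "\<dots> \<le> (1 - c / 4 * a) * ?V + 2 * ((1 + 2 * lam) * K1 * ?e) + 648 * lam * L\<^sup>2 * ?e"
  proof (intro add_mono mult_right_mono V0 order_refl)
    \<comment> \<open>A synchronization gives back an eighth of c a against the half gained locally;
      a quarter is kept as the rate for both kinds of step.\<close>
    have "(1 + x / 8) * (1 - x / 2) = 1 - 3 / 8 * x - x\<^sup>2 / 16" for x :: real
      by (simp add: field_simps power2_eq_square)
    from this[of "c * a"]
    have "(1 + c * a / 8) * (1 - c * a / 2) = 1 - 3 / 8 * (c * a) - (c * a)\<^sup>2 / 16" .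
    moreover have "0 \<le> c * a" "0 \<le> (c * a)\<^sup>2" using c a by auto
    ultimately show "(1 + c * a / 8) * (1 - c * a / 2) \<le> 1 - c / 4 * a"
      by (simp only: times_divide_eq_left times_divide_eq_right)
    show "1 + c * a / 8 \<le> 2" using sm(4) c a by (simp add: mult.commute)
    show "0 \<le> (1 + 2 * lam) * K1 * ?e" using lam_ge(3) K1_ge(2) e0 by auto
  qed (use lam_ge(3) e0 in auto)
  finally show ?thesis by (simp add: K2_def algebra_simps)
qed

text \<open>The value at 0 stays inside the average, where independence of the agents can make it
  small; only the dependence on v is estimated agent by agent.\<close>

lemma norm_avg_le_of_lipschitz:
  fixes I :: "'i set" and F :: "'w \<Rightarrow> 'v \<Rightarrow> 'v"
  assumes I: "finite I" "I \<noteq> {}"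
    and F: "\<And>i. i \<in> I \<Longrightarrow> norm (F (w i) v - F (w i) 0) \<le> L * norm (v - 0)"
  shows "norm (avg I (\<lambda>i. F (w i) v)) \<le> L * norm v + norm (avg I (\<lambda>i. F (w i) 0))"
proof -
  have "norm (avg I (\<lambda>i. F (w i) v) - avg I (\<lambda>i. F (w i) 0))
      \<le> avg I (\<lambda>i. norm (F (w i) v - F (w i) 0))"
    unfolding avg_diff[symmetric] by (rule norm_avg_le)
  also have "\<dots> \<le> avg I (\<lambda>i. L * norm (v - 0))" by (intro avg_mono F)
  also have "\<dots> = L * norm v" using I by (simp add: avg_const)
  finally show ?thesis
    using norm_triangle_ineq2[of "avg I (\<lambda>i. F (w i) v)" "avg I (\<lambda>i. F (w i) 0)"] by linarith
qed

lemma norm_le_avg_corrected: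
  fixes I :: "'i set" and w :: "'i \<Rightarrow> 'w"
  assumes I: "finite I" "I \<noteq> {}" and w: "\<And>i. i \<in> I \<Longrightarrow> w i \<in> G"
    and a: "0 < a" "a * M \<le> 1"
  shows "norm v \<le> 2 * norm (center a I w (\<lambda>_. v)) + 2 * a * norm (avg I (\<lambda>i. g (w i) 0))"
proof -
  let ?h = "avg I (\<lambda>i. g (w i) v)" and ?b = "norm (avg I (\<lambda>i. g (w i) 0))"
  let ?y = "v + a *\<^sub>R ?h"
  have y: "center a I w (\<lambda>_. v) = ?y"
    unfolding avg_corrected[where p = "\<lambda>i. v"] using I by (simp add: avg_const)
  have h: "norm ?h \<le> L * norm v + ?b"
    by (intro norm_avg_le_of_lipschitz I lipschitz_g w)
  have "norm v \<le> norm ?y + norm (a *\<^sub>R ?h)"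
    by (metis add_diff_cancel_right' norm_triangle_ineq4)
  moreover have "norm (a *\<^sub>R ?h) \<le> a * (L * norm v + ?b)" using h a by simp
  moreover have "a * L * norm v \<le> 1 / 4 * norm v"
    using small_step(1)[OF a] by (intro mult_right_mono) auto
  ultimately have "3 / 4 * norm v \<le> norm ?y + a * ?b" by (simp add: algebra_simps)
  moreover have "0 \<le> a * ?b" using a by simp
  ultimately show ?thesis unfolding y mult.assoc using norm_ge_zero[of ?y] by argo
qed

text \<open>With synchronization in every step the remainder involves only averages over all agents, whose
  second moments decrease with the number of agents.\<close>

lemma synchronized_step:
  fixes I :: "'i set" and w :: "'i \<Rightarrow> 'w" and v :: 'v and a :: real
  defines "\<beta> \<equiv> (norm (avg I (\<lambda>i. f (w i) 0)))\<^sup>2 + (norm (avg I (\<lambda>i. g (w i) 0)))\<^sup>2"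
  assumes I: "finite I" "I \<noteq> {}" and w: "\<And>i. i \<in> I \<Longrightarrow> w i \<in> G"
    and a: "0 < a" "a * M \<le> 1"
  shows "E (nexts I d w)
      (\<lambda>w'. (norm (avg I (\<lambda>i. corrected a (w' i) (fed_step a I True w (\<lambda>i. v) i))))\<^sup>2)
    \<le> (1 - c / 4 * a) * (norm (center a I w (\<lambda>_. v)))\<^sup>2
      + K1 * (a ^ 3 * \<beta> + a\<^sup>2 / real (card I))"
proof -
  note sm = small_step[OF a]
  let ?k = "real (card I)"
  have k: "1 \<le> ?k" using I by (simp add: Suc_le_eq card_gt_0_iff)
  define bf where "bf = norm (avg I (\<lambda>i. f (w i) 0))"
  define bg where "bg = norm (avg I (\<lambda>i. g (w i) 0))"
  let ?h = "avg I (\<lambda>i. g (w i) v)" and ?F = "avg I (\<lambda>i. f (w i) v)"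
  define m where "m = v + a *\<^sub>R ?F"
  let ?r = "avg I (\<lambda>i. gm (w i) m - gm (w i) v)"
  let ?y = "v + a *\<^sub>R ?h"
  have b0: "0 \<le> bf" "0 \<le> bg" by (simp_all add: bf_def bg_def)
  have F: "norm ?F \<le> L * norm v + bf" and h: "norm ?h \<le> L * norm v + bg"
    unfolding bf_def bg_def
    using norm_avg_le_of_lipschitz[where F = f, OF I lipschitz_f[OF w]]
      norm_avg_le_of_lipschitz[where F = g, OF I lipschitz_g[OF w]] by auto
  have mv: "norm (m - v) \<le> a * (L * norm v + bf)"
    using F a by (simp add: m_def)
  have y: "center a I w (\<lambda>_. v) = ?y"
    unfolding avg_corrected[where p = "\<lambda>i. v"] using I by (simp add: avg_const)
  have "2 * a * bg \<le> 1 * bg" using sm(2) b0 by (intro mult_right_mono) auto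
  then have v: "norm v \<le> 2 * norm ?y + bg"
    using norm_le_avg_corrected[where w = w and v = v, OF I w a] unfolding y bg_def[symmetric] by simp
  \<comment> \<open>48 = 4^2 * 3, the 3 coming from the square of a sum of three terms.\<close>
  have e: "(norm (?r - a *\<^sub>R B ?h))\<^sup>2 \<le> 48 * a\<^sup>2 * L ^ 4 * ((norm ?y)\<^sup>2 + \<beta>)"
  proof -
    have "norm ?r \<le> avg I (\<lambda>i. norm (gm (w i) m - gm (w i) v))" by (rule norm_avg_le)
    also have "\<dots> \<le> avg I (\<lambda>i. L * norm (m - v))" by (intro avg_mono lipschitz_gm w)
    also have "\<dots> = L * norm (m - v)" using I by (simp add: avg_const)
    also have "\<dots> \<le> L * (a * (L * norm v + bf))" using mv L by (intro mult_left_mono) auto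
    finally have "norm ?r \<le> a * L * (L * norm v + bf)" by (simp add: mult_ac)
    moreover have "norm (a *\<^sub>R B ?h) \<le> a * (L * (L * norm v + bg))"
      using norm_B[of ?h] mult_left_mono[OF h, of L] a L by (simp add: mult_left_mono order_trans)
    ultimately have "norm (?r - a *\<^sub>R B ?h) \<le> a * L * (2 * (L * norm v) + bf + bg)"
      using norm_triangle_ineq4[of ?r "a *\<^sub>R B ?h"] by (simp add: algebra_simps)
    also have "\<dots> \<le> a * L * (2 * (L * (2 * norm ?y + bg)) + L * bf + L * bg)"
      using v a L b0 mult_right_mono[OF L b0(1)] mult_right_mono[OF L b0(2)]
      by (intro mult_left_mono add_mono) auto
    also have "\<dots> \<le> a * L * (L * (4 * (norm ?y + bf + bg)))"
      using a L b0 by (simp add: algebra_simps)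
    finally have "(norm (?r - a *\<^sub>R B ?h))\<^sup>2 \<le> (a * L * (L * (4 * (norm ?y + bf + bg))))\<^sup>2"
      by (intro power_mono) auto
    also have "\<dots> = 16 * a\<^sup>2 * L ^ 4 * (norm ?y + bf + bg)\<^sup>2"
    proof -
      have "(a * L * (L * (4 * x)))\<^sup>2 = 16 * a\<^sup>2 * L ^ 4 * x\<^sup>2" for x
        by (simp add: power4_eq_xxxx power2_eq_square)
      then show ?thesis .
    qed
    also have "16 * a\<^sup>2 * L ^ 4 * (norm ?y + bf + bg)\<^sup>2 \<le> 16 * a\<^sup>2 * L ^ 4 * (3 * ((norm ?y)\<^sup>2 + \<beta>))"
    proof (rule mult_left_mono)
      have "(x + y + z)\<^sup>2 \<le> 3 * (x\<^sup>2 + (y\<^sup>2 + z\<^sup>2))" for x y z :: real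
        using zero_le_power2[of "x - y"] zero_le_power2[of "x - z"] zero_le_power2[of "y - z"]
        by (simp add: power2_eq_square algebra_simps)
      then show "(norm ?y + bf + bg)\<^sup>2 \<le> 3 * ((norm ?y)\<^sup>2 + \<beta>)"
        by (simp add: \<beta>_def bf_def bg_def)
    qed simp
    also have "\<dots> = 48 * a\<^sup>2 * L ^ 4 * ((norm ?y)\<^sup>2 + \<beta>)"
      by (simp only: mult.assoc mult.left_commute[of _ 3])
    finally show ?thesis .
  qed
  have noise: "(1 + norm m)\<^sup>2 \<le> 48 * (1 + (norm ?y)\<^sup>2)"
  proof -
    have "m = avg I (\<lambda>i. v + a *\<^sub>R f (w i) v)"
      using I by (simp add: m_def avg_add avg_scaleR avg_const)
    then have "1 + norm m \<le> 1 + avg I (\<lambda>i. norm (v + a *\<^sub>R f (w i) v))"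
      by (simp add: norm_avg_le)
    also have "\<dots> = avg I (\<lambda>i. 1 + norm (v + a *\<^sub>R f (w i) v))"
      using I by (simp add: avg_add avg_const)
    also have "\<dots> \<le> avg I (\<lambda>i. 2 * (1 + norm v))"
      using sm(1) a w by (intro avg_mono one_add_norm_update_le) auto
    also have "\<dots> = 2 * (1 + norm v)" by (rule avg_const[OF I])
    finally have m: "1 + norm m \<le> 2 * (1 + norm v)" .
    have "norm ?h \<le> avg I (\<lambda>i. norm (g (w i) v))" by (rule norm_avg_le)
    also have "\<dots> \<le> avg I (\<lambda>i. L * (1 + norm v))" by (intro avg_mono norm_g w)
    also have "\<dots> = L * (1 + norm v)" by (rule avg_const[OF I])
    finally have "norm (a *\<^sub>R ?h) \<le> a * L * (1 + norm v)" using a by simp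
    also have "\<dots> \<le> 1 / 4 * (1 + norm v)" using sm(1) by (intro mult_right_mono) auto
    finally have "norm (a *\<^sub>R ?h) \<le> 1 / 4 * (1 + norm v)" .
    moreover have "norm v \<le> norm ?y + norm (a *\<^sub>R ?h)"
      by (metis add_diff_cancel_right' norm_triangle_ineq4)
    ultimately have "1 + norm m \<le> 3 * (1 + norm ?y)"
      using m norm_ge_zero[of ?y] by argo
    then have "(1 + norm m)\<^sup>2 \<le> (3 * (1 + norm ?y))\<^sup>2" by (intro power_mono) auto
    also have "\<dots> = 9 * (1 + norm ?y)\<^sup>2" by (simp only: power_mult_distrib) simp
    finally have "(1 + norm m)\<^sup>2 \<le> 9 * (1 + norm ?y)\<^sup>2" .
    \<comment> \<open>The computation yields 9 * 2 = 18; 48 matches \<open>K1\<close>.\<close>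
    moreover have "x \<le> 48 * (1 + z)" if "x \<le> 9 * y" "y \<le> 2 * 1\<^sup>2 + 2 * z" "0 \<le> z" for x y z :: real
      using that by simp
    ultimately show ?thesis
      using add_square_le[of 1 "norm ?y"] zero_le_power2[of "norm ?y"] by blast
  qed
  have fs: "fed_step a I True w (\<lambda>i. v) = (\<lambda>i. m)"
    using I by (simp add: fed_step_def m_def avg_add avg_scaleR avg_const)
  have "E (nexts I d w)
      (\<lambda>w'. (norm (center a I w' (\<lambda>_. m)))\<^sup>2)
    \<le> (1 - c * a) * (norm (avg I (\<lambda>i. v) + a *\<^sub>R ?h))\<^sup>2
      + (1 + 2 / c) * a * (norm (?r - a *\<^sub>R B ?h))\<^sup>2
      + a\<^sup>2 * L\<^sup>2 / ?k * avg I (\<lambda>i. (1 + norm m)\<^sup>2)"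
    unfolding avg_corrected[where p = "\<lambda>i. m"]
    using sm a I by (intro corrected_mean_step I w) (auto simp: m_def avg_const)
  also have "(1 + 2 / c) * a * (norm (?r - a *\<^sub>R B ?h))\<^sup>2
      \<le> (1 + 2 / c) * a * (48 * a\<^sup>2 * L ^ 4 * ((norm ?y)\<^sup>2 + \<beta>))"
    using a c by (intro mult_left_mono e) auto
  also have "\<dots> = K1 * (a ^ 3 * ((norm ?y)\<^sup>2 + \<beta>))"
    unfolding K1_def by (simp only: power2_eq_square power3_eq_cube ac_simps)
  also have "a\<^sup>2 * L\<^sup>2 / ?k * avg I (\<lambda>i. (1 + norm m)\<^sup>2) \<le> a\<^sup>2 * L\<^sup>2 / ?k * (48 * (1 + (norm ?y)\<^sup>2))"
    using noise I by (intro mult_left_mono) (auto simp: avg_const)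
  also have "\<dots> = 48 * L\<^sup>2 * (a\<^sup>2 / ?k * (1 + (norm ?y)\<^sup>2))" by simp
  also have "\<dots> \<le> K1 * (a\<^sup>2 / ?k * (1 + (norm ?y)\<^sup>2))"
    using K1_ge(1) by (intro mult_right_mono) auto
  finally have main: "E (nexts I d w)
      (\<lambda>w'. (norm (center a I w' (\<lambda>_. m)))\<^sup>2)
    \<le> (1 - c * a) * (norm ?y)\<^sup>2 + K1 * (a ^ 3 * ((norm ?y)\<^sup>2 + \<beta>))
      + K1 * (a\<^sup>2 / ?k * (1 + (norm ?y)\<^sup>2))"
    using I by (simp add: avg_const)
  have "a ^ 3 \<le> a\<^sup>2" using a sm(2) by (intro power_decreasing) auto
  moreover have "a\<^sup>2 / ?k \<le> a\<^sup>2" using divide_left_mono[of 1 ?k "a\<^sup>2"] k by simp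
  ultimately have "K1 * (a ^ 3 + a\<^sup>2 / ?k) \<le> K1 * (2 * a\<^sup>2)"
    using K1_ge(2) by (intro mult_left_mono) auto
  also have "\<dots> = (8 * K1 * a) * (a / 4)" by (simp add: power2_eq_square)
  also have "\<dots> \<le> c * (a / 4)" using sm(6) a by (intro mult_right_mono) auto
  \<comment> \<open>Noise proportional to |y|^2 takes at most a quarter of the contraction; what
    remains is weakened to the rate c/4 of \<open>lyapunov_step\<close>, so that both cases share
    it.\<close>
  finally have small: "K1 * (a ^ 3 + a\<^sup>2 / ?k) * (norm ?y)\<^sup>2 \<le> c * (a / 4) * (norm ?y)\<^sup>2"
    by (intro mult_right_mono) auto
  have pos: "0 \<le> c * a * (norm ?y)\<^sup>2" using c a by simp
  have alg: "(1 - c * a) * z + k * (b * (z + d)) + k * (e * (1 + z)) = z - c * a * z + k * (b * d + e) + k * (b + e) * z"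
    "(1 - c / 4 * a) * z = z - c * a * z / 4" "c * (a / 4) * z = c * a * z / 4" for b d e k z :: real
    by (simp_all add: algebra_simps)
  show ?thesis
    using main small pos unfolding fs y alg by linarith
qed

section \<open>Iteration along the joint law of noise and parameters\<close>

primrec joint :: "'w pmf \<Rightarrow> 'v \<Rightarrow> real \<Rightarrow> 'i set \<Rightarrow> 'w \<Rightarrow> nat \<Rightarrow> nat \<Rightarrow> (('i \<Rightarrow> 'w) \<times> ('i \<Rightarrow> 'v)) pmf" where
  "joint p0 v0 a I d K 0 = map_pmf (\<lambda>w. (w, \<lambda>_. v0)) (Pi_pmf I d (\<lambda>_. p0))"
| "joint p0 v0 a I d K (Suc t) = bind_pmf (joint p0 v0 a I d K t) (\<lambda>x.
     map_pmf (\<lambda>w'. (w', fed_step a I (K dvd Suc t) (fst x) (snd x))) (nexts I d (fst x)))"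

primrec law :: "'w pmf \<Rightarrow> nat \<Rightarrow> 'w pmf" where
  "law p0 0 = p0"
| "law p0 (Suc t) = bind_pmf (law p0 t) nx"

context
  fixes p0 :: "'w pmf" and v0 :: 'v and I :: "'i set"
  assumes p0: "finite (set_pmf p0)" "set_pmf p0 \<subseteq> G" and I: "finite I" "I \<noteq> {}"
begin

lemma finite_law: "finite (set_pmf (law p0 t))"
  by (induction t) (auto intro: p0 finite_nx)

lemma law_in_G: "w \<in> set_pmf (law p0 t) \<Longrightarrow> w \<in> G"
  by (induction t arbitrary: w) (use p0 closed in auto)

lemma finite_joint: "finite (set_pmf (joint p0 v0 a I d K t))"
  by (induction t) (auto intro!: finite_set_Pi_pmf I p0 finite_nx)

text \<open>Synchronization couples the parameters but never feeds back into the noise, so the noise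
  states of the agents stay independent and identically distributed.\<close>

lemma map_fst_joint: "map_pmf fst (joint p0 v0 a I d K t) = Pi_pmf I d (\<lambda>_. law p0 t)"
proof (induction t)
  case (Suc t)
  have "map_pmf fst (joint p0 v0 a I d K (Suc t))
    = bind_pmf (map_pmf fst (joint p0 v0 a I d K t)) (\<lambda>w. Pi_pmf I d (\<lambda>i. nx (w i)))"
    by (simp add: map_bind_pmf bind_map_pmf pmf.map_comp o_def)
  also have "\<dots> = Pi_pmf I d (\<lambda>_. law p0 (Suc t))"
    unfolding Suc law.simps by (rule Pi_pmf_bind[OF I(1), symmetric])
  finally show ?case .
qed (simp add: pmf.map_comp o_def)

lemma joint_in_G:
  assumes "x \<in> set_pmf (joint p0 v0 a I d K t)" "i \<in> I"
  shows "fst x i \<in> G"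
proof -
  have "fst x \<in> set_pmf (map_pmf fst (joint p0 v0 a I d K t))" using assms by auto
  then have "fst x i \<in> set_pmf (law p0 t)"
    using set_Pi_pmf_subset'[OF I(1)] assms(2) unfolding map_fst_joint
    by (force simp: PiE_dflt_def)
  then show ?thesis by (rule law_in_G)
qed

lemma joint_synchronized:
  assumes "x \<in> set_pmf (joint p0 v0 a I d 1 t)"
  shows "\<exists>v. snd x = (\<lambda>_. v)"
  using assms by (cases t) (auto simp: fed_step_def)

lemma expectation_joint_Suc:
  fixes \<Psi> :: "('i \<Rightarrow> 'w) \<times> ('i \<Rightarrow> 'v) \<Rightarrow> real"
  shows "E (joint p0 v0 a I d K (Suc t)) \<Psi>
    = E (joint p0 v0 a I d K t) (\<lambda>x.
        E (nexts I d (fst x))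
          (\<lambda>w'. \<Psi> (w', fed_step a I (K dvd Suc t) (fst x) (snd x))))"
  by (simp add: expectation_bind_finite finite_joint finite_set_Pi_pmf I finite_nx)

lemma norm_corrected_initial_le:
  assumes "w \<in> G" "0 < a" "a * M \<le> 1"
  shows "(norm (corrected a w v0))\<^sup>2 \<le> 4 * (1 + norm v0)\<^sup>2"
proof -
  have "norm (corrected a w v0) \<le> norm v0 + a * (L * (1 + norm v0))"
    unfolding corrected_def using norm_g[OF assms(1), of v0] assms(2)
    by (intro norm_triangle_mono) auto
  also have "a * (L * (1 + norm v0)) \<le> 1 * (1 + norm v0)"
    using small_step(1)[OF assms(2,3)] mult_right_mono[of "a * L" 1 "1 + norm v0"] by simp
  finally have "(norm (corrected a w v0))\<^sup>2 \<le> (2 * (1 + norm v0))\<^sup>2"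
    by (intro power_mono) auto
  then show ?thesis by (simp only: power_mult_distrib) simp
qed

text \<open>A linear recursion: its stationary level is the noise K2 (a^3 + a^2 / N) divided by the
  rate c a / 4.\<close>

lemma lyapunov_joint_le:
  assumes a: "0 < a" "a * M \<le> 1"
  shows "E (joint p0 v0 a I d K t) (\<lambda>x. lyapunov a I (fst x) (snd x))
    \<le> (1 - c / 4 * a) ^ t * (4 * (1 + lam) * (1 + norm v0)\<^sup>2)
      + 4 / c * K2 * (a\<^sup>2 + a / real (card I))"
proof -
  let ?E = "\<lambda>t. E (joint p0 v0 a I d K t) (\<lambda>x. lyapunov a I (fst x) (snd x))"
  let ?e = "a ^ 3 + a\<^sup>2 / real (card I)"
  let ?f = "a\<^sup>2 + a / real (card I)"
  have q: "0 \<le> 1 - c / 4 * a" using small_step(4)[OF a] by (simp add: mult.commute)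
  have K2: "0 \<le> K2" unfolding K2_def using K1_ge(2) lam_ge(3) by simp
  have step: "?E (Suc t) \<le> (1 - c / 4 * a) * ?E t + K2 * ?e" for t
  proof -
    have "?E (Suc t) \<le> E (joint p0 v0 a I d K t)
        (\<lambda>x. (1 - c / 4 * a) * lyapunov a I (fst x) (snd x) + K2 * ?e)"
      unfolding expectation_joint_Suc fst_conv snd_conv
      by (intro expectation_mono_finite finite_joint lyapunov_step I a joint_in_G)
    then show ?thesis by (simp add: integrable_measure_pmf_finite[OF finite_joint])
  qed
  show ?thesis
  proof (induction t)
    case 0
    have "?E 0 \<le> 4 * (1 + lam) * (1 + norm v0)\<^sup>2"
    proof -
      have "?E 0 \<le> E (joint p0 v0 a I d K 0) (\<lambda>x. 4 * (1 + lam) * (1 + norm v0)\<^sup>2)"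
      proof (rule expectation_mono_finite[OF finite_joint])
        fix x assume x: "x \<in> set_pmf (joint p0 v0 a I d K 0)"
        then have s: "snd x = (\<lambda>_. v0)" by auto
        let ?Z = "energy a I (fst x) (\<lambda>_. v0)"
        have "?Z \<le> avg I (\<lambda>i. 4 * (1 + norm v0)\<^sup>2)"
          using x by (intro avg_mono norm_corrected_initial_le a joint_in_G)
        then have Z: "?Z \<le> 4 * (1 + norm v0)\<^sup>2" by (simp only: avg_const[OF I])
        have "0 \<le> ?Z" by (intro avg_nonneg) simp
        then have "lam * a * ?Z \<le> lam * 1 * ?Z"
          using lam_ge(3) small_step(2)[OF a] by (intro mult_right_mono mult_left_mono) auto
        then have "lyapunov a I (fst x) (snd x) \<le> ?Z + lam * ?Z"
          unfolding lyapunov_def s using norm_avg_square_le[OF I] by (intro add_mono) auto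
        also have "\<dots> = (1 + lam) * ?Z" by (simp add: algebra_simps)
        also have "\<dots> \<le> (1 + lam) * (4 * (1 + norm v0)\<^sup>2)"
          using Z lam_ge(3) by (intro mult_left_mono) auto
        finally show "lyapunov a I (fst x) (snd x) \<le> 4 * (1 + lam) * (1 + norm v0)\<^sup>2"
          by (simp only: mult_ac)
      qed
      then show ?thesis by simp
    qed
    moreover have "0 \<le> 4 / c * K2 * ?f" using c K2 a by auto
    ultimately show ?case by simp
  next
    case (Suc t)
    let ?A = "4 * (1 + lam) * (1 + norm v0)\<^sup>2"
    have "?E (Suc t) \<le> (1 - c / 4 * a) * ((1 - c / 4 * a) ^ t * ?A + 4 / c * K2 * ?f) + K2 * ?e"
      using step[of t] mult_left_mono[OF Suc q] by linarith
    also have "K2 * ?e = c / 4 * a * (4 / c * K2 * ?f)"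
      using c by (simp add: power2_eq_square power3_eq_cube field_simps)
    also have "(1 - s) * (p * A + x) + s * x = (1 - s) * p * A + x" for s p A x :: real
      by (simp add: algebra_simps)
    finally show ?case by (simp only: power_Suc)
  qed
qed

text \<open>Undoing the correction costs order a^2 (1 + Z), while the Lyapunov function controls lam
  a Z; the spare factor a is enough.\<close>

lemma mean_square_joint_le:
  assumes a: "0 < a" "a * M \<le> 1"
  defines "K3 \<equiv> 2 + 16 * L\<^sup>2 + 16 * L\<^sup>2 / lam"
  shows "E (joint p0 v0 a I d K t) (\<lambda>x. (norm (avg I (snd x)))\<^sup>2)
    \<le> K3 * ((1 - c / 4 * a) ^ t * (4 * (1 + lam) * (1 + norm v0)\<^sup>2)
      + 4 / c * K2 * (a\<^sup>2 + a / real (card I)) + a\<^sup>2)"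
proof -
  note sm = small_step[OF a]
  have K3: "0 \<le> K3" unfolding K3_def using lam_ge(3) by simp
  have "E (joint p0 v0 a I d K t) (\<lambda>x. (norm (avg I (snd x)))\<^sup>2)
    \<le> E (joint p0 v0 a I d K t) (\<lambda>x. K3 * (lyapunov a I (fst x) (snd x) + a\<^sup>2))"
  proof (rule expectation_mono_finite[OF finite_joint])
    fix x assume x: "x \<in> set_pmf (joint p0 v0 a I d K t)"
    let ?Z = "energy a I (fst x) (snd x)"
    let ?y = "center a I (fst x) (snd x)"
    let ?h = "avg I (\<lambda>i. g (fst x i) (snd x i))"
    let ?V = "lyapunov a I (fst x) (snd x)"
    have Z0: "0 \<le> ?Z" by (intro avg_nonneg) simp
    have V: "?V = (norm ?y)\<^sup>2 + lam * a * ?Z" by (simp add: lyapunov_def)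
    have "(norm ?h)\<^sup>2 \<le> avg I (\<lambda>i. (norm (g (fst x i) (snd x i)))\<^sup>2)"
      by (rule norm_avg_square_le[OF I])
    also have "\<dots> \<le> avg I (\<lambda>i. L\<^sup>2 * (8 * (1 + (norm (corrected a (fst x i) (snd x i)))\<^sup>2)))"
    proof (rule avg_mono)
      fix i assume i: "i \<in> I"
      have "(norm (g (fst x i) (snd x i)))\<^sup>2 \<le> (L * (1 + norm (snd x i)))\<^sup>2"
        by (intro power_mono norm_g joint_in_G[OF x i]) auto
      also have "\<dots> = L\<^sup>2 * (1 + norm (snd x i))\<^sup>2" by (simp only: power_mult_distrib)
      also have "\<dots> \<le> L\<^sup>2 * (8 * (1 + (norm (corrected a (fst x i) (snd x i)))\<^sup>2))"
        using sm(1) by (intro mult_left_mono one_add_norm_le_corrected joint_in_G[OF x i] a) auto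
      finally show "(norm (g (fst x i) (snd x i)))\<^sup>2
        \<le> L\<^sup>2 * (8 * (1 + (norm (corrected a (fst x i) (snd x i)))\<^sup>2))" .
    qed
    also have "\<dots> = L\<^sup>2 * (8 * (1 + ?Z))" by (simp only: avg_mult avg_add avg_const[OF I])
    finally have h: "(norm ?h)\<^sup>2 \<le> L\<^sup>2 * (8 * (1 + ?Z))" .
    have "avg I (snd x) = ?y + (- a) *\<^sub>R ?h"
      by (simp add: avg_corrected)
    then have "(norm (avg I (snd x)))\<^sup>2 \<le> 2 * (norm ?y)\<^sup>2 + 2 * (norm ((- a) *\<^sub>R ?h))\<^sup>2"
      using norm_add_square_le[of ?y "(- a) *\<^sub>R ?h"] by simp
    also have "(norm ((- a) *\<^sub>R ?h))\<^sup>2 = a\<^sup>2 * (norm ?h)\<^sup>2"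
      by (simp add: power_mult_distrib)
    finally have "(norm (avg I (snd x)))\<^sup>2 \<le> 2 * (norm ?y)\<^sup>2 + 2 * (a\<^sup>2 * (L\<^sup>2 * (8 * (1 + ?Z))))"
      using mult_left_mono[OF h, of "a\<^sup>2"] by simp
    also have "\<dots> = 2 * (norm ?y)\<^sup>2 + 16 * L\<^sup>2 * a\<^sup>2 + 16 * L\<^sup>2 / lam * (a * (lam * a * ?Z))"
      using lam_ge(3) by (simp add: power2_eq_square algebra_simps)
    also have "\<dots> \<le> K3 * (norm ?y)\<^sup>2 + K3 * a\<^sup>2 + K3 * (1 * (lam * a * ?Z))"
      using lam_ge(3) sm(2) a Z0 unfolding K3_def
      by (intro add_mono mult_mono mult_right_mono) auto
    finally show "(norm (avg I (snd x)))\<^sup>2 \<le> K3 * (?V + a\<^sup>2)"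
      unfolding V by (simp add: algebra_simps)
  qed
  also have "\<dots> = K3 * (E (joint p0 v0 a I d K t)
      (\<lambda>x. lyapunov a I (fst x) (snd x)) + a\<^sup>2)"
    by (simp add: integrable_measure_pmf_finite[OF finite_joint])
  also have "\<dots> \<le> K3 * ((1 - c / 4 * a) ^ t * (4 * (1 + lam) * (1 + norm v0)\<^sup>2)
      + 4 / c * K2 * (a\<^sup>2 + a / real (card I)) + a\<^sup>2)"
    by (intro mult_left_mono add_right_mono lyapunov_joint_le a K3)
  finally show ?thesis .
qed

text \<open>Squared bias plus variance: the bias decays with the mixing of the chain, and
  independence of the agents reduces the variance to order 1/N.\<close>

lemma expectation_norm_avg_square_le:
  fixes F :: "'w \<Rightarrow> 'v"
  assumes "\<And>w. w \<in> G \<Longrightarrow> norm (F w) \<le> L"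
    and "norm (E (law p0 t) F) \<le> L * \<rho> ^ t" "0 \<le> \<rho>" "\<rho> \<le> 1"
  shows "E (joint p0 v0 a I d K t) (\<lambda>x. (norm (avg I (\<lambda>i. F (fst x i))))\<^sup>2)
    \<le> L\<^sup>2 * (\<rho> ^ t + 1 / real (card I))"
proof -
  let ?k = "real (card I)"
  have k: "0 < ?k" using I by (simp add: card_gt_0_iff)
  have "E (joint p0 v0 a I d K t) (\<lambda>x. (norm (avg I (\<lambda>i. F (fst x i))))\<^sup>2)
    = E (map_pmf fst (joint p0 v0 a I d K t)) (\<lambda>w. (norm (avg I (\<lambda>i. F (w i))))\<^sup>2)"
    by simp
  also have "\<dots> = E (Pi_pmf I d (\<lambda>_. law p0 t))
      (\<lambda>w. (norm (0 + (\<Sum>i\<in>I. (1 / ?k) *\<^sub>R F (w i))))\<^sup>2)"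
    unfolding map_fst_joint by (simp add: avg_def scaleR_sum_right)
  also have "\<dots> \<le> (norm (0 + (\<Sum>i\<in>I. E (law p0 t) (\<lambda>w. (1 / ?k) *\<^sub>R F w))))\<^sup>2
      + (\<Sum>i\<in>I. (L / ?k)\<^sup>2)"
  proof (rule expectation_norm_sum_square_Pi_pmf_le[OF I(1) finite_law])
    fix i w assume "w \<in> set_pmf (law p0 t)"
    then have "norm (F w) \<le> L" using assms(1) law_in_G by blast
    then show "(norm ((1 / ?k) *\<^sub>R F w))\<^sup>2 \<le> (L / ?k)\<^sup>2"
      using k by (intro power_mono) (auto simp: divide_right_mono)
  qed
  also have "(\<Sum>i\<in>I. E (law p0 t) (\<lambda>w. (1 / ?k) *\<^sub>R F w))
      = E (law p0 t) F"
    using k by (simp add: sum_constant_scaleR)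
  also have "(norm (0 + E (law p0 t) F))\<^sup>2 \<le> (L * \<rho> ^ t)\<^sup>2"
    using assms(2) by (intro power_mono) auto
  also have "\<dots> = L\<^sup>2 * (\<rho> ^ t * \<rho> ^ t)" by (simp add: power2_eq_square)
  also have "\<dots> \<le> L\<^sup>2 * (1 * \<rho> ^ t)"
    using assms by (intro mult_left_mono mult_right_mono) (auto simp: power_le_one)
  also have "(\<Sum>i\<in>I. (L / ?k)\<^sup>2) = L\<^sup>2 * (1 / ?k)"
    using k by (simp add: power2_eq_square)
  finally show ?thesis by (simp add: algebra_simps)
qed

text \<open>The remainder of \<open>synchronized_step\<close> is a^3 times averages with second
  moments of order \<rho>^t + 1/N. The part a^3 \<rho>^t is summable in t, so it stays of order a^3
  instead of being divided by the rate c a / 4; the part a^3 / N is dominated by the martingale part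
  a^2 / N.\<close>

lemma mean_square_synchronized_le:
  assumes a: "0 < a" "a * M \<le> 1" and \<rho>: "0 \<le> \<rho>" "\<rho> < 1" and a\<rho>: "c / 4 * a \<le> 1 - \<rho>"
    and f: "\<And>t. norm (E (law p0 t) (\<lambda>w. f w 0)) \<le> L * \<rho> ^ t"
    and g: "\<And>t. norm (E (law p0 t) (\<lambda>w. g w 0)) \<le> L * \<rho> ^ t"
  defines "K4 \<equiv> K1 * 3 * L\<^sup>2"
  shows "E (joint p0 v0 a I d 1 t) (\<lambda>x. (norm (avg I (snd x)))\<^sup>2)
    \<le> (32 * (1 + norm v0)\<^sup>2 + 8 * L\<^sup>2) * (1 - c / 4 * a) ^ t + 8 * (K4 / (1 - \<rho>)) * a ^ 3
      + (8 * (4 / c * K4) + 8 * L\<^sup>2) * (a / real (card I))"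
proof -
  note sm = small_step[OF a]
  let ?k = "real (card I)"
  have k: "1 \<le> ?k" using I by (simp add: Suc_le_eq card_gt_0_iff)
  let ?q = "1 - c / 4 * a"
  let ?J = "\<lambda>t. joint p0 v0 a I d 1 t"
  let ?y = "\<lambda>x. (norm (center a I (fst x) (snd x)))\<^sup>2"
  let ?E = "\<lambda>t. E (?J t) ?y"
  let ?b = "\<lambda>x. (norm (avg I (\<lambda>i. f (fst x i) 0)))\<^sup>2"
  let ?g = "\<lambda>x. (norm (avg I (\<lambda>i. g (fst x i) 0)))\<^sup>2"
  have q: "0 \<le> ?q" "?q \<le> 1" using sm(4) a c by (auto simp: mult.commute)
  have K4: "0 \<le> K4" unfolding K4_def using K1_ge(2) by simp
  have b: "E (?J t) ?b \<le> L\<^sup>2 * (\<rho> ^ t + 1 / ?k)" for t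
    using \<rho> by (intro expectation_norm_avg_square_le f_0 f) auto
  have gb: "E (?J t) ?g \<le> L\<^sup>2 * (\<rho> ^ t + 1 / ?k)" for t
    using \<rho> by (intro expectation_norm_avg_square_le g_0 g) auto
  have step: "?E (Suc t) \<le> ?q * ?E t + K4 * (a ^ 3 * \<rho> ^ t + a\<^sup>2 / ?k)" for t
  proof -
    have "?E (Suc t) \<le> E (?J t)
        (\<lambda>x. ?q * ?y x + K1 * (a ^ 3 * (?b x + ?g x) + a\<^sup>2 / ?k))"
      unfolding expectation_joint_Suc fst_conv snd_conv
    proof (rule expectation_mono_finite[OF finite_joint])
      fix x assume x: "x \<in> set_pmf (?J t)"
      obtain v where v: "snd x = (\<lambda>_. v)" using joint_synchronized[OF x] by auto
      show "E (nexts I d (fst x))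
          (\<lambda>w'. (norm (avg I (\<lambda>i. corrected a (w' i) (fed_step a I (1 dvd Suc t) (fst x) (snd x) i))))\<^sup>2)
        \<le> ?q * ?y x + K1 * (a ^ 3 * (?b x + ?g x) + a\<^sup>2 / ?k)"
        using synchronized_step[OF I joint_in_G[OF x] a, where d = d and v = v] unfolding v by simp
    qed
    also have "\<dots> = ?q * ?E t + K1 * (a ^ 3 * (E (?J t) ?b
        + E (?J t) ?g) + a\<^sup>2 / ?k)"
      by (simp add: integrable_measure_pmf_finite[OF finite_joint])
    also have "\<dots> \<le> ?q * ?E t + K1 * (a ^ 3 * (L\<^sup>2 * (\<rho> ^ t + 1 / ?k) + L\<^sup>2 * (\<rho> ^ t + 1 / ?k))
        + L\<^sup>2 * (a\<^sup>2 / ?k))"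
      using a q K1_ge(2) b gb mult_right_mono[OF L_pow(1)[of 2], of "a\<^sup>2 / ?k"]
      by (intro add_mono mult_left_mono) auto
    also have "\<dots> = ?q * ?E t + K1 * L\<^sup>2 * (2 * (a ^ 3 * \<rho> ^ t) + 2 * (a ^ 3 / ?k) + a\<^sup>2 / ?k)"
      by (simp add: algebra_simps)
    also have "\<dots> \<le> ?q * ?E t + K1 * L\<^sup>2 * (3 * (a ^ 3 * \<rho> ^ t) + 2 * (a\<^sup>2 / ?k) + a\<^sup>2 / ?k)"
    proof (intro add_mono mult_left_mono order_refl)
      show "a ^ 3 / ?k \<le> a\<^sup>2 / ?k"
        using a sm(2) by (intro divide_right_mono power_decreasing) auto
      show "2 * (a ^ 3 * \<rho> ^ t) \<le> 3 * (a ^ 3 * \<rho> ^ t)" using a \<rho> by simp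
    qed (use K1_ge(2) q in auto)
    finally show ?thesis by (simp add: K4_def algebra_simps)
  qed
  have E: "?E t \<le> ?q ^ t * (4 * (1 + norm v0)\<^sup>2) + K4 * a ^ 3 * (\<Sum>s<t. \<rho> ^ s) + 4 / c * K4 * (a / ?k)" for t
  proof (induction t)
    case 0
    have "?E 0 \<le> E (?J 0) (\<lambda>x. 4 * (1 + norm v0)\<^sup>2)"
    proof (rule expectation_mono_finite[OF finite_joint])
      fix x assume x: "x \<in> set_pmf (?J 0)"
      then have s: "snd x = (\<lambda>_. v0)" by auto
      have "?y x \<le> energy a I (fst x) (\<lambda>_. v0)"
        unfolding s by (rule norm_avg_square_le[OF I])
      also have "\<dots> \<le> avg I (\<lambda>i. 4 * (1 + norm v0)\<^sup>2)"
        using x by (intro avg_mono norm_corrected_initial_le a joint_in_G)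
      finally show "?y x \<le> 4 * (1 + norm v0)\<^sup>2" by (simp only: avg_const[OF I])
    qed
    moreover have "0 \<le> 4 / c * K4 * (a / ?k)" using c K4 a by auto
    ultimately show ?case by simp
  next
    case (Suc t)
    have "?E (Suc t) \<le> ?q * (?q ^ t * (4 * (1 + norm v0)\<^sup>2) + K4 * a ^ 3 * (\<Sum>s<t. \<rho> ^ s)
        + 4 / c * K4 * (a / ?k)) + K4 * (a ^ 3 * \<rho> ^ t + a\<^sup>2 / ?k)"
      using step[of t] mult_left_mono[OF Suc q(1)] by linarith
    also have "\<dots> = ?q ^ Suc t * (4 * (1 + norm v0)\<^sup>2) + ?q * (K4 * a ^ 3 * (\<Sum>s<t. \<rho> ^ s))
        + K4 * a ^ 3 * \<rho> ^ t + 4 / c * K4 * (a / ?k)"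
    proof -
      have *: "K4 * (a ^ 3 * \<rho> ^ t + a\<^sup>2 / ?k) = K4 * a ^ 3 * \<rho> ^ t + c / 4 * a * (4 / c * K4 * (a / ?k))"
        using c by (simp add: distrib_left power2_eq_square)
      have "(1 - s) * (p * x + y + z) + (r + s * z) = (1 - s) * p * x + (1 - s) * y + r + z"
        for s p x y z r :: real by (simp add: algebra_simps)
      then show ?thesis unfolding * power_Suc .
    qed
    also have "?q * (K4 * a ^ 3 * (\<Sum>s<t. \<rho> ^ s)) \<le> 1 * (K4 * a ^ 3 * (\<Sum>s<t. \<rho> ^ s))"
      using q K4 a \<rho> by (intro mult_right_mono) (auto intro!: mult_nonneg_nonneg sum_nonneg)
    finally show ?case by (simp add: distrib_left)
  qed
  have geo: "(\<Sum>s<t. \<rho> ^ s) \<le> 1 / (1 - \<rho>)"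
    using \<rho> by (simp add: sum_gp_strict divide_right_mono)
  have "E (?J t) (\<lambda>x. (norm (avg I (snd x)))\<^sup>2)
    \<le> E (?J t) (\<lambda>x. 8 * ?y x + 8 * a\<^sup>2 * ?g x)"
  proof (rule expectation_mono_finite[OF finite_joint])
    fix x assume x: "x \<in> set_pmf (?J t)"
    obtain v where v: "snd x = (\<lambda>_. v)" using joint_synchronized[OF x] by auto
    let ?n = "norm (center a I (fst x) (\<lambda>_. v))" and ?m = "norm (avg I (\<lambda>i. g (fst x i) 0))"
    have "norm v \<le> 2 * ?n + 2 * a * ?m"
      by (rule norm_le_avg_corrected[OF I joint_in_G[OF x] a])
    then have "(norm v)\<^sup>2 \<le> (2 * ?n + 2 * a * ?m)\<^sup>2" by (intro power_mono) auto
    also have "\<dots> \<le> 2 * (2 * ?n)\<^sup>2 + 2 * (2 * a * ?m)\<^sup>2" by (rule add_square_le)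
    also have "\<dots> = 8 * ?n\<^sup>2 + 8 * a\<^sup>2 * ?m\<^sup>2" by (simp only: power_mult_distrib) simp
    finally show "(norm (avg I (snd x)))\<^sup>2 \<le> 8 * ?y x + 8 * a\<^sup>2 * ?g x"
      unfolding v using I by (simp add: avg_const)
  qed
  also have "\<dots> = 8 * ?E t + 8 * a\<^sup>2 * E (?J t) ?g"
    by (simp add: integrable_measure_pmf_finite[OF finite_joint])
  also have "\<dots> \<le> 8 * (?q ^ t * (4 * (1 + norm v0)\<^sup>2) + K4 * a ^ 3 * (1 / (1 - \<rho>)) + 4 / c * K4 * (a / ?k))
      + 8 * L\<^sup>2 * (?q ^ t + a / ?k)"
  proof (intro add_mono mult_left_mono)
    have "K4 * a ^ 3 * (\<Sum>s<t. \<rho> ^ s) \<le> K4 * a ^ 3 * (1 / (1 - \<rho>))"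
      using K4 a by (intro mult_left_mono geo) auto
    then show "?E t \<le> ?q ^ t * (4 * (1 + norm v0)\<^sup>2) + K4 * a ^ 3 * (1 / (1 - \<rho>)) + 4 / c * K4 * (a / ?k)"
      using E[of t] by linarith
    have a2: "a\<^sup>2 \<le> 1" "a\<^sup>2 \<le> a"
      using a sm(2) power_decreasing[of 0 2 a] power_decreasing[of 1 2 a] by auto
    \<comment> \<open>Since \<rho> is at most 1 - c a / 4, the transient of the noise dies out at
      least as fast as that of the parameters and is merged with it.\<close>
    have "a\<^sup>2 * \<rho> ^ t \<le> 1 * ?q ^ t"
      using a2 \<rho> a\<rho> by (intro mult_mono power_mono) auto
    moreover have "a\<^sup>2 / ?k \<le> a / ?k" using a2 by (intro divide_right_mono) auto
    ultimately have "L\<^sup>2 * (a\<^sup>2 * \<rho> ^ t + a\<^sup>2 / ?k) \<le> L\<^sup>2 * (?q ^ t + a / ?k)"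
      by (intro mult_left_mono) auto
    moreover have "a\<^sup>2 * E (?J t) ?g \<le> a\<^sup>2 * (L\<^sup>2 * (\<rho> ^ t + 1 / ?k))"
      by (intro mult_left_mono gb) auto
    moreover have "a\<^sup>2 * (L\<^sup>2 * (\<rho> ^ t + 1 / ?k)) = L\<^sup>2 * (a\<^sup>2 * \<rho> ^ t + a\<^sup>2 / ?k)"
      by (simp add: algebra_simps)
    ultimately show "8 * a\<^sup>2 * E (?J t) ?g \<le> 8 * L\<^sup>2 * (?q ^ t + a / ?k)"
      unfolding mult.assoc by linarith
  qed auto
  finally show ?thesis by (simp add: algebra_simps)
qed

end

end

subsection \<open>Weighted inner products and projections\<close>

definition weighted_inner :: "'s::finite pmf \<Rightarrow> real ^ 's \<Rightarrow> real ^ 's \<Rightarrow> real" where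
  "weighted_inner \<mu> U V = (\<Sum>s\<in>UNIV. pmf \<mu> s * (U $ s * V $ s))"

lemma weighted_norm_square: "(weighted_norm \<mu> V)\<^sup>2 = weighted_inner \<mu> V V"
  by (simp add: weighted_norm_def weighted_inner_def sum_nonneg power2_eq_square)

lemma weighted_norm_nonneg: "0 \<le> weighted_norm \<mu> V"
  by (simp add: weighted_norm_def sum_nonneg)

lemma weighted_inner_diff_left: "weighted_inner \<mu> (U - U') V = weighted_inner \<mu> U V - weighted_inner \<mu> U' V"
  by (simp add: weighted_inner_def algebra_simps sum_subtractf)

lemma weighted_inner_diff_right: "weighted_inner \<mu> U (V - V') = weighted_inner \<mu> U V - weighted_inner \<mu> U V'"
  by (simp add: weighted_inner_def algebra_simps sum_subtractf)

lemma weighted_inner_commute: "weighted_inner \<mu> U V = weighted_inner \<mu> V U"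
  by (simp add: weighted_inner_def mult.commute)

lemma weighted_inner_le_norms: "weighted_inner \<mu> U V \<le> weighted_norm \<mu> U * weighted_norm \<mu> V"
proof -
  let ?u = "\<lambda>s. sqrt (pmf \<mu> s) * U $ s" and ?v = "\<lambda>s. sqrt (pmf \<mu> s) * V $ s"
  have "weighted_inner \<mu> U V = (\<Sum>s\<in>UNIV. ?u s * ?v s)"
  proof -
    have "pmf \<mu> s * (U $ s * V $ s) = (sqrt (pmf \<mu> s) * sqrt (pmf \<mu> s)) * (U $ s * V $ s)" for s
      by simp
    also have "\<dots> s = ?u s * ?v s" for s by (simp only: mult_ac)
    finally show ?thesis by (simp only: weighted_inner_def)
  qed
  also have "\<dots> \<le> (\<Sum>s\<in>UNIV. \<bar>?u s\<bar> * \<bar>?v s\<bar>)"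
    by (intro sum_mono) (simp add: abs_mult[symmetric])
  also have "\<dots> \<le> L2_set ?u UNIV * L2_set ?v UNIV" by (rule L2_set_mult_ineq)
  also have "\<dots> = weighted_norm \<mu> U * weighted_norm \<mu> V"
    by (simp add: L2_set_def weighted_norm_def power_mult_distrib)
  finally show ?thesis .
qed

lemma weighted_norm_eq_0:
  assumes "\<And>s. 0 < pmf \<mu> s" "weighted_norm \<mu> V = 0"
  shows "V = 0"
proof -
  have "(\<Sum>s\<in>UNIV. pmf \<mu> s * (V $ s)\<^sup>2) = 0"
    using assms(2) by (simp add: weighted_norm_def)
  then have "pmf \<mu> s * (V $ s)\<^sup>2 = 0" for s
    by (subst (asm) sum_nonneg_eq_0_iff) auto
  then show ?thesis using assms(1) by (auto simp: vec_eq_iff less_irrefl) (metis less_irrefl)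
qed

text \<open>\<open>arg_min\<close> selects a minimizer by choice, so minimality alone does not
  identify it. Orthogonality gives Pythagoras, hence any minimizer lies at weighted distance 0, and
  positive weights turn this into equality.\<close>

lemma weighted_proj_eqI:
  fixes \<Phi> :: "real ^ 'd ^ 's::finite"
  assumes \<mu>: "\<And>s. 0 < pmf \<mu> s"
    and orth: "\<And>w. weighted_inner \<mu> (V - \<Phi> *v v) (\<Phi> *v w) = 0"
  shows "weighted_proj \<mu> \<Phi> V = \<Phi> *v v"
proof -
  let ?f = "\<lambda>U. weighted_norm \<mu> (V - U)" and ?P = "\<lambda>U. U \<in> span (columns \<Phi>)"
  have span: "span (columns \<Phi>) = range ((*v) \<Phi>)"
  proof (intro equalityI span_minimal)
    show "columns \<Phi> \<subseteq> range ((*v) \<Phi>)" by (auto simp: columns_image_basis)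
    show "subspace (range ((*v) \<Phi>))"
      by (intro linear_subspace_image matrix_vector_mul_linear subspace_UNIV)
  qed (auto simp: matrix_vector_mult_in_columnspace)
  have pyth: "(?f (\<Phi> *v w))\<^sup>2 = (?f (\<Phi> *v v))\<^sup>2 + (weighted_norm \<mu> (\<Phi> *v v - \<Phi> *v w))\<^sup>2" for w
  proof -
    let ?e = "V - \<Phi> *v v" and ?d = "\<Phi> *v v - \<Phi> *v w"
    have "V - \<Phi> *v w = ?e - (\<Phi> *v (w - v))" by (simp add: matrix_vector_mult_diff_distrib)
    then have "(?f (\<Phi> *v w))\<^sup>2 = weighted_inner \<mu> ?e ?e - 2 * weighted_inner \<mu> ?e (\<Phi> *v (w - v))
        + weighted_inner \<mu> (\<Phi> *v (w - v)) (\<Phi> *v (w - v))"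
      unfolding weighted_norm_square
      by (simp only: weighted_inner_diff_left weighted_inner_diff_right)
         (simp add: weighted_inner_commute)
    moreover have "weighted_inner \<mu> (\<Phi> *v (w - v)) (\<Phi> *v (w - v)) = (weighted_norm \<mu> ?d)\<^sup>2"
      by (simp add: weighted_norm_square weighted_inner_def matrix_vector_mult_diff_distrib algebra_simps)
    ultimately show ?thesis by (simp add: orth weighted_norm_square)
  qed
  have le: "?f (\<Phi> *v v) \<le> ?f U" if "?P U" for U
  proof -
    obtain w where U: "U = \<Phi> *v w" using \<open>?P U\<close> unfolding span by auto
    have "(?f (\<Phi> *v v))\<^sup>2 \<le> (?f U)\<^sup>2" using pyth[of w] by (simp add: U)
    then show ?thesis by (rule power2_le_imp_le) (rule weighted_norm_nonneg)
  qed
  have min: "?f (arg_min ?f ?P) = ?f (\<Phi> *v v)"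
    by (rule arg_min_equality) (simp_all add: span le)
  have "?P (arg_min ?f ?P)"
    by (rule arg_minI[of ?P "\<Phi> *v v" ?f]) (auto simp: span not_less le)
  then obtain w where w: "arg_min ?f ?P = \<Phi> *v w" unfolding span by auto
  have "(weighted_norm \<mu> (\<Phi> *v v - \<Phi> *v w))\<^sup>2 = 0"
    using pyth[of w] min unfolding w by simp
  then have "\<Phi> *v v - \<Phi> *v w = 0" by (intro weighted_norm_eq_0[OF \<mu>]) simp
  then show ?thesis by (simp add: weighted_proj_def w)
qed

lemma coercive_linear_surj:
  fixes h :: "'v::euclidean_space \<Rightarrow> 'v"
  assumes "linear h" "0 < c" "\<And>v. c * (norm v)\<^sup>2 \<le> v \<bullet> h v"
  shows "surj h"
proof -
  have "inj h"
  proof (subst linear_injective_0[OF assms(1)], intro allI impI)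
    fix v assume "h v = 0"
    then have "c * (norm v)\<^sup>2 \<le> 0" using assms(3)[of v] by simp
    then show "v = 0" using assms(2) by (simp add: mult_le_0_iff)
  qed
  then show ?thesis using linear_injective_imp_surjective assms(1) by blast
qed

lemma weighted_norm_lower_bound:
  fixes \<Phi> :: "real ^ 'd ^ 's::finite"
  assumes "rank \<Phi> = CARD('d)" "\<And>s. 0 < pmf \<mu> s"
  obtains c where "0 < c" "\<And>v. c * (norm v)\<^sup>2 \<le> (weighted_norm \<mu> (\<Phi> *v v))\<^sup>2"
proof -
  have "inj ((*v) \<Phi>)" using assms(1) by (simp add: full_rank_injective)
  then obtain b where b: "0 < b" "\<And>v. b * norm v \<le> norm (\<Phi> *v v)"
    using linear_inj_bounded_below_pos[of "(*v) \<Phi>"] by (auto simp: matrix_vector_mul_linear)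
  define p where "p = Min (range (pmf \<mu>))"
  have p: "0 < p" "\<And>s. p \<le> pmf \<mu> s"
    using assms(2) by (auto simp: p_def)
  have "p * b\<^sup>2 * (norm v)\<^sup>2 \<le> (weighted_norm \<mu> (\<Phi> *v v))\<^sup>2" for v
  proof -
    have "(b * norm v)\<^sup>2 \<le> (norm (\<Phi> *v v))\<^sup>2" using b by (intro power_mono) auto
    then have "p * (b * norm v)\<^sup>2 \<le> p * (norm (\<Phi> *v v))\<^sup>2" using p by simp
    also have "\<dots> = (\<Sum>s\<in>UNIV. p * ((\<Phi> *v v) $ s)\<^sup>2)"
      by (simp add: norm_vec_def L2_set_def sum_nonneg sum_distrib_left)
    also have "\<dots> \<le> (\<Sum>s\<in>UNIV. pmf \<mu> s * ((\<Phi> *v v) $ s)\<^sup>2)"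
      using p by (intro sum_mono mult_right_mono) auto
    also have "\<dots> = (weighted_norm \<mu> (\<Phi> *v v))\<^sup>2" by (simp add: weighted_norm_def sum_nonneg)
    finally show ?thesis by (simp add: power_mult_distrib mult_ac)
  qed
  then show ?thesis using that[of "p * b\<^sup>2"] p b by simp
qed

subsection \<open>The projected Bellman equation\<close>

lemma expectation_sum_UNIV: "E p h = (\<Sum>x\<in>UNIV. pmf p x * h x)" for h :: "'x::finite \<Rightarrow> real"
  by (simp add: expectation_finite_type)

definition bellman_linear ::
  "('s::finite \<Rightarrow> 'a::finite \<Rightarrow> 's pmf) \<Rightarrow> real \<Rightarrow> ('s \<Rightarrow> 'a pmf) \<Rightarrow> real ^ 's \<Rightarrow> real ^ 's" where
  "bellman_linear P \<gamma> \<pi> V = (\<chi> s. \<gamma> * E (state_kernel P \<pi> s) (\<lambda>s'. V $ s'))"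

lemma expectation_state_kernel:
  fixes h :: "'s::finite \<Rightarrow> real" and \<pi> :: "'s \<Rightarrow> 'a::finite pmf"
  shows "E (state_kernel P \<pi> s) h
    = (\<Sum>a\<in>UNIV. pmf (\<pi> s) a * (\<Sum>s'\<in>UNIV. pmf (P s a) s' * h s'))"
  unfolding state_kernel_def by (subst expectation_bind_finite) (auto simp: expectation_sum_UNIV)

lemma bellman_affine: "bellman P R \<gamma> \<pi> V = bellman P R \<gamma> \<pi> 0 + bellman_linear P \<gamma> \<pi> V"
  by (simp add: vec_eq_iff bellman_def bellman_linear_def expectation_state_kernel distrib_left
      sum.distrib sum_distrib_left mult_ac)

lemma linear_bellman_linear: "linear (bellman_linear P \<gamma> \<pi>)"
  by (rule linearI) (auto simp: vec_eq_iff bellman_linear_def expectation_state_kernel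
      distrib_left sum.distrib sum_distrib_left mult_ac)

lemma linear_bellman_linear_pow: "linear (bellman_linear P \<gamma> \<pi> ^^ n)"
proof (induction n)
  case (Suc n)
  then show ?case using linear_compose[OF Suc linear_bellman_linear] by (simp add: o_def)
qed (simp add: linear_id[unfolded id_def])

lemma bellman_pow_affine:
  "(bellman P R \<gamma> \<pi> ^^ n) V = (bellman P R \<gamma> \<pi> ^^ n) 0 + (bellman_linear P \<gamma> \<pi> ^^ n) V"
proof (induction n)
  case (Suc n)
  let ?T = "bellman P R \<gamma> \<pi>" and ?A = "bellman_linear P \<gamma> \<pi>"
  have "(?T ^^ Suc n) V = ?T 0 + ?A ((?T ^^ n) 0 + (?A ^^ n) V)"
    by (simp add: bellman_affine[of _ _ _ _ "(?T ^^ n) V"] flip: Suc)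
  also have "\<dots> = ?T ((?T ^^ n) 0) + (?A ^^ Suc n) V"
    by (simp add: bellman_affine[of _ _ _ _ "(?T ^^ n) 0"] linear_add[OF linear_bellman_linear])
  finally show ?case by simp
qed simp

text \<open>Jensen's inequality inside the transition kernel, then stationarity: averaging the
  squares over \<mu> and one transition is averaging them over \<mu>.\<close>

lemma weighted_norm_bellman_linear_le:
  assumes "stationary (state_kernel P \<pi>) \<mu>" "0 \<le> \<gamma>"
  shows "weighted_norm \<mu> (bellman_linear P \<gamma> \<pi> V) \<le> \<gamma> * weighted_norm \<mu> V"
proof -
  let ?K = "state_kernel P \<pi>"
  let ?E = "\<lambda>s h. E (?K s) h"
  have jensen: "(?E s (\<lambda>s'. V $ s'))\<^sup>2 \<le> ?E s (\<lambda>s'. (V $ s')\<^sup>2)" for s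
  proof -
    let ?m = "?E s (\<lambda>s'. V $ s')"
    have "0 \<le> ?E s (\<lambda>s'. (V $ s' - ?m)\<^sup>2)" by simp
    also have "\<dots> = ?E s (\<lambda>s'. (V $ s')\<^sup>2 - 2 * ?m * V $ s' + ?m\<^sup>2)"
      by (intro expectation_cong) (simp add: power2_diff)
    also have "\<dots> = ?E s (\<lambda>s'. (V $ s')\<^sup>2) - ?m\<^sup>2"
      by (simp add: integrable_measure_pmf_finite power2_eq_square)
    finally show ?thesis by simp
  qed
  have "(weighted_norm \<mu> (bellman_linear P \<gamma> \<pi> V))\<^sup>2
      = \<gamma>\<^sup>2 * E \<mu> (\<lambda>s. (?E s (\<lambda>s'. V $ s'))\<^sup>2)"
    by (simp add: weighted_norm_def bellman_linear_def sum_nonneg power_mult_distrib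
        expectation_sum_UNIV[of \<mu>] sum_distrib_left mult_ac)
  also have "\<dots> \<le> \<gamma>\<^sup>2 * E \<mu> (\<lambda>s. ?E s (\<lambda>s'. (V $ s')\<^sup>2))"
    by (intro mult_left_mono expectation_mono_finite jensen) auto
  also have "E \<mu> (\<lambda>s. ?E s (\<lambda>s'. (V $ s')\<^sup>2))
      = E (bind_pmf \<mu> ?K) (\<lambda>s'. (V $ s')\<^sup>2)"
    by (rule expectation_bind_finite[symmetric]) auto
  also have "\<dots> = (weighted_norm \<mu> V)\<^sup>2"
    using assms(1) by (simp add: stationary_def weighted_norm_def sum_nonneg expectation_sum_UNIV)
  finally have "(weighted_norm \<mu> (bellman_linear P \<gamma> \<pi> V))\<^sup>2 \<le> (\<gamma> * weighted_norm \<mu> V)\<^sup>2"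
    by (simp add: power_mult_distrib)
  then show ?thesis
    by (rule power2_le_imp_le) (simp add: assms(2) weighted_norm_nonneg)
qed

lemma weighted_norm_bellman_linear_pow_le:
  assumes "stationary (state_kernel P \<pi>) \<mu>" "0 \<le> \<gamma>"
  shows "weighted_norm \<mu> ((bellman_linear P \<gamma> \<pi> ^^ n) V) \<le> \<gamma> ^ n * weighted_norm \<mu> V"
proof (induction n)
  case (Suc n)
  show ?case
    using order_trans[OF weighted_norm_bellman_linear_le[OF assms] mult_left_mono[OF Suc assms(2)]]
    by (simp add: mult_ac)
qed simp

text \<open>The stationary mean of the update; in matrix form, the transpose of \<Phi> times
  diag(\<mu>) times the residual of the n-step Bellman equation.\<close>

definition td_drift ::
  "('s::finite \<Rightarrow> 'a::finite \<Rightarrow> 's pmf) \<Rightarrow> ('s \<Rightarrow> 'a \<Rightarrow> real) \<Rightarrow> real \<Rightarrow> ('s \<Rightarrow> 'a pmf)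
    \<Rightarrow> 's pmf \<Rightarrow> real ^ 'd ^ 's \<Rightarrow> nat \<Rightarrow> real ^ 'd \<Rightarrow> real ^ 'd" where
  "td_drift P R \<gamma> \<pi> \<mu> \<Phi> n v =
    (\<Sum>s\<in>UNIV. (pmf \<mu> s * ((bellman P R \<gamma> \<pi> ^^ n) (\<Phi> *v v) - \<Phi> *v v) $ s) *\<^sub>R \<Phi> $ s)"

lemma linear_features:
  fixes U :: "real ^ 'd \<Rightarrow> real ^ 's::finite" and \<Phi> :: "real ^ 'd ^ 's"
  assumes "linear U"
  shows "linear (\<lambda>v. \<Sum>s\<in>UNIV. (p s * U v $ s) *\<^sub>R \<Phi> $ s)"
  by (rule linearI)
     (simp_all add: linear_add[OF assms] linear_cmul[OF assms] distrib_left scaleR_add_left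
       sum.distrib scaleR_sum_right mult.left_commute)

lemma inner_features: "(\<Sum>s\<in>UNIV. (pmf \<mu> s * U $ s) *\<^sub>R \<Phi> $ s) \<bullet> w = weighted_inner \<mu> U (\<Phi> *v w)"
  for \<Phi> :: "real ^ 'd ^ 's::finite"
  by (simp add: inner_sum_left weighted_inner_def matrix_vector_mul_component mult_ac)

lemma inner_td_drift:
  "td_drift P R \<gamma> \<pi> \<mu> \<Phi> n v \<bullet> w
    = weighted_inner \<mu> ((bellman P R \<gamma> \<pi> ^^ n) (\<Phi> *v v) - \<Phi> *v v) (\<Phi> *v w)"
  unfolding td_drift_def by (rule inner_features)

text \<open>Contraction of the Bellman operator and Cauchy-Schwarz make the linear part dissipative,
  which gives uniqueness and, in finite dimension, existence of a root of the drift. The roots are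
  the solutions of the projected equation because a zero drift says that the Bellman residual is
  orthogonal to all features.\<close>

lemma td_drift_properties:
  fixes \<Phi> :: "real ^ 'd ^ 's::finite" and \<pi> :: "'s \<Rightarrow> 'a::finite pmf"
  assumes \<gamma>: "0 < \<gamma>" "\<gamma> < 1" and n: "1 \<le> n"
    and st: "stationary (state_kernel P \<pi>) \<mu>" and \<mu>: "\<And>s. 0 < pmf \<mu> s"
    and rank: "rank \<Phi> = CARD('d)"
  obtains c B where "0 < c" "linear B" "\<And>v. v \<bullet> B v \<le> - c * (norm v)\<^sup>2"
    "\<And>v. td_drift P R \<gamma> \<pi> \<mu> \<Phi> n (v + td_solution P R \<gamma> \<pi> \<mu> \<Phi> n) = B v"
proof -
  let ?T = "bellman P R \<gamma> \<pi>" and ?A = "bellman_linear P \<gamma> \<pi>"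
  let ?H = "td_drift P R \<gamma> \<pi> \<mu> \<Phi> n"
  obtain c0 where c0: "0 < c0" "\<And>v. c0 * (norm v)\<^sup>2 \<le> (weighted_norm \<mu> (\<Phi> *v v))\<^sup>2"
    using weighted_norm_lower_bound[OF rank \<mu>] by blast
  define c where "c = (1 - \<gamma>) * c0"
  have c: "0 < c" using c0 \<gamma> by (simp add: c_def)
  define B where "B = (\<lambda>v. \<Sum>s\<in>UNIV. (pmf \<mu> s * ((?A ^^ n) (\<Phi> *v v) - \<Phi> *v v) $ s) *\<^sub>R \<Phi> $ s)"
  have lin: "linear (\<lambda>v. (?A ^^ n) (\<Phi> *v v))"
    using linear_compose[OF matrix_vector_mul_linear linear_bellman_linear_pow] by (simp add: o_def)
  have linB: "linear B"
    unfolding B_def by (intro linear_features linear_compose_sub lin matrix_vector_mul_linear)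
  have H: "?H v = ?H 0 + B v" for v
    unfolding td_drift_def B_def sum.distrib[symmetric] bellman_pow_affine[where V = "\<Phi> *v v"]
    by (intro sum.cong refl) (simp add: algebra_simps)
  have diss: "v \<bullet> B v \<le> - c * (norm v)\<^sup>2" for v
  proof -
    let ?V = "\<Phi> *v v"
    have "v \<bullet> B v = weighted_inner \<mu> ((?A ^^ n) ?V) ?V - (weighted_norm \<mu> ?V)\<^sup>2"
      unfolding B_def inner_commute[of v] inner_features
      by (simp add: weighted_inner_diff_left weighted_norm_square)
    also have "weighted_inner \<mu> ((?A ^^ n) ?V) ?V \<le> weighted_norm \<mu> ((?A ^^ n) ?V) * weighted_norm \<mu> ?V"
      by (rule weighted_inner_le_norms)
    also have "\<dots> \<le> (\<gamma> ^ n * weighted_norm \<mu> ?V) * weighted_norm \<mu> ?V"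
      using weighted_norm_bellman_linear_pow_le[OF st, of \<gamma> n ?V] \<gamma>
      by (intro mult_right_mono weighted_norm_nonneg) auto
    \<comment> \<open>n >= 1 enters here; one factor \<gamma> is enough and keeps c independent of
      n.\<close>
    also have "\<dots> \<le> (\<gamma> ^ 1 * weighted_norm \<mu> ?V) * weighted_norm \<mu> ?V"
      using \<gamma> n by (intro mult_right_mono weighted_norm_nonneg power_decreasing) auto
    finally have "v \<bullet> B v \<le> - ((1 - \<gamma>) * (weighted_norm \<mu> ?V)\<^sup>2)"
      by (simp add: algebra_simps power2_eq_square)
    moreover have "(1 - \<gamma>) * (c0 * (norm v)\<^sup>2) \<le> (1 - \<gamma>) * (weighted_norm \<mu> ?V)\<^sup>2"
      using \<gamma> c0 by (intro mult_left_mono) auto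
    ultimately show ?thesis by (simp add: c_def mult_ac)
  qed
  have "surj (\<lambda>v. - B v)"
  proof (rule coercive_linear_surj[OF linear_compose_neg[OF linB] c])
    show "c * (norm v)\<^sup>2 \<le> v \<bullet> - B v" for v using diss[of v] by simp
  qed
  then obtain v0 where "?H 0 = - B v0" by (metis surjD)
  then have v0: "?H v0 = 0" using H[of v0] by simp
  have unique: "v = v0" if "?H v = 0" for v
  proof -
    have "B (v - v0) = 0" using H[of v] H[of v0] v0 that by (metis add_left_cancel eq_iff_diff_eq_0 linear_diff[OF linB])
    then show ?thesis using diss[of "v - v0"] c by (simp add: mult_le_0_iff)
  qed
  have orth_iff: "weighted_inner \<mu> ((?T ^^ n) (\<Phi> *v v) - \<Phi> *v v) (\<Phi> *v w) = 0" if "?H v = 0" for v w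
    using that unfolding inner_td_drift[symmetric] by simp
  have "td_solution P R \<gamma> \<pi> \<mu> \<Phi> n = v0"
    unfolding td_solution_def
  proof (rule the_equality)
    show "\<Phi> *v v0 = weighted_proj \<mu> \<Phi> ((?T ^^ n) (\<Phi> *v v0))"
      by (rule weighted_proj_eqI[OF \<mu> orth_iff[OF v0], symmetric])
  next
    fix v assume v: "\<Phi> *v v = weighted_proj \<mu> \<Phi> ((?T ^^ n) (\<Phi> *v v))"
    let ?W = "(?T ^^ n) (\<Phi> *v v)"
    \<comment> \<open>The Gram map of the features: its surjectivity supplies the coefficients u of
      the projection of W, which \<open>arg_min\<close> does not exhibit.\<close>
    let ?G = "\<lambda>u. \<Sum>s\<in>UNIV. (pmf \<mu> s * (\<Phi> *v u) $ s) *\<^sub>R \<Phi> $ s"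
    have "linear ?G" by (intro linear_features matrix_vector_mul_linear)
    moreover have "c0 * (norm u)\<^sup>2 \<le> u \<bullet> ?G u" for u
      unfolding inner_commute[of u] inner_features weighted_norm_square[symmetric] by (rule c0)
    ultimately have "surj ?G" using coercive_linear_surj c0(1) by blast
    then have "\<exists>u. (\<Sum>s\<in>UNIV. (pmf \<mu> s * ?W $ s) *\<^sub>R \<Phi> $ s) = ?G u"
      unfolding surj_def by (rule spec)
    then obtain u where u: "(\<Sum>s\<in>UNIV. (pmf \<mu> s * ?W $ s) *\<^sub>R \<Phi> $ s) = ?G u" ..
    have orth: "weighted_inner \<mu> (?W - \<Phi> *v u) (\<Phi> *v w) = 0" for w
      unfolding weighted_inner_diff_left
      unfolding inner_features[symmetric] u by (rule diff_self)
    have "\<Phi> *v v = \<Phi> *v u" using v weighted_proj_eqI[OF \<mu> orth] by simp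
    then have "?H v \<bullet> w = 0" for w using orth unfolding inner_td_drift by simp
    then have "?H v = 0" using inner_eq_zero_iff by blast
    then show "v = v0" by (rule unique)
  qed
  moreover have "?H (v + v0) = B v" for v
    using H[of "v + v0"] H[of v0] v0 by (simp add: linear_add[OF linB])
  ultimately show ?thesis using that[OF c linB diss] by simp
qed

subsection \<open>Averaging over the output time and sample complexity\<close>

lemma finite_output_time:
  assumes "0 < c" "1 \<le> T"
  shows "finite (set_pmf (output_time_pmf c T))" "set_pmf (output_time_pmf c T) \<subseteq> {..<T}"
proof -
  show "set_pmf (output_time_pmf c T) \<subseteq> {..<T}"
    by (auto simp: set_pmf_iff pmf_output_time[OF assms] split: if_splits)
  then show "finite (set_pmf (output_time_pmf c T))" by (rule finite_subset) simp
qed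

text \<open>The weight c^(-t) against q^t <= c^(2 t) leaves a geometric series with sum at most 1 /
  (1 - c), and the normalization is at least its last term c^(-(T - 1)). The condition c >= 1/2
  trades c^(T - 1) for 2 c^T.\<close>

lemma expectation_output_time_le:
  assumes c: "0 < c" "c < 1" "1 / 2 \<le> c" and q: "0 \<le> q" "q \<le> c\<^sup>2" and T: "1 \<le> T" and A: "0 \<le> A"
    and h: "\<And>t. t < T \<Longrightarrow> h t \<le> A * q ^ t + b"
  shows "E (output_time_pmf c T) h \<le> 2 * A / (1 - c) * c ^ T + b"
proof -
  let ?Z = "\<Sum>t<T. inverse c ^ t"
  note fin = finite_output_time[OF c(1) T]
  have Z: "inverse c ^ (T - 1) \<le> ?Z"
    by (rule member_le_sum) (use T c in auto)
  have Z0: "0 < ?Z"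
    by (rule less_le_trans[OF _ Z]) (use c in simp)
  have "E (output_time_pmf c T) (\<lambda>t. q ^ t) = (\<Sum>t<T. pmf (output_time_pmf c T) t * q ^ t)"
    using fin by (subst integral_measure_pmf[of "{..<T}"]) auto
  also have "\<dots> = (\<Sum>t<T. (q / c) ^ t) / ?Z"
  proof -
    have "pmf (output_time_pmf c T) t * q ^ t = (q / c) ^ t / ?Z" if "t \<in> {..<T}" for t
      using that by (simp add: pmf_output_time[OF c(1) T] divide_inverse power_mult_distrib)
    then have "(\<Sum>t<T. pmf (output_time_pmf c T) t * q ^ t) = (\<Sum>t<T. (q / c) ^ t / ?Z)"
      by (rule sum.cong[OF refl])
    then show ?thesis by (simp only: sum_divide_distrib)
  qed
  also have "\<dots> \<le> (1 / (1 - c)) / ?Z"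
  proof (rule divide_right_mono)
    have "(\<Sum>t<T. (q / c) ^ t) \<le> (\<Sum>t<T. c ^ t)"
      using c q by (intro sum_mono power_mono) (auto simp: field_simps power2_eq_square)
    also have "\<dots> = (1 - c ^ T) / (1 - c)" using c by (simp add: sum_gp_strict)
    also have "\<dots> \<le> 1 / (1 - c)" using c by (intro divide_right_mono) auto
    finally show "(\<Sum>t<T. (q / c) ^ t) \<le> 1 / (1 - c)" .
  qed (use Z0 in simp)
  also have "\<dots> \<le> (1 / (1 - c)) / inverse c ^ (T - 1)"
    using c Z Z0 by (intro divide_left_mono) auto
  also have "\<dots> = 1 / (1 - c) * c ^ (T - 1)"
    by (simp only: power_inverse divide_inverse inverse_inverse_eq)
  also have "\<dots> \<le> 1 / (1 - c) * (2 * c ^ T)"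
  proof (rule mult_left_mono)
    have "c ^ T = c * c ^ (T - 1)" using T by (cases T) auto
    then show "c ^ (T - 1) \<le> 2 * c ^ T" using c mult_right_mono[of 1 "2 * c" "c ^ (T - 1)"] by simp
  qed (use c in simp)
  finally have "A * E (output_time_pmf c T) (\<lambda>t. q ^ t)
    \<le> A * (1 / (1 - c) * (2 * c ^ T))"
    using A by (intro mult_left_mono)
  then have transient: "A * E (output_time_pmf c T) (\<lambda>t. q ^ t) \<le> 2 * A / (1 - c) * c ^ T"
    by (simp add: mult_ac)
  have "E (output_time_pmf c T) h
    \<le> E (output_time_pmf c T) (\<lambda>t. A * q ^ t + b)"
    using fin h by (intro expectation_mono_finite) auto
  also have "\<dots> = A * E (output_time_pmf c T) (\<lambda>t. q ^ t) + b"
    by (simp add: integrable_measure_pmf_finite[OF fin(1)])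
  finally show ?thesis using transient by linarith
qed

lemma nat_ceiling_ln_bigo: "(\<lambda>x. real (nat \<lceil>ln (1 / x)\<rceil>)) \<in> O[at_right 0](\<lambda>x. ln (1 / x))"
proof (rule bigoI[of _ 2])
  \<comment> \<open>Below exp(-1) the logarithm is at least 1, so rounding up at most doubles
    it.\<close>
  have "eventually (\<lambda>x::real. x \<in> {0<..<exp (- 1)}) (at_right 0)"
    by (rule eventually_at_right_real) simp
  then show "eventually (\<lambda>x. norm (real (nat \<lceil>ln (1 / x)\<rceil>)) \<le> 2 * norm (ln (1 / x))) (at_right (0::real))"
  proof eventually_elim
    case (elim x)
    then have "ln x < ln (exp (- 1))" by (subst ln_less_cancel_iff) auto
    then have 1: "1 \<le> ln (1 / x)" using elim by (simp add: ln_div)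
    then have e: "norm (real (nat \<lceil>ln (1 / x)\<rceil>)) = of_int \<lceil>ln (1 / x)\<rceil>" "norm (ln (1 / x)) = ln (1 / x)"
      by simp_all
    show ?case unfolding e using 1 of_int_ceiling_le_add_one[of "ln (1 / x)"] by linarith
  qed
qed

text \<open>With \<open>x = N T\<close> of the order of \<open>M\<close>, each of the four error terms is a power of a logarithm
  of \<open>M\<close> divided by \<open>M\<close>; five logarithms come from the last one.\<close>

lemma error_terms_le:
  fixes C0 C1 C2 C3 C4 M a \<alpha> :: real and N K T \<tau> :: nat
  defines "x \<equiv> real N * real T"
  assumes C: "0 < C0" "0 < C1" "0 < C2" "0 < C3" "0 < C4"
    and a: "a = 2 / C0" and \<alpha>: "\<alpha> = a * (ln x / real T)" "\<alpha> * C0 < 1" "1 \<le> a * ln x"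
    and N: "1 \<le> N" and K: "1 \<le> K" and T: "T = N * K" and M: "1 < M" "M / 2 \<le> x" "x \<le> M" "M / 4 \<le> (real T)\<^sup>2"
    and \<tau>: "real \<tau> \<le> 1 + ln (1 / \<alpha>)"
  shows "ln (1 / \<alpha>) \<le> real T"
    "C1 * (1 / \<alpha>) * (1 - \<alpha> * C0) ^ T + C2 * (\<alpha> * real \<tau> ^ 2 / real N)
      + C3 * (real K - 1) * \<alpha> ^ 2 * real \<tau> + C4 * \<alpha> ^ 3 * real \<tau> ^ 2
      \<le> (2 * C1 + 2 * C2 * a + 2 * C3 * a\<^sup>2 + 4 * C4 * a ^ 3) * (1 + ln M) ^ 5 / M"
proof -
  let ?T = "real T" and ?N = "real N" and ?\<Lambda> = "1 + ln M"
  have "1 \<le> T" using T N K by (simp add: Suc_le_eq)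
  then have T1: "1 \<le> ?T" by simp
  have a0: "0 < a" using a C by simp
  have x0: "0 < x" using M by linarith
  have Tx: "?T \<le> x" using N T1 mult_right_mono[of 1 ?N ?T] by (simp add: x_def)
  have lnx: "0 < ln x" using \<alpha>(3) a0 by (metis less_le_trans mult_pos_pos not_one_le_zero zero_less_mult_pos zero_less_one)
  have \<alpha>0: "0 < \<alpha>" using \<alpha>(1) a0 lnx T1 by simp
  have inv: "1 / \<alpha> = ?T / (a * ln x)" by (simp add: \<alpha>(1))
  also have "\<dots> \<le> ?T / 1" using \<alpha>(3) T1 by (intro divide_left_mono) auto
  finally have inv_le: "1 / \<alpha> \<le> ?T" by simp
  have "ln (1 / \<alpha>) \<le> ln ?T" using inv_le \<alpha>0 T1 by (subst ln_le_cancel_iff) auto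
  also have "ln ?T \<le> ?T - 1" using T1 by (intro ln_le_minus_one) auto
  finally show "ln (1 / \<alpha>) \<le> ?T" by simp
  have \<Lambda>1: "1 \<le> ?\<Lambda>" using M by simp
  have lnM: "ln x \<le> ?\<Lambda>" using x0 M ln_le_cancel_iff[of x M] by linarith
  have "ln (1 / \<alpha>) \<le> ln M" using inv_le \<alpha>0 T1 Tx M by (subst ln_le_cancel_iff) auto
  then have \<tau>\<Lambda>: "real \<tau> \<le> ?\<Lambda>" using \<tau> by simp
  have inv_x: "1 / x \<le> 2 / M" using M x0 by (simp add: field_simps)
  have pw: "?\<Lambda> ^ k \<le> ?\<Lambda> ^ 5" if "k \<le> 5" for k using \<Lambda>1 that by (rule power_increasing[rotated])
  have \<alpha>_le: "\<alpha> \<le> a * ?\<Lambda> / ?T" using \<alpha>(1) lnM a0 T1 by (simp add: divide_right_mono)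
  \<comment> \<open>a = 2 / C0 makes the exponent \<alpha> C0 T equal to 2 ln x, so the transient is
    at most 1 / x^2, against the factor 1/\<alpha> <= T <= x.\<close>
  have t1: "C1 * (1 / \<alpha>) * (1 - \<alpha> * C0) ^ T \<le> 2 * C1 * ?\<Lambda> ^ 5 / M"
  proof -
    have "(1 - \<alpha> * C0) ^ T \<le> exp (- (\<alpha> * C0)) ^ T"
      using \<alpha>(2) exp_ge_add_one_self[of "- (\<alpha> * C0)"] by (intro power_mono) auto
    also have "\<dots> = exp (- (?T * (\<alpha> * C0)))" by (simp add: exp_of_nat_mult[symmetric])
    also have "?T * (\<alpha> * C0) = 2 * ln x" using \<alpha>(1) a C T1 by simp
    also have "exp (- (2 * ln x)) = 1 / x\<^sup>2"
      using x0 by (simp add: exp_minus exp_double inverse_eq_divide)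
    finally have "(1 / \<alpha>) * (1 - \<alpha> * C0) ^ T \<le> x * (1 / x\<^sup>2)"
      using inv_le Tx \<alpha>0 \<alpha>(2) x0 by (intro mult_mono) auto
    also have "\<dots> = 1 / x" using x0 by (simp add: power2_eq_square)
    also have "\<dots> \<le> 2 / M * 1" using inv_x by simp
    also have "\<dots> \<le> 2 / M * ?\<Lambda> ^ 5" using M pw[of 0] by (intro mult_left_mono) auto
    finally have "C1 * ((1 / \<alpha>) * (1 - \<alpha> * C0) ^ T) \<le> C1 * (2 / M * ?\<Lambda> ^ 5)"
      using C by (intro mult_left_mono) auto
    then show ?thesis by (simp add: mult_ac)
  qed
  have t2: "C2 * (\<alpha> * real \<tau> ^ 2 / ?N) \<le> 2 * C2 * a * ?\<Lambda> ^ 5 / M"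
  proof -
    have "\<alpha> * real \<tau> ^ 2 / ?N \<le> (a * ?\<Lambda> / ?T) * ?\<Lambda>\<^sup>2 / ?N"
      using \<alpha>_le \<tau>\<Lambda> \<alpha>0 a0 \<Lambda>1 T1 by (intro divide_right_mono mult_mono power_mono) auto
    also have "\<dots> = a * ?\<Lambda> ^ 3 * (1 / x)" by (simp add: x_def power2_eq_square power3_eq_cube mult_ac)
    also have "\<dots> \<le> a * ?\<Lambda> ^ 5 * (2 / M)"
      using inv_x pw[of 3] a0 x0 \<Lambda>1 by (intro mult_mono) auto
    finally have "C2 * (\<alpha> * real \<tau> ^ 2 / ?N) \<le> C2 * (a * ?\<Lambda> ^ 5 * (2 / M))"
      using C by (intro mult_left_mono) auto
    then show ?thesis by (simp add: mult_ac)
  qed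
  \<comment> \<open>T = N K turns K / T^2 into 1 / (N T), which is 1 / x.\<close>
  have t3: "C3 * (real K - 1) * \<alpha> ^ 2 * real \<tau> \<le> 2 * C3 * a\<^sup>2 * ?\<Lambda> ^ 5 / M"
  proof -
    have "(real K - 1) * \<alpha> ^ 2 * real \<tau> \<le> real K * (a * ?\<Lambda> / ?T)\<^sup>2 * ?\<Lambda>"
      using \<alpha>_le \<tau>\<Lambda> \<alpha>0 K \<Lambda>1 by (intro mult_mono power_mono mult_nonneg_nonneg) auto
    also have "\<dots> = a\<^sup>2 * ?\<Lambda> ^ 3 * (1 / x)"
      using K N by (simp add: x_def T power2_eq_square power3_eq_cube)
    also have "\<dots> \<le> a\<^sup>2 * ?\<Lambda> ^ 5 * (2 / M)"
      using inv_x pw[of 3] a0 x0 \<Lambda>1 by (intro mult_mono) auto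
    finally have "C3 * ((real K - 1) * \<alpha> ^ 2 * real \<tau>) \<le> C3 * (a\<^sup>2 * ?\<Lambda> ^ 5 * (2 / M))"
      using C by (intro mult_left_mono) auto
    then show ?thesis by (simp add: mult_ac)
  qed
  \<comment> \<open>This term carries no 1/N; it is of order 1 / T^3 up to logarithms, and T^2 >= M
    / 4 brings it down to order 1 / M.\<close>
  have t4: "C4 * \<alpha> ^ 3 * real \<tau> ^ 2 \<le> 4 * C4 * a ^ 3 * ?\<Lambda> ^ 5 / M"
  proof -
    have "\<alpha> ^ 3 * real \<tau> ^ 2 \<le> (a * ?\<Lambda> / ?T) ^ 3 * ?\<Lambda>\<^sup>2"
      using \<alpha>_le \<tau>\<Lambda> \<alpha>0 \<Lambda>1 a0 T1 by (intro mult_mono power_mono) auto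
    also have "\<dots> = a ^ 3 * ?\<Lambda> ^ 5 * (1 / ?T ^ 3)"
      by (simp add: power_mult_distrib power_divide power_add[symmetric])
    also have "\<dots> \<le> a ^ 3 * ?\<Lambda> ^ 5 * (4 / M)"
    proof (rule mult_left_mono)
      have "M / 4 \<le> ?T ^ 3" using M(4) power_increasing[of 2 3 ?T] T1 by linarith
      then show "1 / ?T ^ 3 \<le> 4 / M" using M T1 by (simp add: field_simps)
    qed (use a0 \<Lambda>1 in auto)
    finally have "C4 * (\<alpha> ^ 3 * real \<tau> ^ 2) \<le> C4 * (a ^ 3 * ?\<Lambda> ^ 5 * (4 / M))"
      using C by (intro mult_left_mono) auto
    then show ?thesis by (simp add: mult_ac)
  qed
  show "C1 * (1 / \<alpha>) * (1 - \<alpha> * C0) ^ T + C2 * (\<alpha> * real \<tau> ^ 2 / real N)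
      + C3 * (real K - 1) * \<alpha> ^ 2 * real \<tau> + C4 * \<alpha> ^ 3 * real \<tau> ^ 2
      \<le> (2 * C1 + 2 * C2 * a + 2 * C3 * a\<^sup>2 + 4 * C4 * a ^ 3) * ?\<Lambda> ^ 5 / M"
    using add_mono[OF add_mono[OF add_mono[OF t1 t2] t3] t4]
    by (simp add: distrib_right add_divide_distrib)
qed

text \<open>With l = 1 + ln(1/\<epsilon>), M = C l^5 / \<epsilon> is the budget for N T, and K is M
  / N^2 rounded down. The upper bound assumed on N says exactly that N^2 <= M, so K >= 1 and N T
  lies between M/2 and M. C is large for three reasons: the step size must be below \<alpha>0, a ln
  x at least 1, and the final error at most \<epsilon>.\<close>

lemma sample_complexity:
  fixes C0 C1 C2 C3 C4 \<alpha>0 :: real and \<tau> :: "real \<Rightarrow> nat" and mse :: "real \<Rightarrow> nat \<Rightarrow> nat \<Rightarrow> nat \<Rightarrow> real"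
  assumes C: "0 < C0" "0 < C1" "0 < C2" "0 < C3" "0 < C4" and \<alpha>0: "0 < \<alpha>0" "\<alpha>0 * C0 < 1"
    and \<tau>: "\<And>\<alpha>. 0 < \<alpha> \<Longrightarrow> \<alpha> < \<alpha>0 \<Longrightarrow> real (\<tau> \<alpha>) \<le> 1 + ln (1 / \<alpha>)"
    and mse: "\<And>\<alpha> N K T. 0 < \<alpha> \<Longrightarrow> \<alpha> < \<alpha>0 \<Longrightarrow> 1 \<le> N \<Longrightarrow> 1 \<le> K \<Longrightarrow> 1 \<le> T \<Longrightarrow> ln (1 / \<alpha>) \<le> real T \<Longrightarrow>
      mse \<alpha> N K T \<le> C1 * (1 / \<alpha>) * (1 - \<alpha> * C0) ^ T + C2 * (\<alpha> * real (\<tau> \<alpha>) ^ 2 / real N)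
          + C3 * (real K - 1) * \<alpha> ^ 2 * real (\<tau> \<alpha>) + C4 * \<alpha> ^ 3 * real (\<tau> \<alpha>) ^ 2"
  shows "\<exists>a C :: real. \<exists>p :: nat. 0 < a \<and> 0 < C \<and>
      (\<forall>(N::nat) (\<epsilon>::real).
        1 \<le> N \<and> 0 < \<epsilon> \<and> \<epsilon> \<le> 1 \<and> real N \<le> C * (1 / (real N * \<epsilon>)) * (1 + ln (1 / \<epsilon>)) ^ p \<longrightarrow>
        (\<exists>(T::nat) (K::nat) \<alpha>::real.
          1 \<le> K \<and> T = N * K \<and> \<alpha> = a * (ln (real N * real T) / real T) \<and>
          real T \<le> C * (1 / (real N * \<epsilon>)) * (1 + ln (1 / \<epsilon>)) ^ p \<and>
          0 < \<alpha> \<and> \<alpha> < \<alpha>0 \<and> 1 * ln (1 / \<alpha>) \<le> real T \<and> mse \<alpha> N K T \<le> \<epsilon>))"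
proof -
  define a where "a = 2 / C0"
  have a: "0 < a" using C by (simp add: a_def)
  define W where "W = 2 * C1 + 2 * C2 * a + 2 * C3 * a\<^sup>2 + 4 * C4 * a ^ 3"
  have W: "0 < W" unfolding W_def using C a by (intro add_pos_pos) auto
  have "((\<lambda>M. 2 * a * ln M / sqrt M) \<longlongrightarrow> 0) at_top" by real_asymp
  then have e1: "eventually (\<lambda>M. 2 * a * ln M / sqrt M < \<alpha>0) at_top"
    using \<alpha>0(1) by (rule order_tendstoD)
  have "filterlim (\<lambda>M::real. ln (M / 2)) at_top at_top" by real_asymp
  then have e2: "eventually (\<lambda>M. 1 / a \<le> ln (M / 2)) at_top"
    by (simp add: filterlim_at_top)
  have "((\<lambda>C. W * (ln C + 6) ^ 5 / C) \<longlongrightarrow> 0) at_top" by real_asymp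
  then have e3: "eventually (\<lambda>C. W * (ln C + 6) ^ 5 / C < 1) at_top"
    by (rule order_tendstoD) simp
  obtain M0 where M0: "\<And>M. M0 \<le> M \<Longrightarrow> 2 * a * ln M / sqrt M < \<alpha>0 \<and> 1 / a \<le> ln (M / 2)"
    using eventually_conj[OF e1 e2] unfolding eventually_at_top_linorder by blast
  obtain M1 where M1: "\<And>C. M1 \<le> C \<Longrightarrow> W * (ln C + 6) ^ 5 / C < 1"
    using e3 unfolding eventually_at_top_linorder by blast
  define C where "C = max 4 (max M0 M1)"
  have Cge: "4 \<le> C" "M0 \<le> C" "M1 \<le> C" by (auto simp: C_def)
  have "\<exists>(T::nat) (K::nat) \<alpha>::real.
          1 \<le> K \<and> T = N * K \<and> \<alpha> = a * (ln (real N * real T) / real T) \<and>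
          real T \<le> C * (1 / (real N * \<epsilon>)) * (1 + ln (1 / \<epsilon>)) ^ 5 \<and>
          0 < \<alpha> \<and> \<alpha> < \<alpha>0 \<and> 1 * ln (1 / \<alpha>) \<le> real T \<and> mse \<alpha> N K T \<le> \<epsilon>"
    if N: "1 \<le> N" and \<epsilon>: "0 < \<epsilon>" "\<epsilon> \<le> 1"
      and NC: "real N \<le> C * (1 / (real N * \<epsilon>)) * (1 + ln (1 / \<epsilon>)) ^ 5" for N :: nat and \<epsilon> :: real
  proof -
    define l where "l = 1 + ln (1 / \<epsilon>)"
    have l: "1 \<le> l" using \<epsilon> by (simp add: l_def)
    define M where "M = C * l ^ 5 / \<epsilon>"
    have "C * 1 \<le> C * l ^ 5" using Cge one_le_power[OF l, of 5] by (intro mult_left_mono) auto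
    moreover have "C * l ^ 5 \<le> M" using \<epsilon> Cge l by (simp add: M_def le_divide_eq_1 field_simps mult_left_le)
    ultimately have M: "C \<le> M" by simp
    have NC': "C * (1 / (real N * \<epsilon>)) * (1 + ln (1 / \<epsilon>)) ^ 5 = M / real N"
      by (simp add: M_def l_def field_simps)
    have Npos: "0 < real N" using N by simp
    have NM: "(real N)\<^sup>2 \<le> M" using NC Npos unfolding NC' by (simp add: field_simps power2_eq_square)
    define y where "y = M / (real N)\<^sup>2"
    have y: "1 \<le> y" using NM Npos by (simp add: y_def)
    define K where "K = nat \<lfloor>y\<rfloor>"
    have fl: "1 \<le> \<lfloor>y\<rfloor>" using y by simp
    then have "real K = of_int \<lfloor>y\<rfloor>" by (simp add: K_def)
    with fl have K: "1 \<le> K" "real K \<le> y" "y / 2 \<le> real K"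
      by linarith+
    define T where "T = N * K"
    define x where "x = real N * real T"
    have x_eq: "x = (real N)\<^sup>2 * real K" by (simp add: x_def T_def power2_eq_square)
    have My: "M = (real N)\<^sup>2 * y" using Npos by (simp add: y_def)
    have xM: "x \<le> M" unfolding x_eq My using K by (intro mult_left_mono) auto
    have "(real N)\<^sup>2 * (y / 2) \<le> x" unfolding x_eq using K by (intro mult_left_mono) auto
    then have Mx: "M / 2 \<le> x" by (simp add: My)
    have T1: "1 \<le> T" using N K by (simp add: T_def)
    have Nsq: "real N \<le> sqrt M" using NM by (rule real_le_rsqrt)
    have sM: "0 < sqrt M" using M Cge by simp
    have "sqrt M * (sqrt M / 2) \<le> sqrt M * real T"
    proof -
      have "sqrt M * (sqrt M / 2) = M / 2" using M Cge by simp
      also have "\<dots> \<le> real N * real T" using Mx by (simp add: x_def)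
      also have "\<dots> \<le> sqrt M * real T" using Nsq by (intro mult_right_mono) auto
      finally show ?thesis .
    qed
    then have TM: "sqrt M / 2 \<le> real T" by (rule mult_left_le_imp_le[OF _ sM])
    then have "(sqrt M / 2)\<^sup>2 \<le> (real T)\<^sup>2" using sM by (intro power_mono) auto
    then have TM2: "M / 4 \<le> (real T)\<^sup>2" using M Cge by (simp add: power_divide)
    have lnx: "1 / a \<le> ln x"
    proof -
      have "1 / a \<le> ln (M / 2)" using M0[of M] M Cge by simp
      also have "\<dots> \<le> ln x" using Mx M Cge by (subst ln_le_cancel_iff) auto
      finally show ?thesis .
    qed
    then have lnx0: "0 < ln x" using a by (meson less_le_trans zero_less_divide_1_iff)
    define \<alpha> where "\<alpha> = a * (ln x / real T)"
    have \<alpha>_pos: "0 < \<alpha>" using a lnx0 T1 by (simp add: \<alpha>_def)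
    have "\<alpha> \<le> a * (ln M / (sqrt M / 2))"
      unfolding \<alpha>_def using a lnx0 TM sM xM Mx M Cge
      by (intro mult_left_mono frac_le) (auto intro!: ln_ge_zero)
    also have "\<dots> < \<alpha>0" using M0[of M] M Cge by (simp add: mult_ac)
    finally have \<alpha>_small: "\<alpha> < \<alpha>0" .
    have "\<alpha> * C0 < 1"
      using mult_strict_right_mono[OF \<alpha>_small C(1)] \<alpha>0 by linarith
    moreover have "1 \<le> a * ln x" using lnx a by (simp add: field_simps)
    ultimately have err: "ln (1 / \<alpha>) \<le> real T"
      "C1 * (1 / \<alpha>) * (1 - \<alpha> * C0) ^ T + C2 * (\<alpha> * real (\<tau> \<alpha>) ^ 2 / real N)
        + C3 * (real K - 1) * \<alpha> ^ 2 * real (\<tau> \<alpha>) + C4 * \<alpha> ^ 3 * real (\<tau> \<alpha>) ^ 2 \<le> W * (1 + ln M) ^ 5 / M"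
      unfolding W_def
      using error_terms_le[OF assms(1-5) a_def, of \<alpha> N T K M "\<tau> \<alpha>"] N K(1) T_def M Cge Mx xM TM2 \<alpha>_def
        \<tau>[OF \<alpha>_pos \<alpha>_small] by (auto simp: x_def)
    \<comment> \<open>6 = 5 + 1: 5 ln l comes from the power l^5 in M, and 1 + ln(1/\<epsilon>) is
      l.\<close>
    have "1 + ln M \<le> (ln C + 6) * l"
    proof -
      have "ln M = ln C + 5 * ln l + ln (1 / \<epsilon>)"
        using Cge l \<epsilon> by (simp add: M_def ln_mult ln_div ln_realpow)
      moreover have "ln l \<le> l" using l ln_le_minus_one[of l] by simp
      moreover have "ln C * 1 \<le> ln C * l" using l Cge by (intro mult_left_mono) auto
      ultimately have "1 + ln M \<le> ln C * l + 5 * l + l" by (simp add: l_def)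
      then show ?thesis by (simp add: algebra_simps)
    qed
    then have "(1 + ln M) ^ 5 \<le> ((ln C + 6) * l) ^ 5"
      using M Cge by (intro power_mono) auto
    then have "W * (1 + ln M) ^ 5 / M \<le> W * ((ln C + 6) * l) ^ 5 / M"
      using W M Cge by (intro divide_right_mono mult_left_mono) auto
    also have "\<dots> = (W * (ln C + 6) ^ 5 / C) * \<epsilon>"
      unfolding M_def power_mult_distrib using l \<epsilon> Cge by (simp add: field_simps)
    also have "\<dots> \<le> 1 * \<epsilon>"
      using M1[OF Cge(3)] \<epsilon> by (intro mult_right_mono) auto
    finally have small: "W * (1 + ln M) ^ 5 / M \<le> \<epsilon>" by simp
    have "mse \<alpha> N K T \<le> \<epsilon>"
      using mse[OF \<alpha>_pos \<alpha>_small N K(1) T1 err(1)] err(2) small by linarith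
    moreover have "real T \<le> M / real N" using xM Npos by (simp add: x_def field_simps)
    ultimately show ?thesis
      unfolding NC' using K(1) T_def \<alpha>_def x_def \<alpha>_pos \<alpha>_small err(1) by auto
  qed
  moreover have "0 < C" using Cge by simp
  ultimately show ?thesis using a by blast
qed

subsection \<open>The temporal difference update as a function of a window\<close>

lemma hop_pow_Cons:
  "xs \<noteq> [] \<Longrightarrow> (hop Q ^^ k) F (x # xs) = (hop Q ^^ k) (\<lambda>ys. F (x # ys)) xs"
proof (induction k arbitrary: xs)
  case (Suc k)
  then show ?case by (simp add: hop_def)
qed simp

lemma hop_pow_affine:
  fixes Q :: "'x::finite \<Rightarrow> 'x pmf" and T :: "'u::euclidean_space \<Rightarrow> 'v::euclidean_space"
  assumes "linear T"
  shows "(hop Q ^^ k) (\<lambda>xs. b + T (F xs)) xs = b + T ((hop Q ^^ k) F xs)"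
proof (induction k arbitrary: xs)
  case (Suc k)
  have T: "E p (\<lambda>x. T (h x)) = T (E p h)"
    for p :: "'x pmf" and h :: "'x \<Rightarrow> 'u"
    by (subst (1 2) integral_measure_pmf[of UNIV])
       (auto simp: linear_sum[OF assms] linear_cmul[OF assms])
  show ?case using Suc by (simp add: hop_def integrable_measure_pmf_finite T)
qed simp

lemma hop_pow_cong:
  assumes "\<And>ys. length ys = k \<Longrightarrow> F (xs @ ys) = F' (xs @ ys)"
  shows "(hop Q ^^ k) F xs = (hop Q ^^ k) F' xs"
  using assms
proof (induction k arbitrary: xs)
  case (Suc k)
  have "(hop Q ^^ k) F (xs @ [x]) = (hop Q ^^ k) F' (xs @ [x])" for x
    using Suc.prems[of "x # _"] by (intro Suc.IH) simp
  then show ?case by (simp add: hop_def[of Q _ xs])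
qed simp

definition discounted_return ::
  "('s \<Rightarrow> 'a \<Rightarrow> real) \<Rightarrow> real \<Rightarrow> ('s \<Rightarrow> real) \<Rightarrow> nat \<Rightarrow> ('s \<times> 'a) list \<Rightarrow> real" where
  "discounted_return R \<gamma> V n xs = (\<Sum>j<n. \<gamma> ^ j * R (fst (xs ! j)) (snd (xs ! j))) + \<gamma> ^ n * V (fst (xs ! n))"

lemma discounted_return_Cons:
  "discounted_return R \<gamma> V (Suc n) (x # xs) = R (fst x) (snd x) + \<gamma> * discounted_return R \<gamma> V n xs"
  by (simp add: discounted_return_def sum.lessThan_Suc_shift sum_distrib_left distrib_left mult_ac del: sum.lessThan_Suc)

lemma expectation_bind_Pair:
  fixes h :: "'s::finite \<times> 'a::finite \<Rightarrow> 'v::{banach, second_countable_topology}"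
  shows "E (bind_pmf p (\<lambda>s. map_pmf (Pair s) (q s))) h
    = (\<Sum>s\<in>UNIV. pmf p s *\<^sub>R (\<Sum>a\<in>UNIV. pmf (q s) a *\<^sub>R h (s, a)))"
proof -
  have "E (bind_pmf p (\<lambda>s. map_pmf (Pair s) (q s))) h
    = E p (\<lambda>s. E (map_pmf (Pair s) (q s)) h)"
    by (rule expectation_bind_finite) auto
  also have "\<dots> = E p (\<lambda>s. E (q s) (\<lambda>a. h (s, a)))"
    by simp
  finally show ?thesis unfolding expectation_finite_type .
qed

lemma expectation_state_action_kernel:
  fixes h :: "'s::finite \<times> 'a::finite \<Rightarrow> real"
  shows "E (state_action_kernel P \<pi> x) h
    = (\<Sum>s\<in>UNIV. pmf (P (fst x) (snd x)) s * (\<Sum>a\<in>UNIV. pmf (\<pi> s) a * h (s, a)))"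
  unfolding state_action_kernel_def by (simp only: expectation_bind_Pair real_scaleR_def)

text \<open>The induction splits off the first reward: after one step of the chain, the rest is an
  n-step return from the new state with its action drawn from \<pi>.\<close>

lemma bellman_pow_eq_expected_return:
  fixes P :: "'s::finite \<Rightarrow> 'a::finite \<Rightarrow> 's pmf"
  shows "((bellman P R \<gamma> \<pi> ^^ n) V) $ s
    = (\<Sum>a\<in>UNIV. pmf (\<pi> s) a * (hop (state_action_kernel P \<pi>) ^^ n) (discounted_return R \<gamma> (($) V) n) [(s, a)])"
proof (induction n arbitrary: s)
  case 0
  show ?case by (simp add: discounted_return_def sum_distrib_right[symmetric] sum_pmf_eq_1)
next
  case (Suc n)
  let ?Q = "state_action_kernel P \<pi>" and ?r = "discounted_return R \<gamma> (($) V)"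
  have step: "(hop ?Q ^^ Suc n) (?r (Suc n)) [x]
    = R (fst x) (snd x) + \<gamma> * E (?Q x) (\<lambda>y. (hop ?Q ^^ n) (?r n) [y])" for x
  proof -
    have "(hop ?Q ^^ Suc n) (?r (Suc n)) [x]
      = E (?Q x) (\<lambda>y. (hop ?Q ^^ n) (\<lambda>ys. ?r (Suc n) (x # ys)) [y])"
      by (simp add: hop_def hop_pow_Cons)
    also have "\<dots> = E (?Q x) (\<lambda>y. R (fst x) (snd x) + \<gamma> * (hop ?Q ^^ n) (?r n) [y])"
      unfolding discounted_return_Cons by (simp add: hop_pow_affine)
    finally show ?thesis by (simp add: integrable_measure_pmf_finite)
  qed
  have "((bellman P R \<gamma> \<pi> ^^ Suc n) V) $ s
    = (\<Sum>a\<in>UNIV. pmf (\<pi> s) a * (R s a + \<gamma> * (\<Sum>s'\<in>UNIV. pmf (P s a) s' * ((bellman P R \<gamma> \<pi> ^^ n) V) $ s')))"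
    by (simp add: bellman_def)
  also have "\<dots> = (\<Sum>a\<in>UNIV. pmf (\<pi> s) a * (hop ?Q ^^ Suc n) (?r (Suc n)) [(s, a)])"
    unfolding step Suc expectation_state_action_kernel by simp
  finally show ?case .
qed

text \<open>Stated for the whole history. At update t the history has t + n + 1 entries, so the
  window begins at index t, with the state whose features scale the update.\<close>

definition td_direction ::
  "('s \<Rightarrow> 'a \<Rightarrow> real) \<Rightarrow> real \<Rightarrow> real ^ 'd ^ 's \<Rightarrow> nat \<Rightarrow> real ^ 'd \<Rightarrow> ('s \<times> 'a) list \<Rightarrow> real ^ 'd" where
  "td_direction R \<gamma> \<Phi> n v xs = (let ys = drop (length xs - Suc n) xs in
    (discounted_return R \<gamma> (\<lambda>s. \<Phi> $ s \<bullet> v) n ys - \<Phi> $ fst (ys ! 0) \<bullet> v) *\<^sub>R \<Phi> $ fst (ys ! 0))"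

lemma window_td_direction: "window n (td_direction R \<gamma> \<Phi> n v)"
  by (simp add: window_def td_direction_def)

text \<open>The values of the intermediate states telescope, leaving the n-step return, bootstrapped
  at index t + n, minus the value at index t.\<close>

lemma sum_td_error:
  assumes "t + n < length xs"
  shows "(\<Sum>l=t..<t + n. \<gamma> ^ (l - t) * td_error R \<gamma> \<Phi> xs v l)
    = discounted_return R \<gamma> (\<lambda>s. \<Phi> $ s \<bullet> v) n (drop t xs) - \<Phi> $ fst (drop t xs ! 0) \<bullet> v"
  using assms
proof (induction n)
  case (Suc n)
  then show ?case
    by (simp add: td_error_def discounted_return_def algebra_simps)
qed (simp add: discounted_return_def)

lemma local_update_append:
  assumes "length xs = Suc (t + n)"
  shows "local_update R \<gamma> \<Phi> n \<alpha> (xs @ ys) t v = v + \<alpha> *\<^sub>R td_direction R \<gamma> \<Phi> n v xs"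
proof -
  have "td_error R \<gamma> \<Phi> (xs @ ys) v l = td_error R \<gamma> \<Phi> xs v l" if "l \<in> {t..<t + n}" for l
    using that assms by (simp add: td_error_def nth_append)
  then have "(\<Sum>l=t..<t + n. \<gamma> ^ (l - t) * td_error R \<gamma> \<Phi> (xs @ ys) v l)
      = discounted_return R \<gamma> (\<lambda>s. \<Phi> $ s \<bullet> v) n (drop t xs) - \<Phi> $ fst (drop t xs ! 0) \<bullet> v"
    using sum_td_error[of t n xs \<gamma> R \<Phi> v] assms by simp
  then show ?thesis using assms by (simp add: local_update_def td_direction_def nth_append)
qed

text \<open>Started from [x], the first entry of the window stays x through all n hops, so only the
  return is averaged, and its mean is a power of the Bellman operator.\<close>

lemma window_mean_td_direction:
  fixes P :: "'s::finite \<Rightarrow> 'a::finite \<Rightarrow> 's pmf" and \<Phi> :: "real ^ 'd ^ 's"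
  shows "window_mean (state_action_kernel P \<pi>) (bind_pmf \<mu> (\<lambda>s. map_pmf (Pair s) (\<pi> s))) n (td_direction R \<gamma> \<Phi> n v)
    = td_drift P R \<gamma> \<pi> \<mu> \<Phi> n v"
proof -
  let ?Q = "state_action_kernel P \<pi>"
  let ?V = "\<lambda>s. \<Phi> $ s \<bullet> v"
  let ?q = "\<lambda>x. (hop ?Q ^^ n) (discounted_return R \<gamma> ?V n) [x]"
  have V: "?V = ($) (\<Phi> *v v)" by (simp add: fun_eq_iff matrix_vector_mul_component)
  have hop: "(hop ?Q ^^ n) (td_direction R \<gamma> \<Phi> n v) [x] = (?q x - ?V (fst x)) *\<^sub>R \<Phi> $ fst x" for x
  proof -
    have "(hop ?Q ^^ n) (td_direction R \<gamma> \<Phi> n v) [x]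
      = (hop ?Q ^^ n) (\<lambda>xs. - ?V (fst x) *\<^sub>R \<Phi> $ fst x + discounted_return R \<gamma> ?V n xs *\<^sub>R \<Phi> $ fst x) [x]"
      by (rule hop_pow_cong) (simp add: td_direction_def scaleR_diff_left)
    also have "\<dots> = - ?V (fst x) *\<^sub>R \<Phi> $ fst x + ?q x *\<^sub>R \<Phi> $ fst x"
      by (rule hop_pow_affine) (simp add: linear_scaleR_left)
    finally show ?thesis by (simp add: scaleR_diff_left)
  qed
  have "window_mean ?Q (bind_pmf \<mu> (\<lambda>s. map_pmf (Pair s) (\<pi> s))) n (td_direction R \<gamma> \<Phi> n v)
    = (\<Sum>s\<in>UNIV. pmf \<mu> s *\<^sub>R (\<Sum>a\<in>UNIV. pmf (\<pi> s) a *\<^sub>R (?q (s, a) - ?V s) *\<^sub>R \<Phi> $ s))"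
    unfolding window_mean_def hop
    by (simp only: expectation_bind_Pair fst_conv)
  also have "\<dots> = (\<Sum>s\<in>UNIV. (pmf \<mu> s * ((\<Sum>a\<in>UNIV. pmf (\<pi> s) a * ?q (s, a)) - ?V s)) *\<^sub>R \<Phi> $ s)"
    by (intro sum.cong refl)
       (simp add: scaleR_sum_left[symmetric] right_diff_distrib sum_subtractf sum_distrib_right[symmetric] sum_pmf_eq_1)
  also have "\<dots> = td_drift P R \<gamma> \<pi> \<mu> \<Phi> n v"
    unfolding td_drift_def V by (simp add: bellman_pow_eq_expected_return matrix_vector_mul_component)
  finally show ?thesis .
qed

text \<open>The bounds hold for histories of every length: an entry beyond the end of a list is
  still an element of the finite type, so the sums over all states and actions cover it.\<close>

lemma td_direction_bounds:
  fixes \<Phi> :: "real ^ 'd ^ 's::finite" and R :: "'s \<Rightarrow> 'a::finite \<Rightarrow> real"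
  assumes "0 \<le> \<gamma>" "\<gamma> \<le> 1"
  obtains b where "0 \<le> b" "\<And>u v xs. norm (td_direction R \<gamma> \<Phi> n u xs - td_direction R \<gamma> \<Phi> n v xs) \<le> b * norm (u - v)"
    "\<And>v xs. norm (td_direction R \<gamma> \<Phi> n v xs) \<le> b * (1 + norm v)"
proof -
  define p where "p = (\<Sum>s\<in>UNIV. norm (\<Phi> $ s))"
  define r where "r = (\<Sum>s\<in>UNIV. \<Sum>a\<in>UNIV. \<bar>R s a\<bar>)"
  have p: "norm (\<Phi> $ s) \<le> p" for s unfolding p_def by (rule member_le_sum) auto
  have r: "\<bar>R s a\<bar> \<le> r" for s a
  proof -
    have "\<bar>R s a\<bar> \<le> (\<Sum>a\<in>UNIV. \<bar>R s a\<bar>)" by (rule member_le_sum) auto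
    also have "\<dots> \<le> r" unfolding r_def
      by (rule member_le_sum[of s UNIV "\<lambda>s. \<Sum>a\<in>UNIV. \<bar>R s a\<bar>"]) (auto intro: sum_nonneg)
    finally show ?thesis .
  qed
  have p0: "0 \<le> p" and r0: "0 \<le> r"
    unfolding p_def r_def by (auto intro: sum_nonneg)
  have pow: "0 \<le> \<gamma> ^ k" "\<gamma> ^ k \<le> 1" for k using assms by (auto simp: power_le_one)
  define b where "b = (real n * r + 2 * p) * p"
  have b: "0 \<le> b" "2 * p * p \<le> b" "real n * r * p \<le> b"
    unfolding b_def using p0 r0 by (auto simp: algebra_simps)
  have lip: "norm (td_direction R \<gamma> \<Phi> n u xs - td_direction R \<gamma> \<Phi> n v xs) \<le> 2 * p * p * norm (u - v)" for u v xs
  proof -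
    let ?ys = "drop (length xs - Suc n) xs"
    let ?s = "\<Phi> $ fst (?ys ! 0)" and ?e = "\<Phi> $ fst (?ys ! n)"
    have "td_direction R \<gamma> \<Phi> n u xs - td_direction R \<gamma> \<Phi> n v xs = (\<gamma> ^ n * (?e \<bullet> (u - v)) - ?s \<bullet> (u - v)) *\<^sub>R ?s"
      by (simp add: td_direction_def Let_def discounted_return_def inner_diff_right algebra_simps)
    also have "norm \<dots> \<le> (p * norm (u - v) + p * norm (u - v)) * p"
    proof -
      have in_le: "\<bar>\<Phi> $ s \<bullet> (u - v)\<bar> \<le> p * norm (u - v)" for s
        using Cauchy_Schwarz_ineq2[of "\<Phi> $ s" "u - v"] mult_right_mono[OF p[of s], of "norm (u - v)"] by simp
      have "\<bar>\<gamma> ^ n * (?e \<bullet> (u - v))\<bar> \<le> 1 * (p * norm (u - v))"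
        unfolding abs_mult using pow[of n] in_le by (intro mult_mono) auto
      then have "\<bar>\<gamma> ^ n * (?e \<bullet> (u - v)) - ?s \<bullet> (u - v)\<bar> \<le> p * norm (u - v) + p * norm (u - v)"
        using in_le[of "fst (?ys ! 0)"] by linarith
      then show ?thesis using p p0 by (auto intro!: mult_mono)
    qed
    finally show ?thesis by (simp add: algebra_simps)
  qed
  have zero: "norm (td_direction R \<gamma> \<Phi> n 0 xs) \<le> real n * r * p" for xs
  proof -
    let ?ys = "drop (length xs - Suc n) xs"
    let ?S = "\<Sum>j<n. \<gamma> ^ j * R (fst (?ys ! j)) (snd (?ys ! j))"
    have "\<bar>?S\<bar> \<le> (\<Sum>j<n. 1 * r)"
      unfolding real_norm_def[symmetric]
    proof (rule sum_norm_le)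
      show "norm (\<gamma> ^ j * R (fst (?ys ! j)) (snd (?ys ! j))) \<le> 1 * r" for j
        unfolding real_norm_def abs_mult using pow r by (intro mult_mono) auto
    qed
    then have "\<bar>?S\<bar> * norm (\<Phi> $ fst (?ys ! 0)) \<le> (real n * r) * p"
      using p p0 r0 by (intro mult_mono) auto
    then show ?thesis by (simp add: td_direction_def Let_def discounted_return_def)
  qed
  show ?thesis
  proof (rule that[OF b(1)])
    show "norm (td_direction R \<gamma> \<Phi> n u xs - td_direction R \<gamma> \<Phi> n v xs) \<le> b * norm (u - v)" for u v xs
      using lip[of u xs v] mult_right_mono[OF b(2), of "norm (u - v)"] by simp
    show "norm (td_direction R \<gamma> \<Phi> n v xs) \<le> b * (1 + norm v)" for v xs
    proof -
      have "norm (td_direction R \<gamma> \<Phi> n v xs) \<le> 2 * p * p * norm v + real n * r * p"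
        using lip[of v xs 0] zero[of xs] norm_triangle_ineq2[of "td_direction R \<gamma> \<Phi> n v xs" "td_direction R \<gamma> \<Phi> n 0 xs"]
        by simp
      also have "\<dots> \<le> b * norm v + b"
        using b mult_right_mono[OF b(2), of "norm v"] by (intro add_mono) auto
      finally show ?thesis by (simp add: algebra_simps)
    qed
  qed
qed

subsection \<open>Trajectories\<close>

text \<open>The noise state is the entire history, so the noise chain has the trajectory law itself;
  the functions evaluated on it look only at a window.\<close>

definition extend :: "('x \<Rightarrow> 'x pmf) \<Rightarrow> 'x list \<Rightarrow> 'x list pmf" where
  "extend Q xs = map_pmf (\<lambda>x. xs @ [x]) (Q (last xs))"

lemma finite_extend: "finite (set_pmf (extend Q xs))" for Q :: "'x::finite \<Rightarrow> 'x pmf"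
  by (simp add: extend_def)

lemma expectation_extend: "E (extend Q xs) F = hop Q F xs"
  by (simp add: extend_def hop_def)

lemma traj_pmf_Suc: "traj_pmf P \<pi> \<xi> (Suc L) = bind_pmf (traj_pmf P \<pi> \<xi> L) (extend (state_action_kernel P \<pi>))"
  by (simp add: extend_def[abs_def])

lemma finite_traj_pmf: "finite (set_pmf (traj_pmf P \<pi> \<xi> L))"
  for P :: "'s::finite \<Rightarrow> 'a::finite \<Rightarrow> 's pmf"
  by (induction L) auto

lemma length_traj_pmf: "xs \<in> set_pmf (traj_pmf P \<pi> \<xi> L) \<Longrightarrow> length xs = Suc L"
  by (induction L arbitrary: xs) auto

abbreviation trajs :: "('s \<Rightarrow> 'a \<Rightarrow> 's pmf) \<Rightarrow> ('s \<Rightarrow> 'a pmf) \<Rightarrow> 's pmf \<Rightarrow> nat \<Rightarrow> nat \<Rightarrow> (nat \<Rightarrow> ('s \<times> 'a) list) pmf" where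
  "trajs P \<pi> \<xi> N L \<equiv> Pi_pmf {..<N} [] (\<lambda>_. traj_pmf P \<pi> \<xi> L)"

lemma Pi_pmf_traj_Suc:
  fixes N :: nat
  shows "trajs P \<pi> \<xi> N (Suc L)
    = bind_pmf (trajs P \<pi> \<xi> N L)
        (\<lambda>\<omega>. Pi_pmf {..<N} [] (\<lambda>i. extend (state_action_kernel P \<pi>) (\<omega> i)))"
  unfolding traj_pmf_Suc by (rule Pi_pmf_bind) simp

lemma Pi_pmf_traj_length:
  fixes N :: nat
  assumes "\<omega> \<in> set_pmf (trajs P \<pi> \<xi> N L)" "i < N"
  shows "length (\<omega> i) = Suc L"
  using set_Pi_pmf_subset'[OF finite_lessThan, of N "[]" "\<lambda>_. traj_pmf P \<pi> \<xi> L"] assms length_traj_pmf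
  by (force simp: PiE_dflt_def)

lemma Pi_pmf_extend:
  fixes N :: nat
  assumes "\<omega>' \<in> set_pmf (Pi_pmf {..<N} [] (\<lambda>i. extend Q (\<omega> i)))" "i < N"
  obtains x where "\<omega>' i = \<omega> i @ [x]"
proof -
  have "\<omega>' i \<in> set_pmf (extend Q (\<omega> i))"
    using set_Pi_pmf_subset'[OF finite_lessThan, of N "[]" "\<lambda>i. extend Q (\<omega> i)"] assms
    by (force simp: PiE_dflt_def)
  then show ?thesis using that by (auto simp: extend_def)
qed

lemma agent_mean_eq_avg: "agent_mean N u = avg {..<N} u"
  by (simp add: agent_mean_def avg_def)

text \<open>Causality: the parameters at time t come from the updates 0 to t - 1, which read indices
  below t + n. All agents are constrained at once because synchronization mixes them.\<close>

lemma fed_td_append: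
  assumes "\<And>i. i < N \<Longrightarrow> t + n \<le> length (\<omega> i) \<and> (\<exists>ys. \<omega>' i = \<omega> i @ ys)" "i < N"
  shows "fed_td R \<gamma> \<Phi> n \<alpha> N K \<omega>' t i = fed_td R \<gamma> \<Phi> n \<alpha> N K \<omega> t i"
  using assms
proof (induction t arbitrary: i)
  case (Suc t)
  have u: "local_update R \<gamma> \<Phi> n \<alpha> (\<omega>' i) t (fed_td R \<gamma> \<Phi> n \<alpha> N K \<omega>' t i)
    = local_update R \<gamma> \<Phi> n \<alpha> (\<omega> i) t (fed_td R \<gamma> \<Phi> n \<alpha> N K \<omega> t i)" if i: "i < N" for i
  proof -
    have len: "Suc (t + n) \<le> length (\<omega> i)" using Suc.prems(1)[OF i] by simp
    obtain ys where ys: "\<omega>' i = \<omega> i @ ys" using Suc.prems(1)[OF i] by auto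
    have "fed_td R \<gamma> \<Phi> n \<alpha> N K \<omega>' t i = fed_td R \<gamma> \<Phi> n \<alpha> N K \<omega> t i"
      using Suc.prems(1) i by (intro Suc.IH) (auto dest: Suc_leD)
    moreover have "\<omega> i = take (Suc (t + n)) (\<omega> i) @ drop (Suc (t + n)) (\<omega> i)" by simp
    moreover have "\<omega>' i = take (Suc (t + n)) (\<omega> i) @ (drop (Suc (t + n)) (\<omega> i) @ ys)"
      using ys by simp
    moreover have "length (take (Suc (t + n)) (\<omega> i)) = Suc (t + n)" using len by simp
    ultimately show ?thesis by (metis local_update_append)
  qed
  show ?case
    using u Suc.prems(2) by (auto simp: Let_def agent_mean_def)
qed simp

text \<open>The trajectory is cut after index t + n, one more than the parameters at time t have
  read: this entry completes the window of the next update and matches the noise state of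
  \<open>joint\<close> at time t.\<close>

lemma expectation_marginal:
  fixes P :: "'s::finite \<Rightarrow> 'a::finite \<Rightarrow> 's pmf" and \<Phi> :: "real ^ 'd ^ 's" and h :: "real ^ 'd \<Rightarrow> real"
  assumes "t + n \<le> L"
  shows "E (trajs P \<pi> \<xi> N L)
      (\<lambda>\<omega>. h (agent_mean N (fed_td R \<gamma> \<Phi> n \<alpha> N K \<omega> t)))
    = E (trajs P \<pi> \<xi> N (t + n))
      (\<lambda>\<omega>. h (agent_mean N (fed_td R \<gamma> \<Phi> n \<alpha> N K \<omega> t)))"
  using assms
proof (induction L rule: dec_induct)
  case (step L)
  let ?P = "trajs P \<pi> \<xi> N L"
  let ?h = "\<lambda>\<omega>. h (agent_mean N (fed_td R \<gamma> \<Phi> n \<alpha> N K \<omega> t))"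
  have "E (trajs P \<pi> \<xi> N (Suc L)) ?h
    = E ?P (\<lambda>\<omega>. E
        (Pi_pmf {..<N} [] (\<lambda>i. extend (state_action_kernel P \<pi>) (\<omega> i))) ?h)"
    unfolding Pi_pmf_traj_Suc
    by (intro expectation_bind_finite finite_set_Pi_pmf finite_traj_pmf finite_extend) auto
  also have "\<dots> = E ?P (\<lambda>\<omega>. E
        (Pi_pmf {..<N} [] (\<lambda>i. extend (state_action_kernel P \<pi>) (\<omega> i))) (\<lambda>_. ?h \<omega>))"
  proof (intro expectation_cong)
    fix \<omega> \<omega>' assume \<omega>: "\<omega> \<in> set_pmf ?P"
      and \<omega>': "\<omega>' \<in> set_pmf (Pi_pmf {..<N} [] (\<lambda>i. extend (state_action_kernel P \<pi>) (\<omega> i)))"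
    have "fed_td R \<gamma> \<Phi> n \<alpha> N K \<omega>' t i = fed_td R \<gamma> \<Phi> n \<alpha> N K \<omega> t i" if "i < N" for i
    proof (rule fed_td_append[OF _ that])
      fix i assume i: "i < N"
      show "t + n \<le> length (\<omega> i) \<and> (\<exists>ys. \<omega>' i = \<omega> i @ ys)"
        using Pi_pmf_traj_length[OF \<omega> i] Pi_pmf_extend[OF \<omega>' i] step(1) by (metis le_SucI)
    qed
    then show "?h \<omega>' = ?h \<omega>" by (simp add: agent_mean_def)
  qed
  finally show ?case using step.IH by simp
qed simp

lemma output_mse_le:
  fixes P :: "'s::finite \<Rightarrow> 'a::finite \<Rightarrow> 's pmf" and \<Phi> :: "real ^ 'd ^ 's"
  assumes c: "0 < c" "c < 1" "1 / 2 \<le> c" and q: "0 \<le> q" "q \<le> c\<^sup>2" and T: "1 \<le> T" and A: "0 \<le> A"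
    and h: "\<And>t. E (trajs P \<pi> \<xi> N (t + n))
      (\<lambda>\<omega>. (norm (agent_mean N (fed_td R \<gamma> \<Phi> n \<alpha> N K \<omega> t) - v))\<^sup>2) \<le> A * q ^ t + b"
  shows "output_mse P R \<gamma> \<pi> \<xi> \<Phi> n \<alpha> N K T c v \<le> 2 * A / (1 - c) * c ^ T + b"
proof -
  let ?P = "trajs P \<pi> \<xi> N (T + n - 1)"
  let ?h = "\<lambda>\<omega> t. (norm (agent_mean N (fed_td R \<gamma> \<Phi> n \<alpha> N K \<omega> t) - v))\<^sup>2"
  have fin: "finite (set_pmf ?P)" by (intro finite_set_Pi_pmf finite_traj_pmf) simp
  have "output_mse P R \<gamma> \<pi> \<xi> \<Phi> n \<alpha> N K T c v
    = E (bind_pmf (output_time_pmf c T) (\<lambda>t. map_pmf (\<lambda>\<omega>. (\<omega>, t)) ?P)) (\<lambda>(\<omega>, t). ?h \<omega> t)"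
    unfolding output_mse_def pair_pmf_def
    by (subst bind_commute_pmf) (simp add: map_pmf_def)
  also have "\<dots> = E (output_time_pmf c T) (\<lambda>t. E ?P (\<lambda>\<omega>. ?h \<omega> t))"
    using finite_output_time(1)[OF c(1) T] fin by (subst expectation_bind_finite) auto
  also have "\<dots> \<le> 2 * A / (1 - c) * c ^ T + b"
  proof (rule expectation_output_time_le[OF c q T A])
    fix t assume "t < T"
    then have "t + n \<le> T + n - 1" by simp
    note marginal = expectation_marginal[OF this, where h = "\<lambda>u. (norm (u - v))\<^sup>2"]
    show "E ?P (\<lambda>\<omega>. ?h \<omega> t) \<le> A * q ^ t + b"
      unfolding marginal by (rule h)
  qed
  finally show ?thesis .
qed

subsection \<open>Federated temporal difference learning as a stochastic approximation\<close>

text \<open>Initial parameters 0 become errors - v, and the n + 1 initial entries are the first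
  window. Indices from N on are reset to 0 on both sides: there the two recursions run on the
  default [] and need not agree.\<close>

lemma joint_eq_trajectories:
  fixes P :: "'s::finite \<Rightarrow> 'a::finite \<Rightarrow> 's pmf" and \<Phi> :: "real ^ 'd ^ 's" and v :: "real ^ 'd" and N n :: nat
    and R :: "'s \<Rightarrow> 'a \<Rightarrow> real" and \<gamma> :: real and \<pi> :: "'s \<Rightarrow> 'a pmf"
  defines "f \<equiv> \<lambda>xs \<delta>. td_direction R \<gamma> \<Phi> n (\<delta> + v) xs" and "Q \<equiv> state_action_kernel P \<pi>"
  assumes sa: "stochastic_approximation f g B (extend Q) G L c" and N: "1 \<le> N"
  shows "map_pmf (\<lambda>x. (fst x, \<lambda>i. if i < N then snd x i else 0))
      (stochastic_approximation.joint f (extend Q) (traj_pmf P \<pi> \<xi> n) (- v) \<alpha> {..<N} [] K t)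
    = map_pmf (\<lambda>\<omega>. (\<omega>, \<lambda>i. if i < N then fed_td R \<gamma> \<Phi> n \<alpha> N K \<omega> t i - v else 0))
      (trajs P \<pi> \<xi> N (t + n))"
proof -
  interpret stochastic_approximation f g B "extend Q" G L c by (rule sa)
  define res :: "(nat \<Rightarrow> real ^ 'd) \<Rightarrow> nat \<Rightarrow> real ^ 'd" where "res = (\<lambda>u i. if i < N then u i else 0)"
  let ?J = "joint (traj_pmf P \<pi> \<xi> n) (- v) \<alpha> {..<N} [] K"
  let ?fed = "fed_td R \<gamma> \<Phi> n \<alpha> N K"
  have "map_pmf (\<lambda>x. (fst x, res (snd x))) (?J t)
    = map_pmf (\<lambda>\<omega>. (\<omega>, res (\<lambda>i. ?fed \<omega> t i - v))) (trajs P \<pi> \<xi> N (t + n))"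
  proof (induction t)
    case 0
    show ?case by (simp add: pmf.map_comp o_def)
  next
    case (Suc t)
    let ?P = "trajs P \<pi> \<xi> N (t + n)"
    let ?step = "\<lambda>y. map_pmf (\<lambda>w'. (w', res (fed_step \<alpha> {..<N} (K dvd Suc t) (fst y) (snd y))))
      (Pi_pmf {..<N} [] (\<lambda>i. extend Q (fst y i)))"
    \<comment> \<open>The reset commutes with a step because indices from N on do not enter the
      average.\<close>
    have res_step: "res (fed_step \<alpha> {..<N} b w (res u)) = res (fed_step \<alpha> {..<N} b w u)" for b w u
    proof -
      have "avg {..<N} (\<lambda>i. res u i + \<alpha> *\<^sub>R f (w i) (res u i)) = avg {..<N} (\<lambda>i. u i + \<alpha> *\<^sub>R f (w i) (u i))"
        by (intro avg_cong) (simp add: res_def)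
      then show ?thesis by (auto simp: fed_step_def res_def fun_eq_iff Let_def)
    qed
    have "map_pmf (\<lambda>x. (fst x, res (snd x))) (?J (Suc t)) = bind_pmf (?J t) ?step"
      by (simp add: map_bind_pmf pmf.map_comp o_def)
    also have "\<dots> = bind_pmf (map_pmf (\<lambda>x. (fst x, res (snd x))) (?J t)) ?step"
      by (simp add: bind_map_pmf res_step)
    also have "\<dots> = bind_pmf ?P (\<lambda>\<omega>. map_pmf (\<lambda>w'. (w', res (fed_step \<alpha> {..<N} (K dvd Suc t) \<omega> (\<lambda>i. ?fed \<omega> t i - v))))
      (Pi_pmf {..<N} [] (\<lambda>i. extend Q (\<omega> i))))"
      unfolding Suc by (simp add: bind_map_pmf res_step)
    also have "\<dots> = bind_pmf ?P (\<lambda>\<omega>. map_pmf (\<lambda>w'. (w', res (\<lambda>i. ?fed w' (Suc t) i - v)))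
      (Pi_pmf {..<N} [] (\<lambda>i. extend Q (\<omega> i))))"
    proof (intro bind_pmf_cong map_pmf_cong refl)
      fix \<omega> \<omega>' assume \<omega>: "\<omega> \<in> set_pmf ?P" and \<omega>': "\<omega>' \<in> set_pmf (Pi_pmf {..<N} [] (\<lambda>i. extend Q (\<omega> i)))"
      let ?u = "\<lambda>i. local_update R \<gamma> \<Phi> n \<alpha> (\<omega>' i) t (?fed \<omega>' t i)"
      have u: "?fed \<omega> t i - v + \<alpha> *\<^sub>R f (\<omega> i) (?fed \<omega> t i - v) = ?u i - v" if i: "i < N" for i
      proof -
        obtain x where x: "\<omega>' i = \<omega> i @ [x]" by (rule Pi_pmf_extend[OF \<omega>' i])
        have "?fed \<omega>' t i = ?fed \<omega> t i"
        proof (rule fed_td_append[OF _ i])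
          fix j assume j: "j < N"
          show "t + n \<le> length (\<omega> j) \<and> (\<exists>ys. \<omega>' j = \<omega> j @ ys)"
            using Pi_pmf_traj_length[OF \<omega> j] Pi_pmf_extend[OF \<omega>' j] by (metis le_SucI order_refl)
        qed
        then show ?thesis
          by (simp add: x f_def local_update_append[OF Pi_pmf_traj_length[OF \<omega> i]])
      qed
      then have "avg {..<N} (\<lambda>i. ?fed \<omega> t i - v + \<alpha> *\<^sub>R f (\<omega> i) (?fed \<omega> t i - v)) = avg {..<N} (\<lambda>i. ?u i - v)"
        by (intro avg_cong) simp
      also have "\<dots> = agent_mean N ?u - v"
        using N by (simp add: avg_diff avg_const agent_mean_eq_avg lessThan_empty_iff)
      finally show "(\<omega>', res (fed_step \<alpha> {..<N} (K dvd Suc t) \<omega> (\<lambda>i. ?fed \<omega> t i - v)))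
        = (\<omega>', res (\<lambda>i. ?fed \<omega>' (Suc t) i - v))"
        using u by (auto simp: fed_step_def res_def fun_eq_iff Let_def)
    qed
    also have "\<dots> = map_pmf (\<lambda>\<omega>. (\<omega>, res (\<lambda>i. ?fed \<omega> (Suc t) i - v))) (trajs P \<pi> \<xi> N (Suc t + n))"
      unfolding add_Suc Pi_pmf_traj_Suc Q_def by (simp add: map_bind_pmf)
    finally show ?case .
  qed
  then show ?thesis by (simp only: res_def)
qed

lemma expectation_traj_mixing:
  fixes P :: "'s::finite \<Rightarrow> 'a::finite \<Rightarrow> 's pmf" and \<pi> :: "'s \<Rightarrow> 'a pmf" and F :: "('s \<times> 'a) list \<Rightarrow> 'v::euclidean_space"
  defines "Q \<equiv> state_action_kernel P \<pi>"
  assumes mix: "\<And>k x y. \<bar>pmf (kernel_pow Q k x) y - pmf \<nu> y\<bar> \<le> C * \<rho> ^ k"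
    and \<rho>: "0 < \<rho>" "\<rho> < 1" and C: "0 < C"
    and F: "window n F" "\<And>xs. norm (F xs) \<le> b"
  shows "norm (E (traj_pmf P \<pi> \<xi> (t + n)) F - window_mean Q \<nu> n F)
    \<le> (2 + C * CARD('s \<times> 'a)) / \<rho> ^ n * b * \<rho> ^ t"
proof -
  let ?p = "traj_pmf P \<pi> \<xi> n"
  have "E (traj_pmf P \<pi> \<xi> (t + n)) F = E ?p ((hop Q ^^ t) F)" for F :: "('s \<times> 'a) list \<Rightarrow> 'v"
  proof (induction t arbitrary: F)
    case (Suc t)
    have "E (traj_pmf P \<pi> \<xi> (Suc t + n)) F
      = E (traj_pmf P \<pi> \<xi> (t + n)) (hop Q F)"
      unfolding add_Suc traj_pmf_Suc Q_def[symmetric]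
      by (subst expectation_bind_finite) (simp_all add: finite_traj_pmf finite_extend expectation_extend[abs_def])
    then show ?case by (simp only: Suc hop_pow_Suc_apply)
  qed simp
  then have "E (traj_pmf P \<pi> \<xi> (t + n)) F - window_mean Q \<nu> n F
    = E ?p (\<lambda>xs. (hop Q ^^ t) F xs - window_mean Q \<nu> n F)"
    by (simp add: integrable_measure_pmf_finite[OF finite_traj_pmf])
  also have "norm \<dots> \<le> (2 + C * CARD('s \<times> 'a)) / \<rho> ^ n * b * \<rho> ^ t"
  proof (rule norm_expectation_le[OF finite_traj_pmf])
    fix xs assume "xs \<in> set_pmf ?p"
    then have "xs \<noteq> []" using length_traj_pmf by fastforce
    then show "norm ((hop Q ^^ t) F xs - window_mean Q \<nu> n F) \<le> (2 + C * CARD('s \<times> 'a)) / \<rho> ^ n * b * \<rho> ^ t"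
      by (rule hop_pow_mixing[OF mix \<rho> C F])
  qed
  finally show ?thesis .
qed

lemma fed_td_mean_square:
  fixes P :: "'s::finite \<Rightarrow> 'a::finite \<Rightarrow> 's pmf" and \<Phi> :: "real ^ 'd ^ 's"
  assumes \<gamma>: "0 < \<gamma>" "\<gamma> < 1" and n: "1 \<le> n"
    and irr: "irreducible_chain (state_action_kernel P \<pi>)"
    and aper: "aperiodic_chain (state_action_kernel P \<pi>)"
    and st: "stationary (state_kernel P \<pi>) \<mu>" and rank: "rank \<Phi> = CARD('d)"
  obtains A \<kappa> a1 :: real where "0 < A" "0 < \<kappa>" "0 < a1" "a1 * \<kappa> \<le> 1"
    "\<And>\<alpha> N K t. 0 < \<alpha> \<Longrightarrow> \<alpha> < a1 \<Longrightarrow> 1 \<le> N \<Longrightarrow> 1 \<le> K \<Longrightarrow>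
      E (trajs P \<pi> \<xi> N (t + n))
        (\<lambda>\<omega>. (norm (agent_mean N (fed_td R \<gamma> \<Phi> n \<alpha> N K \<omega> t) - td_solution P R \<gamma> \<pi> \<mu> \<Phi> n))\<^sup>2)
      \<le> A * (1 - \<kappa> * \<alpha>) ^ t + (A * (\<alpha> / real N) + (if K = 1 then A * \<alpha> ^ 3 else A * \<alpha>\<^sup>2))"
proof -
  define Q where "Q = state_action_kernel P \<pi>"
  define \<nu> where "\<nu> = bind_pmf \<mu> (\<lambda>s. map_pmf (Pair s) (\<pi> s))"
  define v where "v = td_solution P R \<gamma> \<pi> \<mu> \<Phi> n"
  \<comment> \<open>A step of the pair chain draws a state and then an action from \<pi>, so \<mu>
    followed by \<pi> is stationary for the pairs.\<close>
  have st\<nu>: "stationary Q \<nu>"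
  proof -
    have "bind_pmf \<nu> Q = bind_pmf (bind_pmf \<mu> (state_kernel P \<pi>)) (\<lambda>s. map_pmf (Pair s) (\<pi> s))"
      by (simp add: \<nu>_def Q_def state_action_kernel_def[abs_def] state_kernel_def[abs_def] bind_assoc_pmf bind_map_pmf)
    then show ?thesis using st by (simp add: stationary_def \<nu>_def)
  qed
  have \<mu>: "0 < pmf \<mu> s" for s
  proof -
    \<comment> \<open>Any action would do: irreducibility of the pair chain gives every pair
      positive mass.\<close>
    have "0 < pmf \<nu> (s, undefined)"
      using stationary_positive[OF _ st\<nu>] irr by (simp add: Q_def)
    then show ?thesis by (auto simp: pmf_positive_iff \<nu>_def)
  qed
  obtain c B where B: "0 < c" "linear B" "\<And>u. u \<bullet> B u \<le> - c * (norm u)\<^sup>2"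
    "\<And>u. td_drift P R \<gamma> \<pi> \<mu> \<Phi> n (u + v) = B u"
    using td_drift_properties[OF \<gamma> n st \<mu> rank, of R] unfolding v_def by blast
  obtain bB where bB: "0 < bB" "\<And>u. norm (B u) \<le> norm u * bB"
    using bounded_linear.pos_bounded linear_conv_bounded_linear B(2) by blast
  obtain b where b: "0 \<le> b"
    "\<And>u w xs. norm (td_direction R \<gamma> \<Phi> n u xs - td_direction R \<gamma> \<Phi> n w xs) \<le> b * norm (u - w)"
    "\<And>w xs. norm (td_direction R \<gamma> \<Phi> n w xs) \<le> b * (1 + norm w)"
    using td_direction_bounds[of \<gamma> R \<Phi> n] \<gamma> by (metis less_imp_le)
  obtain C \<rho> :: real where mix: "0 < C" "0 < \<rho>" "\<rho> < 1"
    "\<And>k x y. \<bar>pmf (kernel_pow Q k x) y - pmf \<nu> y\<bar> \<le> C * \<rho> ^ k"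
    using geometric_mixing[OF irr aper, folded Q_def, OF st\<nu>] by blast
  obtain \<kappa> :: "'s \<times> 'a \<Rightarrow> 's \<times> 'a \<Rightarrow> real" where \<kappa>:
    "\<And>x y. \<kappa> x y - E (Q x) (\<lambda>z. \<kappa> z y) = (if x = y then 1 else 0) - pmf \<nu> y"
    using deviation_kernel[OF irr aper, folded Q_def, OF st\<nu>] by blast
  define f where "f = (\<lambda>xs \<delta>. td_direction R \<gamma> \<Phi> n (\<delta> + v) xs)"
  define g0 where "g0 = (\<lambda>\<delta>. window_poisson Q \<nu> \<kappa> n (\<lambda>xs. f xs \<delta>))"
  \<comment> \<open>A Poisson solution is free up to a constant. Subtracting the stationary mean at
    0 centres g at 0, so its expectation along the chain decays geometrically; the equation is
    unaffected.\<close>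
  define g where "g = (\<lambda>xs \<delta>. g0 \<delta> xs - window_mean Q \<nu> n (g0 0))"
  define cp where "cp = 2 * real n + (\<Sum>x\<in>UNIV. \<Sum>y\<in>UNIV. \<bar>\<kappa> x y\<bar>)"
  define cm where "cm = (2 + C * CARD('s \<times> 'a)) / \<rho> ^ n"
  define w where "w = b * (1 + norm v)"
  \<comment> \<open>A sum of all the constants, so that it bounds each of them; the last two
    summands are for the decay of f and g at 0.\<close>
  define L where "L = 1 + b + w + cp * b + 2 * (cp * w) + bB + cm * w + cm * (cp * w)"
  have nn: "0 \<le> cp" "0 \<le> cm" "0 \<le> w" "0 \<le> cp * b" "0 \<le> cp * w" "0 \<le> cm * w" "0 \<le> cm * (cp * w)"
  proof -
    show cp: "0 \<le> cp" by (auto simp: cp_def intro!: add_nonneg_nonneg sum_nonneg)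
    show cm: "0 \<le> cm" using mix by (simp add: cm_def)
    show w: "0 \<le> w" using b(1) by (simp add: w_def)
    show "0 \<le> cp * b" "0 \<le> cp * w" "0 \<le> cm * w" "0 \<le> cm * (cp * w)" using cp cm w b(1) by auto
  qed
  have Lge: "1 \<le> L" "b \<le> L" "w \<le> L" "cp * b \<le> L" "2 * (cp * w) \<le> L" "bB \<le> L" "cm * w \<le> L" "cm * (cp * w) \<le> L"
    unfolding L_def using nn b(1) bB(1) by linarith+
  have win_f: "window n (\<lambda>xs. f xs \<delta>)" for \<delta> unfolding f_def by (rule window_td_direction)
  have mean_f: "window_mean Q \<nu> n (\<lambda>xs. f xs \<delta>) = B \<delta>" for \<delta>
    unfolding f_def Q_def \<nu>_def window_mean_td_direction by (rule B(4))
  have f0: "norm (f xs 0) \<le> w" for xs using b(3)[of v xs] by (simp add: f_def w_def)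
  have lip_f: "norm (f xs u - f xs u') \<le> b * norm (u - u')" for xs u u'
    using b(2)[of "u + v" xs "u' + v"] by (simp add: f_def)
  have g0_0: "norm (g0 0 xs) \<le> cp * w" for xs
    unfolding g0_def cp_def by (rule norm_window_poisson_le) (rule f0)
  have win_g0: "window n (g0 0)" unfolding g0_def by (rule window_window_poisson[OF win_f])
  have scale: "x * norm y \<le> L * norm y" if "x \<le> L" for x and y :: "real ^ 'd"
    using that by (rule mult_right_mono) simp
  have scale_\<rho>: "x * \<rho> ^ t \<le> L * \<rho> ^ t" if "x \<le> L" for x t
    using that mix(2) by (intro mult_right_mono) auto
  interpret sa: stochastic_approximation f g B "extend Q" "{xs. xs \<noteq> []}" L c
  proof
    show "finite (set_pmf (extend Q xs))" for xs by (rule finite_extend)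
    show "xs' \<in> {xs. xs \<noteq> []}" if "xs' \<in> set_pmf (extend Q xs)" for xs xs'
      using that by (auto simp: extend_def)
    show "f xs \<delta> - B \<delta> = g xs \<delta> - E (extend Q xs) (\<lambda>xs'. g xs' \<delta>)"
      if "xs \<in> {xs. xs \<noteq> []}" for xs \<delta>
    proof -
      have "f xs \<delta> - B \<delta> = g0 \<delta> xs - hop Q (g0 \<delta>) xs"
        unfolding mean_f[symmetric] g0_def using that by (intro window_poisson_equation \<kappa> win_f) simp
      moreover have "E (extend Q xs) (\<lambda>xs'. g xs' \<delta>)
        = hop Q (g0 \<delta>) xs - window_mean Q \<nu> n (g0 0)"
        unfolding g_def expectation_extend[symmetric]
        by (simp add: integrable_measure_pmf_finite[OF finite_extend])
      ultimately show ?thesis by (simp add: g_def)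
    qed
    show "norm (f xs u - f xs u') \<le> L * norm (u - u')" for xs u u'
      using lip_f scale[OF Lge(2)] order_trans by blast
    show "norm (g xs u - g xs u') \<le> L * norm (u - u')" for xs u u'
    proof -
      have "norm (g xs u - g xs u') \<le> cp * (b * norm (u - u'))"
        unfolding g_def g0_def cp_def
        by (simp add: window_poisson_diff[symmetric]) (rule norm_window_poisson_le, rule lip_f)
      also have "\<dots> \<le> L * norm (u - u')" using scale[OF Lge(4), of "u - u'"] by (simp add: mult.assoc)
      finally show ?thesis .
    qed
    show "norm (f xs 0) \<le> L" for xs using f0[of xs] Lge(3) by simp
    show "norm (g xs 0) \<le> L" for xs
    proof -
      have "norm (g xs 0) \<le> cp * w + cp * w"
        unfolding g_def by (intro order_trans[OF norm_triangle_ineq4] add_mono g0_0 norm_window_mean_le)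
      then show ?thesis using Lge(5) by simp
    qed
    show "norm (B u) \<le> L * norm u" for u
      using bB(2)[of u] scale[OF Lge(6), of u] by (simp add: mult.commute)
  qed (use B Lge in \<open>auto simp: linear_add[OF B(2)] linear_cmul[OF B(2)]\<close>)
  let ?p0 = "traj_pmf P \<pi> \<xi> n"
  have p0: "finite (set_pmf ?p0)" "set_pmf ?p0 \<subseteq> {xs. xs \<noteq> []}"
    using length_traj_pmf[of _ P \<pi> \<xi> n] by (fastforce simp: finite_traj_pmf)+
  have law: "sa.law ?p0 t = traj_pmf P \<pi> \<xi> (t + n)" for t
  proof (induction t)
    case (Suc t)
    show ?case unfolding add_Suc traj_pmf_Suc sa.law.simps Suc by (simp only: Q_def)
  qed simp
  \<comment> \<open>The stationary mean of f at 0 is B 0 = 0, so mixing drives this expectation to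
    zero.\<close>
  have decay_f: "norm (E (sa.law ?p0 t) (\<lambda>xs. f xs 0)) \<le> L * \<rho> ^ t" for t
    using expectation_traj_mixing[OF mix(4)[unfolded Q_def] mix(2,3,1) win_f f0, of \<xi> t] scale_\<rho>[OF Lge(7), of t]
    unfolding law mean_f[unfolded Q_def] cm_def by (simp add: linear_0[OF B(2)])
  have decay_g: "norm (E (sa.law ?p0 t) (\<lambda>xs. g xs 0)) \<le> L * \<rho> ^ t" for t
    using expectation_traj_mixing[OF mix(4)[unfolded Q_def] mix(2,3,1) win_g0 g0_0, of \<xi> t, folded Q_def] scale_\<rho>[OF Lge(8), of t]
    unfolding law g_def cm_def
    by (simp add: integrable_measure_pmf_finite[OF finite_traj_pmf] mult.assoc)
  define K3 where "K3 = 2 + 16 * L\<^sup>2 + 16 * L\<^sup>2 / sa.lam"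
  define K4 where "K4 = sa.K1 * 3 * L\<^sup>2"
  have pos: "0 < sa.lam" "0 \<le> sa.K1" "0 \<le> sa.K2" "0 \<le> K3" "0 \<le> K4" "0 < sa.M"
  proof -
    show lam: "0 < sa.lam" by (rule sa.lam_ge)
    show K1: "0 \<le> sa.K1" using sa.K1_ge(2) by simp
    show "0 \<le> sa.K2" unfolding sa.K2_def using lam K1 by simp
    show "0 \<le> K3" "0 \<le> K4" unfolding K3_def K4_def using lam K1 by auto
    show "0 < sa.M" unfolding sa.M_def using Lge(1) B(1) K1 by (intro add_pos_nonneg) auto
  qed
  define A1 where "A1 = K3 * (4 * (1 + sa.lam) * (1 + norm (- v))\<^sup>2)"
  define A2 where "A2 = K3 * (4 / c * sa.K2 + 1)"
  define B1 where "B1 = 32 * (1 + norm (- v))\<^sup>2 + 8 * L\<^sup>2"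
  define B2 where "B2 = 8 * (K4 / (1 - \<rho>))"
  define B3 where "B3 = 8 * (4 / c * K4) + 8 * L\<^sup>2"
  define A where "A = 1 + A1 + A2 + B1 + B2 + B3"
  have A0: "0 \<le> A1" "0 \<le> A2" "0 \<le> B1" "0 \<le> B2" "0 \<le> B3"
    unfolding A1_def A2_def B1_def B2_def B3_def using pos B(1) mix(3) by auto
  then have A: "0 < A" "A1 \<le> A" "A2 \<le> A" "B1 \<le> A" "B2 \<le> A" "B3 \<le> A"
    unfolding A_def by auto
  \<comment> \<open>The first bound is the small-step condition; the second keeps c/4 \<alpha> below
    1 - \<rho>, as the synchronized case requires.\<close>
  define a1 where "a1 = min (1 / sa.M) ((1 - \<rho>) * (4 / c))"
  have a1: "0 < a1" unfolding a1_def using pos mix(3) B(1) by simp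
  have a1c: "a1 * (c / 4) \<le> 1 - \<rho>"
  proof -
    have "a1 * (c / 4) \<le> ((1 - \<rho>) * (4 / c)) * (c / 4)"
      unfolding a1_def using B(1) by (intro mult_right_mono) auto
    then show ?thesis using B(1) by simp
  qed
  show ?thesis
  proof (rule that[of A "c / 4" a1])
    show "a1 * (c / 4) \<le> 1" using a1c mix(2) by simp
    fix \<alpha> :: real and N K t :: nat
    assume \<alpha>: "0 < \<alpha>" "\<alpha> < a1" and N: "1 \<le> N" and K: "1 \<le> K"
    let ?q = "1 - c / 4 * \<alpha>"
    let ?J = "sa.joint ?p0 (- v) \<alpha> {..<N} [] K t"
    let ?E = "E ?J (\<lambda>x. (norm (avg {..<N} (snd x)))\<^sup>2)"
    have I: "finite {..<N}" "{..<N} \<noteq> {}" using N by (auto simp: lessThan_empty_iff)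
    have "\<alpha> * sa.M \<le> a1 * sa.M" using \<alpha> pos by simp
    also have "\<dots> \<le> 1 / sa.M * sa.M" unfolding a1_def using pos by (intro mult_right_mono) auto
    finally have aM: "\<alpha> * sa.M \<le> 1" using pos by simp
    have "c / 4 * \<alpha> \<le> c / 4 * a1" using \<alpha> B(1) by simp
    then have ac: "c / 4 * \<alpha> \<le> 1 - \<rho>" using a1c by (simp add: mult.commute)
    have q: "0 \<le> ?q ^ t" using ac mix(2) by (intro zero_le_power) simp
    have "E (trajs P \<pi> \<xi> N (t + n))
        (\<lambda>\<omega>. (norm (agent_mean N (fed_td R \<gamma> \<Phi> n \<alpha> N K \<omega> t) - v))\<^sup>2)
      = E (map_pmf (\<lambda>\<omega>. (\<omega>, \<lambda>i. if i < N then fed_td R \<gamma> \<Phi> n \<alpha> N K \<omega> t i - v else 0))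
          (trajs P \<pi> \<xi> N (t + n))) (\<lambda>x. (norm (avg {..<N} (snd x)))\<^sup>2)"
    proof -
      have "agent_mean N u - v = avg {..<N} (\<lambda>i. if i < N then u i - v else 0)" for u
      proof -
        have "avg {..<N} (\<lambda>i. if i < N then u i - v else 0) = avg {..<N} (\<lambda>i. u i - v)"
          by (intro avg_cong) simp
        then show ?thesis using I by (simp add: avg_diff avg_const agent_mean_eq_avg)
      qed
      then show ?thesis by simp
    qed
    also have "\<dots> = E (map_pmf (\<lambda>x. (fst x, \<lambda>i. if i < N then snd x i else 0)) ?J)
        (\<lambda>x. (norm (avg {..<N} (snd x)))\<^sup>2)"
      using joint_eq_trajectories[OF sa.stochastic_approximation_axioms[unfolded f_def Q_def] N, of \<xi> \<alpha> K t]
      unfolding f_def[symmetric] Q_def[symmetric] by simp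
    also have "\<dots> = ?E"
    proof -
      have "avg {..<N} (\<lambda>i. if i < N then u i else 0) = avg {..<N} u" for u :: "nat \<Rightarrow> real ^ 'd"
        by (intro avg_cong) simp
      then show ?thesis by simp
    qed
    also have "?E \<le> A * ?q ^ t + (A * (\<alpha> / real N) + (if K = 1 then A * \<alpha> ^ 3 else A * \<alpha>\<^sup>2))"
    proof (cases "K = 1")
      case True
      have "?E \<le> B1 * ?q ^ t + B2 * \<alpha> ^ 3 + B3 * (\<alpha> / real N)"
        using sa.mean_square_synchronized_le[OF p0 I \<alpha>(1) aM _ mix(3) ac decay_f decay_g, of "- v" "[]" t] mix(2)
        unfolding True B1_def B2_def B3_def K4_def by simp
      also have "\<dots> \<le> A * ?q ^ t + A * \<alpha> ^ 3 + A * (\<alpha> / real N)"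
        using A \<alpha>(1) q by (intro add_mono mult_right_mono) auto
      finally show ?thesis using True by simp
    next
      case False
      have "?E \<le> K3 * (?q ^ t * (4 * (1 + sa.lam) * (1 + norm (- v))\<^sup>2)
          + 4 / c * sa.K2 * (\<alpha>\<^sup>2 + \<alpha> / real N) + \<alpha>\<^sup>2)"
        using sa.mean_square_joint_le[OF p0 I \<alpha>(1) aM, of "- v" "[]" K t] unfolding K3_def by simp
      also have "\<dots> \<le> A1 * ?q ^ t + A2 * (\<alpha> / real N) + A2 * \<alpha>\<^sup>2"
      proof -
        have alg: "K3 * (p * y + x * (s + r) + s) \<le> K3 * y * p + K3 * (x + 1) * r + K3 * (x + 1) * s"
          if "0 \<le> r" for p y x s r :: real
          using mult_nonneg_nonneg[OF pos(4) that] by (simp add: algebra_simps)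
        show ?thesis unfolding A1_def A2_def by (rule alg) (use \<alpha>(1) in simp)
      qed
      also have "\<dots> \<le> A * ?q ^ t + A * (\<alpha> / real N) + A * \<alpha>\<^sup>2"
        using A \<alpha>(1) q by (intro add_mono mult_right_mono) auto
      finally show ?thesis using False by simp
    qed
    finally show "E (trajs P \<pi> \<xi> N (t + n))
        (\<lambda>\<omega>. (norm (agent_mean N (fed_td R \<gamma> \<Phi> n \<alpha> N K \<omega> t) - td_solution P R \<gamma> \<pi> \<mu> \<Phi> n))\<^sup>2)
      \<le> A * (1 - c / 4 * \<alpha>) ^ t + (A * (\<alpha> / real N) + (if K = 1 then A * \<alpha> ^ 3 else A * \<alpha>\<^sup>2))"
      unfolding v_def .
  qed (use A(1) B(1) a1 in auto)
qed

theorem theorem5p1: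
  fixes P :: "'s::finite \<Rightarrow> 'a::finite \<Rightarrow> 's pmf"
    and R :: "'s \<Rightarrow> 'a \<Rightarrow> real"
    and \<gamma> :: real
    and \<pi> :: "'s \<Rightarrow> 'a pmf"
    and \<xi> \<mu> :: "'s pmf"
    and \<Phi> :: "real ^ 'd::finite ^ 's"
    and n :: nat
  assumes "0 < \<gamma>" and "\<gamma> < 1"
    and "1 \<le> n"
    and "irreducible_chain (state_action_kernel P \<pi>)"
    and "aperiodic_chain (state_action_kernel P \<pi>)"
    and "stationary (state_kernel P \<pi>) \<mu>"
    and "rank \<Phi> = CARD('d)"
  shows "\<exists>C0 C1 C2 C3 C4 \<alpha>0 b :: real. \<exists>\<tau> :: real \<Rightarrow> nat. \<exists>c :: real \<Rightarrow> real.
    0 < C0 \<and> 0 < C1 \<and> 0 < C2 \<and> 0 < C3 \<and> 0 < C4 \<and> 0 < \<alpha>0 \<and> \<alpha>0 * C0 < 1 \<and> 0 < b \<and>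
    (\<lambda>\<alpha>. real (\<tau> \<alpha>)) \<in> O[at_right 0](\<lambda>\<alpha>. ln (1 / \<alpha>)) \<and>
    (\<forall>\<alpha>. 0 < \<alpha> \<and> \<alpha> < \<alpha>0 \<longrightarrow> 0 < c \<alpha> \<and> c \<alpha> < 1) \<and>
    (\<forall>\<alpha> (N::nat) (K::nat) (T::nat).
      0 < \<alpha> \<and> \<alpha> < \<alpha>0 \<and> 1 \<le> N \<and> 1 \<le> K \<and> 1 \<le> T \<and> b * ln (1 / \<alpha>) \<le> real T \<longrightarrow>
      output_mse P R \<gamma> \<pi> \<xi> \<Phi> n \<alpha> N K T (c \<alpha>) (td_solution P R \<gamma> \<pi> \<mu> \<Phi> n)
        \<le> C1 * (1 / \<alpha>) * (1 - \<alpha> * C0) ^ T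
          + C2 * (\<alpha> * real (\<tau> \<alpha>) ^ 2 / real N)
          + C3 * (real K - 1) * \<alpha> ^ 2 * real (\<tau> \<alpha>)
          + C4 * \<alpha> ^ 3 * real (\<tau> \<alpha>) ^ 2) \<and>
    (\<exists>a C :: real. \<exists>p :: nat. 0 < a \<and> 0 < C \<and>
      (\<forall>(N::nat) (\<epsilon>::real).
        1 \<le> N \<and> 0 < \<epsilon> \<and> \<epsilon> \<le> 1 \<and> real N \<le> C * (1 / (real N * \<epsilon>)) * (1 + ln (1 / \<epsilon>)) ^ p \<longrightarrow>
        (\<exists>(T::nat) (K::nat) \<alpha>::real.
          1 \<le> K \<and> T = N * K \<and> \<alpha> = a * (ln (real N * real T) / real T) \<and>
          real T \<le> C * (1 / (real N * \<epsilon>)) * (1 + ln (1 / \<epsilon>)) ^ p \<and>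
          0 < \<alpha> \<and> \<alpha> < \<alpha>0 \<and> b * ln (1 / \<alpha>) \<le> real T \<and>
          output_mse P R \<gamma> \<pi> \<xi> \<Phi> n \<alpha> N K T (c \<alpha>) (td_solution P R \<gamma> \<pi> \<mu> \<Phi> n) \<le> \<epsilon>)))"
proof -
  let ?v = "td_solution P R \<gamma> \<pi> \<mu> \<Phi> n"
  obtain A \<kappa> a1 :: real where A: "0 < A" "0 < \<kappa>" "0 < a1" "a1 * \<kappa> \<le> 1"
    and iterate: "\<And>\<alpha> N K t. 0 < \<alpha> \<Longrightarrow> \<alpha> < a1 \<Longrightarrow> 1 \<le> N \<Longrightarrow> 1 \<le> K \<Longrightarrow>
      E (trajs P \<pi> \<xi> N (t + n))
        (\<lambda>\<omega>. (norm (agent_mean N (fed_td R \<gamma> \<Phi> n \<alpha> N K \<omega> t) - ?v))\<^sup>2)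
      \<le> A * (1 - \<kappa> * \<alpha>) ^ t + (A * (\<alpha> / real N) + (if K = 1 then A * \<alpha> ^ 3 else A * \<alpha>\<^sup>2))"
    using fed_td_mean_square[OF assms, of \<xi> R] by blast
  \<comment> \<open>Half the contraction rate of the iterates: with c = 1 - \<alpha> C0, c^2 >= 1 -
    \<kappa> \<alpha>, which is what averaging over the output time requires.\<close>
  define C0 where "C0 = \<kappa> / 2"
  \<comment> \<open>The bound 1/2 makes ln(1/\<alpha>) positive, so that \<tau> is at least
    1.\<close>
  define \<alpha>0 where "\<alpha>0 = min a1 (1 / 2)"
  define \<tau> :: "real \<Rightarrow> nat" where "\<tau> = (\<lambda>\<alpha>. nat \<lceil>ln (1 / \<alpha>)\<rceil>)"
  define c where "c = (\<lambda>\<alpha>. 1 - \<alpha> * C0)"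
  have C0: "0 < C0" using A by (simp add: C0_def)
  have a1C0: "a1 * C0 \<le> 1 / 2" using A by (simp add: C0_def)
  have \<alpha>0: "0 < \<alpha>0" "\<alpha>0 \<le> a1" "\<alpha>0 \<le> 1 / 2" using A by (auto simp: \<alpha>0_def)
  have \<alpha>C0: "0 < \<alpha> * C0" "\<alpha> * C0 \<le> 1 / 2" if "0 < \<alpha>" "\<alpha> \<le> \<alpha>0" for \<alpha>
  proof -
    have "\<alpha> * C0 \<le> a1 * C0" using that C0 \<alpha>0 by (intro mult_right_mono) auto
    then show "\<alpha> * C0 \<le> 1 / 2" using a1C0 by (rule order_trans)
    show "0 < \<alpha> * C0" using that C0 by simp
  qed
  have \<tau>: "1 \<le> \<tau> \<alpha>" "real (\<tau> \<alpha>) \<le> 1 + ln (1 / \<alpha>)" if "0 < \<alpha>" "\<alpha> < \<alpha>0" for \<alpha>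
  proof -
    have "0 < ln (1 / \<alpha>)" using that \<alpha>0 by (intro ln_gt_zero) auto
    then show "1 \<le> \<tau> \<alpha>" by (simp add: \<tau>_def Suc_le_eq)
    have "real (\<tau> \<alpha>) = of_int \<lceil>ln (1 / \<alpha>)\<rceil>"
      using \<open>0 < ln (1 / \<alpha>)\<close> by (simp add: \<tau>_def)
    then show "real (\<tau> \<alpha>) \<le> 1 + ln (1 / \<alpha>)"
      using of_int_ceiling_le_add_one[of "ln (1 / \<alpha>)"] by linarith
  qed
  have mse: "output_mse P R \<gamma> \<pi> \<xi> \<Phi> n \<alpha> N K T (c \<alpha>) ?v
        \<le> 2 * A / C0 * (1 / \<alpha>) * (1 - \<alpha> * C0) ^ T
          + A * (\<alpha> * real (\<tau> \<alpha>) ^ 2 / real N)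
          + A * (real K - 1) * \<alpha> ^ 2 * real (\<tau> \<alpha>)
          + A * \<alpha> ^ 3 * real (\<tau> \<alpha>) ^ 2"
    if \<alpha>: "0 < \<alpha>" "\<alpha> < \<alpha>0" and N: "1 \<le> N" and K: "1 \<le> K" and T: "1 \<le> T" for \<alpha> N K T
  proof -
    note \<alpha>C = \<alpha>C0[OF \<alpha>(1) less_imp_le[OF \<alpha>(2)]]
    have \<tau>1: "1 \<le> real (\<tau> \<alpha>)" using \<tau>(1)[OF \<alpha>] by simp
    then have \<tau>2: "1 \<le> real (\<tau> \<alpha>) ^ 2" by (rule one_le_power)
    let ?b = "A * (\<alpha> / real N) + (if K = 1 then A * \<alpha> ^ 3 else A * \<alpha>\<^sup>2)"
    have "output_mse P R \<gamma> \<pi> \<xi> \<Phi> n \<alpha> N K T (c \<alpha>) ?v \<le> 2 * A / (1 - c \<alpha>) * c \<alpha> ^ T + ?b"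
    proof (rule output_mse_le)
      show "0 < c \<alpha>" "c \<alpha> < 1" "1 / 2 \<le> c \<alpha>" using \<alpha>C by (auto simp: c_def)
      have k: "\<kappa> * \<alpha> = 2 * (\<alpha> * C0)" by (simp add: C0_def)
      show "0 \<le> 1 - \<kappa> * \<alpha>" unfolding k using \<alpha>C by simp
      have "(1 - x)\<^sup>2 = 1 - 2 * x + x\<^sup>2" for x :: real by (simp add: power2_eq_square algebra_simps)
      then show "1 - \<kappa> * \<alpha> \<le> (c \<alpha>)\<^sup>2" unfolding k c_def by simp
      show "0 \<le> A" using A by simp
      show "E (trajs P \<pi> \<xi> N (t + n))
        (\<lambda>\<omega>. (norm (agent_mean N (fed_td R \<gamma> \<Phi> n \<alpha> N K \<omega> t) - ?v))\<^sup>2) \<le> A * (1 - \<kappa> * \<alpha>) ^ t + ?b" for t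
        using \<alpha> \<alpha>0 N K by (intro iterate) auto
    qed (rule T)
    also have "2 * A / (1 - c \<alpha>) * c \<alpha> ^ T = 2 * A / C0 * (1 / \<alpha>) * (1 - \<alpha> * C0) ^ T"
      by (simp add: c_def mult.commute)
    also have "A * (\<alpha> / real N) \<le> A * (\<alpha> * real (\<tau> \<alpha>) ^ 2 / real N)"
      using A \<alpha> \<tau>2 mult_left_mono[OF \<tau>2, of \<alpha>] by (intro mult_left_mono divide_right_mono) auto
    also have "(if K = 1 then A * \<alpha> ^ 3 else A * \<alpha>\<^sup>2)
        \<le> A * (real K - 1) * \<alpha> ^ 2 * real (\<tau> \<alpha>) + A * \<alpha> ^ 3 * real (\<tau> \<alpha>) ^ 2"
    \<comment> \<open>For K >= 2 the factor (K - 1) \<tau> is at least 1, so \<alpha>^2 fits into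
      the third term; for K = 1 that term is zero and \<alpha>^3 goes into the fourth.\<close>
    proof (cases "K = 1")
      case True
      then show ?thesis using A \<alpha> \<tau>2 mult_left_mono[OF \<tau>2, of "A * \<alpha> ^ 3"] by simp
    next
      case False
      then have "1 \<le> real K - 1" using K by simp
      then have "1 * 1 \<le> (real K - 1) * real (\<tau> \<alpha>)" using \<tau>1 by (intro mult_mono) auto
      then have "A * \<alpha>\<^sup>2 * 1 \<le> A * \<alpha>\<^sup>2 * ((real K - 1) * real (\<tau> \<alpha>))"
        using A by (intro mult_left_mono) auto
      moreover have "0 \<le> A * \<alpha> ^ 3 * real (\<tau> \<alpha>) ^ 2" using A \<alpha> by simp
      ultimately show ?thesis using False by (simp add: mult_ac)
    qed
    finally show ?thesis by (simp add: add.assoc)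
  qed
  have C1: "0 < 2 * A / C0" using A C0 by simp
  have \<alpha>0C0: "\<alpha>0 * C0 < 1" using \<alpha>C0[OF \<alpha>0(1) order_refl] by simp
  have c: "0 < c \<alpha> \<and> c \<alpha> < 1" if "0 < \<alpha>" "\<alpha> < \<alpha>0" for \<alpha>
    using \<alpha>C0[of \<alpha>] that by (simp add: c_def)
  have O: "(\<lambda>\<alpha>. real (\<tau> \<alpha>)) \<in> O[at_right 0](\<lambda>\<alpha>. ln (1 / \<alpha>))"
    unfolding \<tau>_def by (rule nat_ceiling_ln_bigo)
  note sc = sample_complexity[OF C0 C1 A(1) A(1) A(1) \<alpha>0(1) \<alpha>0C0 \<tau>(2) mse]
  show ?thesis
    by (rule exI[of _ C0], rule exI[of _ "2 * A / C0"], rule exI[of _ A], rule exI[of _ A], rule exI[of _ A],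
        rule exI[of _ \<alpha>0], rule exI[of _ 1], rule exI[of _ \<tau>], rule exI[of _ c], intro conjI sc)
       (use C0 C1 A \<alpha>0 \<alpha>0C0 O c mse in auto)
qed

end
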